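(* Let $n\ge2$ and let $B=\sum_{k=1}^nB_k$ be a planar magnetic field which is in general position with respect to every energy $E\in(0,E^\circ]$. Then there is a constant $c>0$ such that, for each $E\in(0,E^\circ]$, the topological entropy of the flow $\Phi_E=\Phi|_{\mathbb R\times\Sigma_E}$ on the energy surface $\Sigma_E$ satisfies $$h_{top}(\Phi_E)\ge c\sqrt E .$$
   Context: **Dynamics.** $J=\begin{pmatrix}0&1\\-1&0\end{pmatrix}$. For a magnetic field $B:\mathbb R^2\to\mathbb R$ (locally Lipschitz) the motion is $\ddot q=B(q)J\dot q$; with $p=\dot q$, $\Phi(t,x)$ denotes the (complete) flow on phase space $\mathbb R^2\times\mathbb R^2\ni x=(q,p)$. The energy $H(q,p)=\frac12\|p\|^2$ is conserved; $\Sigma_E=H^{-1}(E)$ for $E>0$. Topological entropy $h_{top}$ is understood in Bowen's sense (for a not necessarily compact metric space, as a supremum over compact subsets, using the standard metric), the entropy of a flow being that of its time-one map. **Field.** $B=\sum_{k=1}^nB_k$, where each $B_k$ is locally Lipschitz, not identically zero, rotationally symmetric about a center $q_k\in\mathbb R^2$, $B_k=B_k(\|q-q_k\|)$ (the radial profile $r\mapsto B_k(r)$ is denoted by the same letter), with $\operatorname{supp}B_k\subseteq D_k:=\{\|q-q_k\|\le R_k\}$, and the closed discs $D_k$ are pairwise disjoint. Put $E^\circ(B_k)=\max_{r\ge0}\frac{(B_k(r)r)^2}{2}$ and $E^\circ=\min_kE^\circ(B_k)>0$. **Critical momenta.** For $E\in(0,E^\circ]$, $R_k^+=R_k^+(E)$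 is the largest $r>0$ with $|B_k(r)|\,r=\sqrt{2E}$ (radius of the outermost circular orbit of energy $E$ about $q_k$ for the field $B_k$). Let $\varepsilon_k\in\{1,-1\}$ be the sign of $B_k(R_k^+)\ne0$. The critical magnetic momentum is $$I_k^+=-\varepsilon_kR_k^+\sqrt{2E}-\int_{R_k^+}^{R_k}B_k(r)\,r\,dr .$$ **The arcs $A_{k,l}$, $B_{l,k}$ ($k\ne l$; depending on $E$).** For a directed straight line with unit direction $e$, its momentum about $q_k$ is $\sqrt{2E}\,\langle x-q_k,Je\rangle$ for any $x$ on the line (the angular momentum about $q_k$ of a free particle of energy $E$ moving along it; value $-R_k\sqrt{2E}$ means that the line is tangent to $D_k$ and passes it on the left, i.e. with $D_k$ on its right side; value $+R_k\sqrt{2E}$ means that it is tangent and passes $D_k$ on the right). For $a\in[-R_k\sqrt{2E},R_k\sqrt{2E}]$ and $b\in[-R_l\sqrt{2E},R_l\sqrt{2E}]$ let $\ell(a,b)$ be the unique directed line with $\langle e,q_l-q_k\rangle>0$ having momentum $a$ about $q_k$ and $b$ about $q_l$. Its exit point from $D_k$ is its intersection point $x$ with $\partial D_k$ satisfying $\langle x-q_k,e\rangle\ge0$, and its entry point into $D_l$ is its intersection point $x$ with $\partial D_l$ satisfying $\langle x-q_l,e\rangle\le0$. Consider two lines: - if $\varepsilon_k=\varepsilon_l$: the common tangent $\ell(-\varepsilon_kR_k\sqrt{2E},-\varepsilon_lR_l\sqrt{2E})$ and the critical line $\ell(I_k^+,I_l^+)$; - if $\varepsilon_k\neq\varepsilon_l$: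 the lines $\ell(-\varepsilon_kR_k\sqrt{2E},I_l^+)$ and $\ell(I_k^+,-\varepsilon_lR_l\sqrt{2E})$. In each case one of the two lines is tangent to $D_k$ and the other has momentum $I_k^+$ about $q_k$; likewise for $D_l$. $A_{k,l}\subset\partial D_k$ is the closed arc between the exit points of the two lines from $D_k$ on the side facing $D_l$: it runs from the tangency point on $\partial D_k$, clockwise if $\varepsilon_k=1$ and counterclockwise if $\varepsilon_k=-1$, to the exit point of the line with momentum $I_k^+$ about $q_k$. $B_{l,k}\subset\partial D_l$ is the closed arc between the entry points of the two lines into $D_l$ on the side facing $D_k$: it runs from the tangency point on $\partial D_l$, counterclockwise if $\varepsilon_l=1$ and clockwise if $\varepsilon_l=-1$, to the entry point of the line with momentum $I_l^+$ about $q_l$. **General position.** $B$ is in general position with respect to $E\in(0,E^\circ]$ if 1. $\operatorname{conv}(A_{k,l}\cup B_{l,k})\cap\operatorname{supp}B_m=\emptyset$ for distinct $k,l,m\in\{1,\dots,n\}$ ($\operatorname{conv}$ = convex hull), and 2. $\partial D_k\setminus\big(\bigcup_{l\ne k}A_{k,l}\cup\bigcup_{l\ne k}B_{k,l}\big)\ne\emptyset$ for all $k$. *)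

theory Defs
  imports "HOL-Analysis.Analysis"
begin

section \<open>Topological entropy\<close>

definition bowen_separated :: "('a::metric_space \<Rightarrow> 'a) \<Rightarrow> nat \<Rightarrow> real \<Rightarrow> 'a set \<Rightarrow> bool" where
  "bowen_separated T n \<epsilon> F \<longleftrightarrow>
     (\<forall>x\<in>F. \<forall>y\<in>F. x \<noteq> y \<longrightarrow> (\<exists>i<n. dist ((T ^^ i) x) ((T ^^ i) y) > \<epsilon>))"

text \<open>The logarithm is monotone, so the supremum below is the logarithm of the maximal
  cardinality of an \<open>(n, \<epsilon>)\<close>-separated subset of \<open>K\<close> (and \<open>\<infinity>\<close> if these
  cardinalities are unbounded).\<close>

definition log_separated_count :: "('a::metric_space \<Rightarrow> 'a) \<Rightarrow> 'a set \<Rightarrow> real \<Rightarrow> nat \<Rightarrow> ereal" where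
  "log_separated_count T K \<epsilon> n =
     (SUP F \<in> {F. F \<subseteq> K \<and> finite F \<and> bowen_separated T n \<epsilon> F}. ereal (ln (real (card F))))"

definition entropy_on_compact :: "('a::metric_space \<Rightarrow> 'a) \<Rightarrow> 'a set \<Rightarrow> ereal" where
  "entropy_on_compact T K =
     Lim (at_right 0) (\<lambda>\<epsilon>::real. limsup (\<lambda>n. log_separated_count T K \<epsilon> n / ereal (real n)))"

text \<open>Bowen's entropy of the restriction of \<open>T\<close> to a \<open>T\<close>-invariant set \<open>X\<close>,
  with the metric of the ambient space.\<close>

definition topological_entropy :: "'a::metric_space set \<Rightarrow> ('a \<Rightarrow> 'a) \<Rightarrow> ereal" where
  "topological_entropy X T = (SUP K \<in> {K. K \<subseteq> X \<and> compact K}. entropy_on_compact T K)"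

definition flow_entropy :: "'a::metric_space set \<Rightarrow> (real \<Rightarrow> 'a \<Rightarrow> 'a) \<Rightarrow> ereal" where
  "flow_entropy X \<Phi> = topological_entropy X (\<Phi> 1)"


section \<open>Magnetic dynamics in the plane\<close>

definition Jmat :: "real ^ 2 ^ 2" where
  "Jmat = vector [vector [0, 1], vector [-1, 0]]"

text \<open>Phase space points are pairs \<open>(q, p)\<close>; the type carries the Euclidean metric of
  four-dimensional space.\<close>

type_synonym phase = "(real ^ 2) \<times> (real ^ 2)"

definition is_magnetic_flow :: "(real ^ 2 \<Rightarrow> real) \<Rightarrow> (real \<Rightarrow> phase \<Rightarrow> phase) \<Rightarrow> bool" where
  "is_magnetic_flow B \<Phi> \<longleftrightarrow>
     (\<forall>x. \<Phi> 0 x = x \<and>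
       (\<forall>t. ((\<lambda>s. \<Phi> s x) has_vector_derivative
              (snd (\<Phi> t x), B (fst (\<Phi> t x)) *\<^sub>R (Jmat *v snd (\<Phi> t x)))) (at t)))"

definition energy :: "phase \<Rightarrow> real" where
  "energy x = (norm (snd x))\<^sup>2 / 2"

definition energy_surface :: "real \<Rightarrow> phase set" where
  "energy_surface E = {x. energy x = E}"


section \<open>Rotationally symmetric fields\<close>

text \<open>The values of \<open>profile\<close> at negative arguments are irrelevant.\<close>

record bump =
  center :: "real ^ 2"
  radius :: real
  profile :: "real \<Rightarrow> real"

definition bump_field :: "bump \<Rightarrow> real ^ 2 \<Rightarrow> real" where
  "bump_field S x = profile S (norm (x - center S))"

definition disc :: "bump \<Rightarrow> (real ^ 2) set" where
  "disc S = cball (center S) (radius S)"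

definition circle :: "bump \<Rightarrow> (real ^ 2) set" where
  "circle S = sphere (center S) (radius S)"

definition supp :: "(real ^ 2 \<Rightarrow> real) \<Rightarrow> (real ^ 2) set" where
  "supp f = closure {x. f x \<noteq> 0}"

definition magnetic_bumps :: "nat \<Rightarrow> (nat \<Rightarrow> bump) \<Rightarrow> bool" where
  "magnetic_bumps n S \<longleftrightarrow>
     (\<forall>k\<in>{1..n}.
        local_lipschitz (UNIV :: real set) UNIV (\<lambda>_. bump_field (S k)) \<and>
        (\<exists>x. bump_field (S k) x \<noteq> 0) \<and>
        supp (bump_field (S k)) \<subseteq> disc (S k)) \<and>
     (\<forall>k\<in>{1..n}. \<forall>l\<in>{1..n}. k \<noteq> l \<longrightarrow> disc (S k) \<inter> disc (S l) = {})"

definition total_field :: "nat \<Rightarrow> (nat \<Rightarrow> bump) \<Rightarrow> real ^ 2 \<Rightarrow> real" where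
  "total_field n S x = (\<Sum>k\<in>{1..n}. bump_field (S k) x)"

definition bump_critical_energy :: "bump \<Rightarrow> real" where
  "bump_critical_energy S = (SUP r\<in>{0..}. (profile S r * r)\<^sup>2 / 2)"

definition critical_energy :: "nat \<Rightarrow> (nat \<Rightarrow> bump) \<Rightarrow> real" where
  "critical_energy n S = (MIN k\<in>{1..n}. bump_critical_energy (S k))"


section \<open>Critical momenta\<close>

definition outer_radius :: "real \<Rightarrow> bump \<Rightarrow> real" where
  "outer_radius E S = (GREATEST r. r > 0 \<and> \<bar>profile S r\<bar> * r = sqrt (2 * E))"

definition outer_sign :: "real \<Rightarrow> bump \<Rightarrow> real" where
  "outer_sign E S = sgn (profile S (outer_radius E S))"

definition critical_momentum :: "real \<Rightarrow> bump \<Rightarrow> real" where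
  "critical_momentum E S =
     - outer_sign E S * outer_radius E S * sqrt (2 * E)
     - integral {outer_radius E S..radius S} (\<lambda>r. profile S r * r)"

definition tangent_momentum :: "real \<Rightarrow> bump \<Rightarrow> real" where
  "tangent_momentum E S = - outer_sign E S * radius S * sqrt (2 * E)"


section \<open>Directed lines\<close>

text \<open>A directed line is a pair \<open>(L, e)\<close> of a line \<open>L\<close> and its unit direction \<open>e\<close>.\<close>

type_synonym dline = "(real ^ 2) set \<times> (real ^ 2)"

definition is_dline :: "dline \<Rightarrow> bool" where
  "is_dline l \<longleftrightarrow> norm (snd l) = 1 \<and> (\<exists>x. fst l = range (\<lambda>t. x + t *\<^sub>R snd l))"

definition has_momentum :: "real \<Rightarrow> real ^ 2 \<Rightarrow> dline \<Rightarrow> real \<Rightarrow> bool" where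
  "has_momentum E c l a \<longleftrightarrow> (\<forall>x\<in>fst l. sqrt (2 * E) * ((x - c) \<bullet> (Jmat *v snd l)) = a)"

text \<open>The line \<open>\<ell>(a, b)\<close> going from the bump \<open>S\<close> to the bump \<open>S'\<close>.\<close>

definition ell :: "real \<Rightarrow> bump \<Rightarrow> bump \<Rightarrow> real \<Rightarrow> real \<Rightarrow> dline" where
  "ell E S S' a b =
     (THE l. is_dline l \<and> snd l \<bullet> (center S' - center S) > 0 \<and>
        has_momentum E (center S) l a \<and> has_momentum E (center S') l b)"

definition exit_point :: "bump \<Rightarrow> dline \<Rightarrow> real ^ 2" where
  "exit_point S l = (THE x. x \<in> circle S \<inter> fst l \<and> (x - center S) \<bullet> snd l \<ge> 0)"

definition entry_point :: "bump \<Rightarrow> dline \<Rightarrow> real ^ 2" where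
  "entry_point S l = (THE x. x \<in> circle S \<inter> fst l \<and> (x - center S) \<bullet> snd l \<le> 0)"


section \<open>Arcs\<close>

definition rotation :: "real \<Rightarrow> real ^ 2 ^ 2" where
  "rotation \<theta> = vector [vector [cos \<theta>, - sin \<theta>], vector [sin \<theta>, cos \<theta>]]"

text \<open>The points met when moving from \<open>u\<close> on the circle about \<open>c\<close>, counterclockwise
  for \<open>\<sigma> = 1\<close> and clockwise for \<open>\<sigma> = -1\<close>, until \<open>v\<close> is reached for the first time;
  both end points are included.\<close>

definition circle_arc :: "real \<Rightarrow> real ^ 2 \<Rightarrow> real ^ 2 \<Rightarrow> real ^ 2 \<Rightarrow> (real ^ 2) set" where
  "circle_arc \<sigma> c u v =
     {c + rotation (\<sigma> * \<theta>) *v (u - c) | \<theta>.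
        0 \<le> \<theta> \<and> (\<forall>\<psi>. 0 \<le> \<psi> \<and> \<psi> < \<theta> \<longrightarrow> c + rotation (\<sigma> * \<psi>) *v (u - c) \<noteq> v)}"

text \<open>Of the two lines from \<open>S\<close> to \<open>S'\<close> that bound the arcs, \<open>source_tangent\<close> is the one
  tangent to the disc of \<open>S\<close> and \<open>source_critical\<close> the one with critical momentum about the
  centre of \<open>S\<close>; \<open>target_tangent\<close> and \<open>target_critical\<close> are the same two lines distinguished
  by their behaviour at \<open>S'\<close>.\<close>

definition source_tangent :: "real \<Rightarrow> bump \<Rightarrow> bump \<Rightarrow> dline" where
  "source_tangent E S S' =
     (if outer_sign E S = outer_sign E S'
      then ell E S S' (tangent_momentum E S) (tangent_momentum E S')
      else ell E S S' (tangent_momentum E S) (critical_momentum E S'))"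

definition source_critical :: "real \<Rightarrow> bump \<Rightarrow> bump \<Rightarrow> dline" where
  "source_critical E S S' =
     (if outer_sign E S = outer_sign E S'
      then ell E S S' (critical_momentum E S) (critical_momentum E S')
      else ell E S S' (critical_momentum E S) (tangent_momentum E S'))"

definition target_tangent :: "real \<Rightarrow> bump \<Rightarrow> bump \<Rightarrow> dline" where
  "target_tangent E S S' =
     (if outer_sign E S = outer_sign E S'
      then ell E S S' (tangent_momentum E S) (tangent_momentum E S')
      else ell E S S' (critical_momentum E S) (tangent_momentum E S'))"

definition target_critical :: "real \<Rightarrow> bump \<Rightarrow> bump \<Rightarrow> dline" where
  "target_critical E S S' =
     (if outer_sign E S = outer_sign E S'
      then ell E S S' (critical_momentum E S) (critical_momentum E S')
      else ell E S S' (tangent_momentum E S) (critical_momentum E S'))"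

text \<open>\<open>exit_arc E (S k) (S l)\<close> is the arc \<open>A\<^sub>k\<^sub>,\<^sub>l\<close> of the circle of \<open>S k\<close>.\<close>

definition exit_arc :: "real \<Rightarrow> bump \<Rightarrow> bump \<Rightarrow> (real ^ 2) set" where
  "exit_arc E S S' =
     circle_arc (- outer_sign E S) (center S)
       (exit_point S (source_tangent E S S')) (exit_point S (source_critical E S S'))"

text \<open>\<open>entry_arc E (S l) (S k)\<close> is the arc \<open>B\<^sub>l\<^sub>,\<^sub>k\<close> of the circle of \<open>S l\<close>: the first bump
  is the one that is entered, the second one the origin of the lines.\<close>

definition entry_arc :: "real \<Rightarrow> bump \<Rightarrow> bump \<Rightarrow> (real ^ 2) set" where
  "entry_arc E S' S =
     circle_arc (outer_sign E S') (center S')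
       (entry_point S' (target_tangent E S S')) (entry_point S' (target_critical E S S'))"


section \<open>General position\<close>

definition general_position :: "nat \<Rightarrow> (nat \<Rightarrow> bump) \<Rightarrow> real \<Rightarrow> bool" where
  "general_position n S E \<longleftrightarrow>
     (\<forall>k\<in>{1..n}. \<forall>l\<in>{1..n}. \<forall>m\<in>{1..n}. k \<noteq> l \<longrightarrow> k \<noteq> m \<longrightarrow> l \<noteq> m \<longrightarrow>
        (convex hull (exit_arc E (S k) (S l) \<union> entry_arc E (S l) (S k)))
          \<inter> supp (bump_field (S m)) = {}) \<and>
     (\<forall>k\<in>{1..n}.
        circle (S k) - ((\<Union>l\<in>{1..n} - {k}. exit_arc E (S k) (S l))
          \<union> (\<Union>l\<in>{1..n} - {k}. entry_arc E (S k) (S l))) \<noteq> {})"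

end

theory Submission
  imports Defs
begin

text \<open>
  Two of the bumps already produce the required entropy. Consider a particle of energy \<open>E\<close>, hence of
  speed \<open>s = sqrt (2 E)\<close>, that runs to and fro between them. On its way through a bump it keeps its
  angular momentum about the centre, and only its direction is turned. An orbit that passes outside
  the outermost circular orbit is determined, up to a rotation, by its smallest distance \<open>\<rho>\<close> from
  the centre. The turn depends continuously on \<open>\<rho>\<close>; it tends to \<open>0\<close> at the boundary of the disc
  (\<open>turns_small_near_boundary\<close>) and to infinity at the circular orbit
  (\<open>turns_large_near_circular_orbit\<close>). So the number of revolutions during a passage can be chosen.

  An orbit corresponds to a sequence of momenta, each of which has to fit to its two neighbours: the
  turn in the bump must lead from the incoming to the outgoing line. For prescribed revolution
  numbers, each of these equations can be solved for the momentum in its middle, and the solution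
  with the largest turning radius is an increasing function of the two neighbouring momenta. Tarski's fixed point theorem
  then solves all equations at once (\<open>monotone_chain_fixpoint\<close>, \<open>chain_solution\<close>), and every sequence of
  admissible revolution numbers belongs to an orbit (\<open>itinerary_exists\<close>).

  The momenta of these orbits lie between the critical and the tangent ones. Since the positions of
  the exit and entry points are monotone functions of the momenta, the flights start and end in the
  arcs (\<open>exit_and_entry_in_arcs\<close>), and by general position they do not meet other bumps.

  The integral of the field along an orbit is a continuous lift of the direction of motion. Along two
  orbits which stay close for all times up to some bound the lifts stay close. Each flight has a
  direction close to an integer multiple of \<open>\<pi>\<close>, and these integers determine the revolution numbers;
  so orbits with different words are separated (\<open>close_imp_same_word\<close>). With four or five revolutions
  about the first bump as symbols, there are \<open>2 ^ L\<close> words of length \<open>L\<close>, and the entropy is at least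
  \<open>ln 2\<close> divided by the time for one symbol.

  Finally, this time is at most a constant divided by \<open>s\<close>, with the same constant for all energies. This
  is clear for the flights. For the passages it is \<open>angle_lower_bound\<close>: \<open>s\<close> times the duration is
  bounded in terms of the turn, the radius of the disc and a lower bound for the radius of the
  circular orbit; and this radius is smallest at the largest energy (\<open>outer_radius_antimono\<close>).
\<close>

section \<open>Lower bounds for the entropy\<close>

lemma log_separated_count_antimono:
  assumes "\<epsilon> \<le> \<epsilon>'"
  shows "log_separated_count T K \<epsilon>' n \<le> log_separated_count T K \<epsilon> n"
proof -
  have "bowen_separated T n \<epsilon> F" if "bowen_separated T n \<epsilon>' F" for F
    using that assms unfolding bowen_separated_def by (meson order_le_less_trans)
  then show ?thesis
    unfolding log_separated_count_def by (intro SUP_subset_mono) auto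
qed

text \<open>Bowen's entropy is written as a limit for \<open>\<epsilon> \<rightarrow> 0\<close>. The limit exists because the quantity can only
  grow when \<open>\<epsilon>\<close> shrinks, and it is then the supremum; so one fixed resolution already gives a
  lower bound.\<close>

lemma antimono_tendsto_at_right_0:
  fixes f :: "real \<Rightarrow> ereal"
  assumes anti: "\<And>x y. 0 < x \<Longrightarrow> x \<le> y \<Longrightarrow> f y \<le> f x"
  shows "(f \<longlongrightarrow> (SUP x\<in>{0<..}. f x)) (at_right 0)"
proof (rule increasing_tendsto)
  show "\<forall>\<^sub>F x in at_right 0. f x \<le> (SUP x\<in>{0<..}. f x)"
    by (auto simp: eventually_at_right_field intro!: SUP_upper exI[of _ 1])
next
  fix l assume "l < (SUP x\<in>{0<..}. f x)"
  then obtain e where e: "e > 0" "l < f e"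
    by (auto simp: less_SUP_iff)
  show "\<forall>\<^sub>F x in at_right 0. l < f x"
    unfolding eventually_at_right_field
    using e anti by (intro exI[of _ e]) (auto intro: order_less_le_trans)
qed

lemma entropy_on_compact_ge:
  assumes "0 < \<epsilon>"
  shows "limsup (\<lambda>n. log_separated_count T K \<epsilon> n / ereal (real n)) \<le> entropy_on_compact T K"
proof -
  let ?f = "\<lambda>\<epsilon>::real. limsup (\<lambda>n. log_separated_count T K \<epsilon> n / ereal (real n))"
  have "?f y \<le> ?f x" if "0 < x" "x \<le> y" for x y
    using log_separated_count_antimono[OF that(2)]
    by (intro Limsup_mono eventually_mono[OF eventually_gt_at_top[of 0]] ereal_divide_right_mono) auto
  then have "(?f \<longlongrightarrow> (SUP x\<in>{0<..}. ?f x)) (at_right 0)"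
    by (rule antimono_tendsto_at_right_0)
  then have "entropy_on_compact T K = (SUP x\<in>{0<..}. ?f x)"
    unfolding entropy_on_compact_def by (intro tendsto_Lim) auto
  then show ?thesis
    using assms by (auto intro: SUP_upper)
qed

text \<open>This is how positive entropy is produced: words of length \<open>L\<close> over two symbols are told apart
  within time \<open>a L + b\<close> at a fixed resolution. The additive \<open>b\<close> disappears in the exponential
  growth rate.\<close>

lemma topological_entropy_ge_ln2_over:
  assumes K: "K \<subseteq> X" "compact K" and "0 < \<epsilon>" and "0 < a"
    and sep: "\<And>L. \<exists>F. F \<subseteq> K \<and> finite F \<and> card F = 2 ^ L \<and>
       (\<forall>n. real n \<ge> a * real L + b \<longrightarrow> bowen_separated T n \<epsilon> F)"
  shows "ereal (ln 2 / a) \<le> topological_entropy X T"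
proof -
  define L where "L n = nat \<lfloor>(real n - b) / a\<rfloor>" for n
  \<comment> \<open>within time \<open>n\<close> all words of length \<open>L n\<close> can be distinguished; the \<open>- 1\<close> pays for rounding down\<close>
  have bound: "ereal (ln 2 * ((real n - b) / a - 1) / real n)
      \<le> log_separated_count T K \<epsilon> n / ereal (real n)" if n: "n > 0" "real n \<ge> b" for n
  proof -
    obtain F where F: "F \<subseteq> K" "finite F" "card F = 2 ^ L n"
      "\<forall>m. real m \<ge> a * real (L n) + b \<longrightarrow> bowen_separated T m \<epsilon> F"
      using sep by blast
    have nn: "0 \<le> (real n - b) / a"
      using n \<open>0 < a\<close> by auto
    have "real (L n) \<le> (real n - b) / a"
      unfolding L_def using nn by simp
    then have "a * real (L n) + b \<le> real n"
      using \<open>0 < a\<close> by (simp add: field_simps)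
    then have "bowen_separated T n \<epsilon> F"
      using F(4) by blast
    then have "ereal (ln (real (card F))) \<le> log_separated_count T K \<epsilon> n"
      unfolding log_separated_count_def using F by (intro SUP_upper) auto
    moreover have "ln (real (card F)) = real (L n) * ln 2"
      using F by (simp add: ln_realpow)
    moreover have "(real n - b) / a - 1 \<le> real (L n)"
      unfolding L_def using nn by linarith
    then have "((real n - b) / a - 1) * ln 2 \<le> real (L n) * ln 2"
      by (intro mult_right_mono) auto
    ultimately have "ereal (ln 2 * ((real n - b) / a - 1)) \<le> log_separated_count T K \<epsilon> n"
      by (metis ereal_less_eq(3) mult.commute order_trans)
    from ereal_divide_right_mono[OF this, of "ereal (real n)"] show ?thesis
      using n by (simp add: field_simps)
  qed
  have "(\<lambda>n. ln 2 * ((real n - b) / a - 1) / real n) \<longlonglongrightarrow> ln 2 * (1 / a)"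
  proof -
    have "(\<lambda>n. ln 2 * (1 / a - (b / a + 1) * (1 / real n))) \<longlonglongrightarrow> ln 2 * (1 / a - (b / a + 1) * 0)"
      by (intro tendsto_intros lim_1_over_n)
    moreover have "\<forall>\<^sub>F n in sequentially. ln 2 * (1 / a - (b / a + 1) * (1 / real n))
        = ln 2 * ((real n - b) / a - 1) / real n"
      using eventually_gt_at_top[of 0] by eventually_elim (use \<open>0 < a\<close> in \<open>simp add: field_simps\<close>)
    ultimately show ?thesis
      by (auto elim: Lim_transform_eventually)
  qed
  then have "(\<lambda>n. ereal (ln 2 * ((real n - b) / a - 1) / real n)) \<longlonglongrightarrow> ereal (ln 2 / a)"
    by (simp del: times_divide_eq_left)
  then have "ereal (ln 2 / a) = limsup (\<lambda>n. ereal (ln 2 * ((real n - b) / a - 1) / real n))"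
    by (intro lim_imp_Limsup[symmetric] trivial_limit_sequentially)
  also have "\<dots> \<le> limsup (\<lambda>n. log_separated_count T K \<epsilon> n / ereal (real n))"
  proof (rule Limsup_mono)
    obtain N where "real N \<ge> b"
      using real_arch_simple by blast
    then show "\<forall>\<^sub>F n in sequentially. ereal (ln 2 * ((real n - b) / a - 1) / real n)
        \<le> log_separated_count T K \<epsilon> n / ereal (real n)"
      unfolding eventually_sequentially by (intro exI[of _ "max 1 N"] allI impI bound) auto
  qed
  also have "\<dots> \<le> entropy_on_compact T K"
    by (rule entropy_on_compact_ge[OF \<open>0 < \<epsilon>\<close>])
  also have "\<dots> \<le> topological_entropy X T"
    unfolding topological_entropy_def using K by (intro SUP_upper) auto
  finally show ?thesis .
qed

section \<open>Chains of equations that are monotone in their neighbours\<close>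

text \<open>Each unknown is a monotone function of its two neighbours. On the product of intervals, ordered
  pointwise, this is a monotone map of a complete lattice, so Tarski's argument applies: the
  supremum of all post-fixed points is a fixed point. All equations of an
  infinite orbit are solved at once in this way.\<close>

lemma monotone_chain_fixpoint:
  fixes g :: "nat \<Rightarrow> real \<Rightarrow> real \<Rightarrow> real" and lo hi :: "nat \<Rightarrow> real"
  assumes box: "\<And>j x y. lo j \<le> x \<Longrightarrow> x \<le> hi j \<Longrightarrow> lo (Suc (Suc j)) \<le> y \<Longrightarrow> y \<le> hi (Suc (Suc j))
      \<Longrightarrow> lo (Suc j) \<le> g (Suc j) x y \<and> g (Suc j) x y \<le> hi (Suc j)"
    and mono: "\<And>j x y x' y'. lo j \<le> x \<Longrightarrow> x \<le> x' \<Longrightarrow> x' \<le> hi j \<Longrightarrow> lo (Suc (Suc j)) \<le> y \<Longrightarrow> y \<le> y'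
      \<Longrightarrow> y' \<le> hi (Suc (Suc j)) \<Longrightarrow> g (Suc j) x y \<le> g (Suc j) x' y'"
    and c0: "lo 0 \<le> c0" "c0 \<le> hi 0"
    and lohi: "\<And>j. lo j \<le> hi j"
  obtains c where "c 0 = c0" "\<And>j. lo j \<le> c j \<and> c j \<le> hi j"
    "\<And>j. c (Suc j) = g (Suc j) (c j) (c (Suc (Suc j)))"
proof -
  define Box where "Box = {c. c 0 = c0 \<and> (\<forall>j. lo j \<le> c j \<and> c j \<le> hi j)}"
  define Pre where "Pre = {c \<in> Box. \<forall>j. c (Suc j) \<le> g (Suc j) (c j) (c (Suc (Suc j)))}"
  define C where "C j = (SUP c\<in>Pre. c j)" for j
  have bottom: "(\<lambda>j. if j = 0 then c0 else lo j) \<in> Pre"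
    using c0 lohi unfolding Pre_def Box_def by (auto intro!: conjunct1[OF box])
  have bdd: "bdd_above ((\<lambda>c. c j) ` Pre)" for j
    by (rule bdd_aboveI[of _ "hi j"]) (auto simp: Pre_def Box_def)
  have upper: "c j \<le> C j" if "c \<in> Pre" for c j
    unfolding C_def using that bdd by (intro cSUP_upper) auto
  have least: "C j \<le> x" if "\<And>c. c \<in> Pre \<Longrightarrow> c j \<le> x" for j x
    unfolding C_def using that bottom by (intro cSUP_least) auto
  have C0: "C 0 = c0"
    using upper[OF bottom, of 0] least[of 0 c0] by (force simp: Pre_def Box_def)
  have C_box: "lo j \<le> C j" "C j \<le> hi j" for j
    using upper[OF bottom, of j] c0 by (auto split: if_splits intro!: least simp: Pre_def Box_def)
  have CBox: "C \<in> Box"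
    using C0 C_box by (auto simp: Box_def)
  have pre: "C (Suc j) \<le> g (Suc j) (C j) (C (Suc (Suc j)))" for j
  proof (rule least)
    fix c assume c: "c \<in> Pre"
    then have "c (Suc j) \<le> g (Suc j) (c j) (c (Suc (Suc j)))"
      by (auto simp: Pre_def)
    also have "\<dots> \<le> g (Suc j) (C j) (C (Suc (Suc j)))"
      using c C_box upper[OF c] by (intro mono) (auto simp: Pre_def Box_def)
    finally show "c (Suc j) \<le> g (Suc j) (C j) (C (Suc (Suc j)))" .
  qed
  define D where "D j = (case j of 0 \<Rightarrow> c0 | Suc i \<Rightarrow> g (Suc i) (C i) (C (Suc (Suc i))))" for j
  have CD: "C j \<le> D j" for j
    using pre C0 by (auto simp: D_def split: nat.splits)
  have DBox: "D \<in> Box"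
    using c0 box C_box by (auto simp: D_def Box_def split: nat.splits)
  have "D (Suc j) \<le> g (Suc j) (D j) (D (Suc (Suc j)))" for j
  proof -
    have "D (Suc j) = g (Suc j) (C j) (C (Suc (Suc j)))"
      by (simp add: D_def)
    also have "\<dots> \<le> g (Suc j) (D j) (D (Suc (Suc j)))"
      using C_box CD DBox by (intro mono) (auto simp: Box_def)
    finally show ?thesis .
  qed
  then have "D \<in> Pre"
    using DBox by (auto simp: Pre_def)
  then have "D j \<le> C j" for j
    by (rule upper)
  then have "C j = D j" for j
    using CD by (simp add: antisym)
  then have "C (Suc j) = g (Suc j) (C j) (C (Suc (Suc j)))" for j
    by (metis D_def nat.case(2))
  then show ?thesis
    using that C0 C_box by blast
qed

text \<open>The largest root, when \<open>f\<close> is continuous and changes sign from nonnegative to negative. The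
  choice of the largest root is monotone in \<open>f\<close>.\<close>

definition last_nonneg :: "real \<Rightarrow> real \<Rightarrow> (real \<Rightarrow> real) \<Rightarrow> real" where
  "last_nonneg v u f = Sup {x. v \<le> x \<and> x \<le> u \<and> 0 \<le> f x}"

lemma last_nonneg_root:
  assumes cont: "continuous_on {v..u} f" and "v \<le> u" and v: "0 \<le> f v" and u: "f u < 0"
  shows "v \<le> last_nonneg v u f" "last_nonneg v u f \<le> u" "f (last_nonneg v u f) = 0"
proof -
  let ?Z = "{x. v \<le> x \<and> x \<le> u \<and> 0 \<le> f x}"
  have "?Z = {v..u} \<inter> f -` {0..}" by auto
  then have "closed ?Z"
    using continuous_closed_preimage[OF cont] by simp
  moreover have bdd: "bdd_above ?Z" by (rule bdd_aboveI[of _ u]) simp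
  moreover have ne: "?Z \<noteq> {}" using \<open>v \<le> u\<close> v by auto
  ultimately have in_Z: "last_nonneg v u f \<in> ?Z"
    unfolding last_nonneg_def by (intro closed_contains_Sup)
  then show 1: "v \<le> last_nonneg v u f" "last_nonneg v u f \<le> u" by auto
  have "\<exists>x\<ge>last_nonneg v u f. x \<le> u \<and> f x = 0"
    using in_Z u 1 continuous_on_subset[OF cont, of "{last_nonneg v u f..u}"] by (intro IVT2') auto
  then obtain x where x: "last_nonneg v u f \<le> x" "x \<le> u" "f x = 0" by blast
  then have "x \<in> ?Z" using 1 by simp
  then have "x \<le> last_nonneg v u f"
    unfolding last_nonneg_def using bdd by (rule cSup_upper)
  then show "f (last_nonneg v u f) = 0" using x by simp
qed

lemma last_nonneg_mono:
  assumes "v \<le> u" "0 \<le> f v" "\<And>x. v \<le> x \<Longrightarrow> x \<le> u \<Longrightarrow> f x \<le> g x"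
  shows "last_nonneg v u f \<le> last_nonneg v u g"
  unfolding last_nonneg_def
proof (rule cSup_subset_mono)
  show "{x. v \<le> x \<and> x \<le> u \<and> 0 \<le> f x} \<noteq> {}" using assms by auto
  show "bdd_above {x. v \<le> x \<and> x \<le> u \<and> 0 \<le> g x}" by (rule bdd_aboveI[of _ u]) simp
  show "{x. v \<le> x \<and> x \<le> u \<and> 0 \<le> f x} \<subseteq> {x. v \<le> x \<and> x \<le> u \<and> 0 \<le> g x}"
    using assms(3) by (auto intro: order_trans)
qed

text \<open>The matching conditions of an orbit that runs to and fro between two bumps. The unknowns
  \<open>\<rho> j\<close> are turning radii, \<open>c j = \<gamma> j (\<rho> j)\<close> the momenta, \<open>A j\<close> half of the angle by which the
  bump turns the orbit, and the two arcsines are the inclinations of the lines after and before the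
  \<open>j\<close>-th passage; their difference, plus \<open>\<pi>\<close> for the reversal, is the turn which the passage must
  produce modulo \<open>2 \<pi>\<close>. The integers \<open>m j\<close> count the revolutions and can be prescribed, since
  \<open>A j\<close> covers a range of several revolutions.

  Both inclinations change in the same direction when one of the neighbouring momenta grows. If
  \<open>\<rho> j\<close> is the largest solution of its own equation, this makes \<open>c j\<close> an increasing function of
  \<open>c (j - 1)\<close> and \<open>c (j + 1)\<close>, whatever the sign \<open>\<epsilon> j\<close> is, so that
  \<open>monotone_chain_fixpoint\<close> solves all equations simultaneously.\<close>

lemma chain_solution:
  fixes A \<gamma> :: "nat \<Rightarrow> real \<Rightarrow> real" and u v \<epsilon> m K :: "nat \<Rightarrow> real" and D c0 :: real
  assumes vu: "\<And>j. v j \<le> u j" and A_cont: "\<And>j. continuous_on {v j..u j} (A j)"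
    and \<gamma>_cont: "\<And>j. continuous_on {v j..u j} (\<gamma> j)"
    and \<epsilon>: "\<And>j. \<epsilon> j * \<epsilon> j = 1"
    and \<gamma>_mono: "\<And>j x y. v j \<le> x \<Longrightarrow> x \<le> y \<Longrightarrow> y \<le> u j \<Longrightarrow> - \<epsilon> j * \<gamma> j x \<le> - \<epsilon> j * \<gamma> j y"
    and \<gamma>_bound: "\<And>j x. v j \<le> x \<Longrightarrow> x \<le> u j \<Longrightarrow> \<bar>\<gamma> j x\<bar> \<le> K j"
    and K: "\<And>j. K j + K (Suc j) < D" and c0: "\<bar>c0\<bar> \<le> K 0"
    and A_low: "\<And>j. 2 * A j (u j) + 2 * pi \<le> 2 * pi * m j"
    and A_high: "\<And>j. 2 * pi * m j + 2 * pi \<le> 2 * A j (v j)"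
  obtains \<rho> c where "c 0 = c0" "\<And>j. c (Suc j) = \<gamma> (Suc j) (\<rho> (Suc j))"
    "\<And>j. v (Suc j) \<le> \<rho> (Suc j)" "\<And>j. \<rho> (Suc j) \<le> u (Suc j)"
    "\<And>j. 2 * A (Suc j) (\<rho> (Suc j)) = 2 * pi * m (Suc j)
       - \<epsilon> (Suc j) * (pi + arcsin ((c (Suc j) - c (Suc (Suc j))) / D) - arcsin ((c j - c (Suc j)) / D))"
proof -
  \<comment> \<open>defect of the \<open>j\<close>-th equation when the neighbouring momenta are \<open>x\<close> and \<open>y\<close>; the second arcsine has its sign absorbed\<close>
  define P where "P j x y \<rho> = 2 * A j \<rho> + \<epsilon> j * (pi + arcsin ((\<gamma> j \<rho> - y) / D) + arcsin ((\<gamma> j \<rho> - x) / D)) - 2 * pi * m j"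
    for j x y \<rho>
  define r where "r j x y = last_nonneg (v j) (u j) (P j x y)" for j x y
  have \<epsilon>_cases: "\<epsilon> j = 1 \<or> \<epsilon> j = - 1" for j
    using \<epsilon>[of j] by (simp add: square_eq_1_iff)
  have K0: "0 \<le> K j" for j
    using \<gamma>_bound[of j "v j"] vu[of j] abs_ge_zero[of "\<gamma> j (v j)"] by linarith
  have D: "0 < D" using K[of 0] K0[of 0] K0[of 1] by simp
  have arg: "- 1 < (x - y) / D \<and> (x - y) / D < 1"
    if "\<bar>x\<bar> \<le> K j \<and> \<bar>y\<bar> \<le> K (Suc j) \<or> \<bar>x\<bar> \<le> K (Suc j) \<and> \<bar>y\<bar> \<le> K j" for j x y
  proof -
    have "- D < x - y" "x - y < D" using that K[of j] by linarith+
    then show ?thesis using D by (simp add: pos_less_divide_eq pos_divide_less_eq)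
  qed
  have bracket: "0 < pi + arcsin ((z - y) / D) + arcsin ((z - x) / D) \<and>
      pi + arcsin ((z - y) / D) + arcsin ((z - x) / D) < 2 * pi"
    if "\<bar>x\<bar> \<le> K j" "\<bar>z\<bar> \<le> K (Suc j)" "\<bar>y\<bar> \<le> K (Suc (Suc j))" for j x y z
    using arcsin_lt_bounded[of "(z - y) / D"] arcsin_lt_bounded[of "(z - x) / D"]
      arg[of z "Suc j" y] arg[of z j x] that by simp
  have P_cont: "continuous_on {v (Suc j)..u (Suc j)} (P (Suc j) x y)"
    and P_v: "0 \<le> P (Suc j) x y (v (Suc j))" and P_u: "P (Suc j) x y (u (Suc j)) < 0"
    if xy: "\<bar>x\<bar> \<le> K j" "\<bar>y\<bar> \<le> K (Suc (Suc j))" for j x y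
  proof -
    have b: "\<bar>\<gamma> (Suc j) \<rho>\<bar> \<le> K (Suc j)" if "\<rho> \<in> {v (Suc j)..u (Suc j)}" for \<rho>
      using \<gamma>_bound that by auto
    show "continuous_on {v (Suc j)..u (Suc j)} (P (Suc j) x y)"
      unfolding P_def
    proof (intro continuous_intros A_cont \<gamma>_cont ballI)
      fix \<rho> assume "\<rho> \<in> {v (Suc j)..u (Suc j)}"
      from b[OF this] show "- 1 \<le> (\<gamma> (Suc j) \<rho> - y) / D \<and> (\<gamma> (Suc j) \<rho> - y) / D \<le> 1"
          "- 1 \<le> (\<gamma> (Suc j) \<rho> - x) / D \<and> (\<gamma> (Suc j) \<rho> - x) / D \<le> 1"
        using arg[of "\<gamma> (Suc j) \<rho>" "Suc j" y] arg[of "\<gamma> (Suc j) \<rho>" j x] xy by auto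
    qed (use D in auto)
    have br: "- (2 * pi) < \<epsilon> (Suc j) * (pi + arcsin ((\<gamma> (Suc j) \<rho> - y) / D) + arcsin ((\<gamma> (Suc j) \<rho> - x) / D)) \<and>
       \<epsilon> (Suc j) * (pi + arcsin ((\<gamma> (Suc j) \<rho> - y) / D) + arcsin ((\<gamma> (Suc j) \<rho> - x) / D)) < 2 * pi"
      if "\<rho> \<in> {v (Suc j)..u (Suc j)}" for \<rho>
      using bracket[OF xy(1) b[OF that] xy(2)] \<epsilon>_cases[of "Suc j"] by auto
    show "0 \<le> P (Suc j) x y (v (Suc j))"
      using br[of "v (Suc j)"] A_high[of "Suc j"] vu[of "Suc j"] by (simp add: P_def)
    show "P (Suc j) x y (u (Suc j)) < 0"
      using br[of "u (Suc j)"] A_low[of "Suc j"] vu[of "Suc j"] by (simp add: P_def)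
  qed
  have r_root: "v (Suc j) \<le> r (Suc j) x y" "r (Suc j) x y \<le> u (Suc j)" "P (Suc j) x y (r (Suc j) x y) = 0"
    if xy: "\<bar>x\<bar> \<le> K j" "\<bar>y\<bar> \<le> K (Suc (Suc j))" for j x y
    unfolding r_def using last_nonneg_root[OF P_cont[OF xy] vu P_v[OF xy] P_u[OF xy]] by auto
  obtain c where c: "c 0 = c0" "\<And>j. - K j \<le> c j \<and> c j \<le> K j"
    "\<And>j. c (Suc j) = \<gamma> (Suc j) (r (Suc j) (c j) (c (Suc (Suc j))))"
  proof (rule monotone_chain_fixpoint[of "\<lambda>j. - K j" K "\<lambda>j x y. \<gamma> j (r j x y)" c0])
    fix j x y assume "- K j \<le> x" "x \<le> K j" "- K (Suc (Suc j)) \<le> y" "y \<le> K (Suc (Suc j))"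
    then have xy: "\<bar>x\<bar> \<le> K j" "\<bar>y\<bar> \<le> K (Suc (Suc j))" by auto
    show "- K (Suc j) \<le> \<gamma> (Suc j) (r (Suc j) x y) \<and> \<gamma> (Suc j) (r (Suc j) x y) \<le> K (Suc j)"
      using \<gamma>_bound[OF r_root(1,2)[OF xy]] by auto
  next
    fix j x y x' y'
    assume h: "- K j \<le> x" "x \<le> x'" "x' \<le> K j" "- K (Suc (Suc j)) \<le> y" "y \<le> y'" "y' \<le> K (Suc (Suc j))"
    then have xy: "\<bar>x\<bar> \<le> K j" "\<bar>y\<bar> \<le> K (Suc (Suc j))" and xy': "\<bar>x'\<bar> \<le> K j" "\<bar>y'\<bar> \<le> K (Suc (Suc j))"
      by auto
    have less: "arcsin ((\<gamma> (Suc j) \<rho> - y') / D) + arcsin ((\<gamma> (Suc j) \<rho> - x') / D)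
        \<le> arcsin ((\<gamma> (Suc j) \<rho> - y) / D) + arcsin ((\<gamma> (Suc j) \<rho> - x) / D)"
      if "v (Suc j) \<le> \<rho>" "\<rho> \<le> u (Suc j)" for \<rho>
    proof -
      have z: "\<bar>\<gamma> (Suc j) \<rho>\<bar> \<le> K (Suc j)" by (rule \<gamma>_bound[OF that])
      show ?thesis
        using arg[of "\<gamma> (Suc j) \<rho>" "Suc j" y] arg[of "\<gamma> (Suc j) \<rho>" j x]
          arg[of "\<gamma> (Suc j) \<rho>" "Suc j" y'] arg[of "\<gamma> (Suc j) \<rho>" j x'] z xy xy' h D
        by (intro add_mono arcsin_le_arcsin divide_right_mono) auto
    qed
    show "\<gamma> (Suc j) (r (Suc j) x y) \<le> \<gamma> (Suc j) (r (Suc j) x' y')"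
    \<comment> \<open>growing neighbours lower the defect for one sign and raise it for the other, but \<open>\<gamma>\<close> reverses its monotonicity as well\<close>
    proof (cases "\<epsilon> (Suc j) = 1")
      case True
      have "r (Suc j) x' y' \<le> r (Suc j) x y"
        unfolding r_def using less True by (intro last_nonneg_mono vu P_v xy') (auto simp: P_def)
      then show ?thesis
        using \<gamma>_mono[OF r_root(1)[OF xy'] _ r_root(2)[OF xy]] True by simp
    next
      case False
      then have e: "\<epsilon> (Suc j) = - 1" using \<epsilon>_cases by blast
      have "P (Suc j) x y \<rho> \<le> P (Suc j) x' y' \<rho>" if "v (Suc j) \<le> \<rho>" "\<rho> \<le> u (Suc j)" for \<rho>
        using less[OF that] e by (simp add: P_def)
      then have "r (Suc j) x y \<le> r (Suc j) x' y'"
        unfolding r_def by (intro last_nonneg_mono vu P_v xy)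
      then show ?thesis
        using \<gamma>_mono[OF r_root(1)[OF xy] _ r_root(2)[OF xy']] e by simp
    qed
  next
    fix c assume "c 0 = c0" "\<And>j. - K j \<le> c j \<and> c j \<le> K j"
      "\<And>j. c (Suc j) = \<gamma> (Suc j) (r (Suc j) (c j) (c (Suc (Suc j))))"
    then show thesis by (rule that)
  next
    show "- K 0 \<le> c0" "c0 \<le> K 0" using c0 by (simp_all add: abs_le_iff)
    show "- K j \<le> K j" for j using K0[of j] by simp
  qed
  have cK: "\<bar>c j\<bar> \<le> K j" for j using c(2)[of j] by auto
  define \<rho> where "\<rho> j = r j (c (j - 1)) (c (Suc j))" for j
  have eq: "P (Suc j) (c j) (c (Suc (Suc j))) (\<rho> (Suc j)) = 0" for j
    unfolding \<rho>_def using r_root(3)[OF cK cK, of j] by simp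
  have \<gamma>\<rho>: "c (Suc j) = \<gamma> (Suc j) (\<rho> (Suc j))" for j
    using c(3)[of j] by (simp add: \<rho>_def)
  show thesis
  proof (rule that[of c \<rho>])
    fix j
    have "arcsin ((c (Suc j) - c j) / D) = arcsin (- ((c j - c (Suc j)) / D))"
      by (simp add: minus_divide_left)
    also have "\<dots> = - arcsin ((c j - c (Suc j)) / D)"
      using arg[of "c j" j "c (Suc j)"] cK by (intro arcsin_minus) auto
    finally show "2 * A (Suc j) (\<rho> (Suc j)) = 2 * pi * m (Suc j)
       - \<epsilon> (Suc j) * (pi + arcsin ((c (Suc j) - c (Suc (Suc j))) / D) - arcsin ((c j - c (Suc j)) / D))"
      using eq[of j] by (simp add: P_def \<gamma>\<rho>[symmetric])
    show "v (Suc j) \<le> \<rho> (Suc j)" "\<rho> (Suc j) \<le> u (Suc j)"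
      using r_root(1,2)[OF cK cK, of j] by (simp_all add: \<rho>_def)
  qed (use c(1) \<gamma>\<rho> in auto)
qed

section \<open>Calculus on an interval\<close>

text \<open>Gronwall's inequality in the form used for the continuous dependence on initial values: the
  function \<open>exp (- 2 K t) (norm (z t))\<^sup>2\<close> does not increase.\<close>

lemma gronwall_norm:
  fixes z z' :: "real \<Rightarrow> 'a::real_inner"
  assumes deriv: "\<And>t. 0 \<le> t \<Longrightarrow> t \<le> T \<Longrightarrow> (z has_vector_derivative z' t) (at t)"
    and bound: "\<And>t. 0 \<le> t \<Longrightarrow> t \<le> T \<Longrightarrow> norm (z' t) \<le> K * norm (z t)"
    and "0 \<le> T"
  shows "norm (z T) \<le> exp (K * T) * norm (z 0)"
proof -
  define u where "u t = exp (- 2 * K * t) * (z t \<bullet> z t)" for t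
  have "u T \<le> u 0"
  proof (rule DERIV_nonpos_imp_nonincreasing[OF \<open>0 \<le> T\<close>])
    fix t assume t: "0 \<le> t" "t \<le> T"
    have d: "((\<lambda>t. z t \<bullet> z t) has_real_derivative 2 * (z t \<bullet> z' t)) (at t)"
      using has_derivative_inner[OF deriv[OF t, unfolded has_vector_derivative_def]
          deriv[OF t, unfolded has_vector_derivative_def]]
      unfolding has_field_derivative_def
      by (rule has_derivative_eq_rhs) (auto simp: inner_commute algebra_simps)
    have "(u has_real_derivative exp (- 2 * K * t) * (2 * (z t \<bullet> z' t) - 2 * K * (z t \<bullet> z t))) (at t)"
      unfolding u_def
      by (rule derivative_eq_intros d refl)+ (simp add: algebra_simps)
    moreover have "z t \<bullet> z' t \<le> K * (z t \<bullet> z t)"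
    proof -
      have "z t \<bullet> z' t \<le> norm (z t) * norm (z' t)"
        by (rule norm_cauchy_schwarz)
      also have "\<dots> \<le> norm (z t) * (K * norm (z t))"
        using bound[OF t] by (intro mult_left_mono) auto
      finally show ?thesis
        by (simp add: power2_norm_eq_inner[symmetric] power2_eq_square algebra_simps)
    qed
    ultimately show "\<exists>y. (u has_real_derivative y) (at t) \<and> y \<le> 0"
      by (intro exI conjI) (auto simp: mult_le_0_iff)
  qed
  then have "exp (- (2 * K * T)) * (norm (z T))\<^sup>2 \<le> (norm (z 0))\<^sup>2"
    by (simp add: u_def power2_norm_eq_inner)
  then have "(norm (z T))\<^sup>2 \<le> exp (2 * K * T) * (norm (z 0))\<^sup>2"
    by (simp add: exp_minus field_simps)
  also have "\<dots> = (exp (K * T) * norm (z 0))\<^sup>2"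
    by (simp add: power_mult_distrib exp_double[symmetric] mult.assoc)
  finally show ?thesis
    by (rule power2_le_imp_le) simp
qed

lemma first_hitting_time:
  fixes f :: "real \<Rightarrow> real"
  assumes cont: "continuous_on {0..T} f" and "f 0 \<le> c" "c \<le> f T" "0 \<le> T"
  obtains t where "0 \<le> t" "t \<le> T" "f t = c" "\<And>u. 0 \<le> u \<Longrightarrow> u < t \<Longrightarrow> f u < c"
proof -
  let ?Z = "{0..T} \<inter> f -` {c..}"
  have "closed ?Z"
    by (rule continuous_closed_preimage[OF cont]) auto
  then have "compact ?Z"
    using compact_Int_closed[OF compact_Icc[of 0 T], of ?Z] by (simp add: Int_assoc[symmetric])
  moreover have "T \<in> ?Z"
    using assms by auto
  ultimately obtain t where t: "t \<in> ?Z" "\<And>u. u \<in> ?Z \<Longrightarrow> t \<le> u"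
    using compact_attains_inf[of ?Z] by blast
  have below: "f u < c" if "0 \<le> u" "u < t" for u
    using t that by force
  have "f t = c"
  proof (rule antisym)
    have "\<exists>x. 0 \<le> x \<and> x \<le> t \<and> f x = c"
      using t assms continuous_on_subset[OF cont, of "{0..t}"] by (intro IVT') auto
    then show "f t \<le> c"
      using below by (metis less_le order_refl)
  qed (use t in auto)
  then show ?thesis
    using that t below by auto
qed

lemma has_real_derivative_pos_imp_increasing_open:
  fixes f f' :: "real \<Rightarrow> real"
  assumes "a < b" and "continuous_on {a..b} f"
    and "\<And>x. a < x \<Longrightarrow> x < b \<Longrightarrow> (f has_real_derivative f' x) (at x)"
    and "\<And>x. a < x \<Longrightarrow> x < b \<Longrightarrow> 0 < f' x"
  shows "f a < f b"
  by (rule DERIV_pos_imp_increasing_open[OF assms(1) _ assms(2)]) (use assms in blast)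

section \<open>Radial motion in a rotationally symmetric field\<close>

text \<open>The motion of a particle of speed \<open>s\<close> in one rotationally symmetric field, reduced by the
  symmetry. Here \<open>\<beta>\<close> is the radial profile multiplied by the sign \<open>\<epsilon>\<close> of the field on the outermost
  circular orbit, whose radius is \<open>a\<close>; outside that circle the field is too weak for a circular
  orbit of speed \<open>s\<close>. The field vanishes from radius \<open>R\<close> on. The larger radius \<open>R'\<close> leaves a rim on
  which other bumps are not yet felt, so that a trajectory can be followed a little beyond its exit.\<close>

locale whirl =
  fixes \<beta> :: "real \<Rightarrow> real" and a R R' s Lp :: real
  assumes a_pos: "0 < a" and a_less: "a < R" and R_less: "R < R'" and s_pos: "0 < s"
    and crit: "\<beta> a * a = s"
    and sub: "\<And>r. a < r \<Longrightarrow> r \<le> R' \<Longrightarrow> \<bar>\<beta> r\<bar> * r < s"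
    and off: "\<And>r. R \<le> r \<Longrightarrow> r \<le> R' \<Longrightarrow> \<beta> r = 0"
    and lip: "Lp-lipschitz_on {a..R'} \<beta>"
begin

text \<open>A trajectory starts at its closest approach to the centre, at distance \<open>\<rho>\<close>. With the position \<open>x\<close>
  relative to the centre and the velocity \<open>p\<close>, the coordinates are \<open>r = |x|\<close>, \<open>W = \<langle>x, p\<rangle>\<close>, the
  angular momentum \<open>\<Lambda> = - \<epsilon> \<langle>x, J p\<rangle>\<close> and the accumulated turn \<open>A\<close> of the velocity. The equations
  are claimed only where the particle is not at the centre and not outside radius \<open>R'\<close>. Because of
  the factor \<open>\<epsilon>\<close> the same system describes the orbit before its closest approach with time
  reversed.\<close>

definition traj ::
  "real \<Rightarrow> (real \<Rightarrow> real) \<Rightarrow> (real \<Rightarrow> real) \<Rightarrow> (real \<Rightarrow> real) \<Rightarrow> (real \<Rightarrow> real) \<Rightarrow> bool" where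
  "traj \<rho> r W \<Lambda> A \<longleftrightarrow>
     continuous_on {0..} r \<and> r 0 = \<rho> \<and> W 0 = 0 \<and> \<Lambda> 0 = \<rho> * s \<and> A 0 = 0 \<and>
     (\<forall>t\<ge>0. 0 < r t \<and> r t \<le> R' \<longrightarrow>
        (r has_real_derivative W t / r t) (at t) \<and>
        (W has_real_derivative s\<^sup>2 - \<beta> (r t) * \<Lambda> t) (at t) \<and>
        (\<Lambda> has_real_derivative \<beta> (r t) * W t) (at t) \<and>
        (A has_real_derivative \<beta> (r t)) (at t) \<and>
        (W t)\<^sup>2 + (\<Lambda> t)\<^sup>2 = (r t * s)\<^sup>2)"

text \<open>A trajectory together with the time \<open>\<tau>\<close> at which it leaves the disc and the time \<open>T\<close> at which it
  reaches the end of the rim.\<close>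

definition passage ::
  "real \<Rightarrow> (real \<Rightarrow> real) \<Rightarrow> (real \<Rightarrow> real) \<Rightarrow> (real \<Rightarrow> real) \<Rightarrow> (real \<Rightarrow> real) \<Rightarrow> real \<Rightarrow> real \<Rightarrow> bool" where
  "passage \<rho> r W \<Lambda> A \<tau> T \<longleftrightarrow> traj \<rho> r W \<Lambda> A \<and> 0 < \<tau> \<and> \<tau> < T \<and> r \<tau> = R \<and> r T = R' \<and>
     (\<forall>t. 0 \<le> t \<and> t \<le> T \<longrightarrow> \<rho> \<le> r t \<and> r t \<le> R') \<and> (\<forall>t. 0 < t \<and> t \<le> T \<longrightarrow> 0 < W t)"

lemma R_pos: "0 < R" and R'_pos: "0 < R'"
  using a_pos a_less R_less by auto

lemma lip_nonneg: "0 \<le> Lp"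
  using lip by (rule lipschitz_on_nonneg)

lemma sub_le: "a \<le> r \<Longrightarrow> r \<le> R' \<Longrightarrow> \<bar>\<beta> r\<bar> * r \<le> s"
  using sub[of r] crit a_pos s_pos by (cases "r = a") (auto simp: abs_mult[symmetric] less_imp_le)

lemma \<beta>_bound:
  assumes "a \<le> r" "r \<le> R'"
  shows "\<bar>\<beta> r\<bar> \<le> s / a"
proof -
  have "\<bar>\<beta> r\<bar> * a \<le> \<bar>\<beta> r\<bar> * r"
    using assms by (intro mult_left_mono) auto
  then show ?thesis
    using sub_le[OF assms] a_pos by (simp add: field_simps)
qed

lemma \<beta>_diff:
  assumes "a \<le> r" "r \<le> R'" "a \<le> r'" "r' \<le> R'"
  shows "\<bar>\<beta> r - \<beta> r'\<bar> \<le> Lp * \<bar>r - r'\<bar>"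
  using lipschitz_onD[OF lip, of r r'] assms by (auto simp: dist_real_def)

lemma traj_derivs:
  assumes "traj \<rho> r W \<Lambda> A" "0 \<le> t" "0 < r t" "r t \<le> R'"
  shows "(r has_real_derivative W t / r t) (at t)"
    and "(W has_real_derivative s\<^sup>2 - \<beta> (r t) * \<Lambda> t) (at t)"
    and "(\<Lambda> has_real_derivative \<beta> (r t) * W t) (at t)"
    and "(A has_real_derivative \<beta> (r t)) (at t)"
    and "(W t)\<^sup>2 + (\<Lambda> t)\<^sup>2 = (r t * s)\<^sup>2"
  using assms by (auto simp: traj_def)

lemma traj_bounds:
  assumes "traj \<rho> r W \<Lambda> A" "0 \<le> t" "0 < r t" "r t \<le> R'"
  shows "\<bar>W t\<bar> \<le> r t * s" "\<bar>\<Lambda> t\<bar> \<le> r t * s"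
proof -
  note eq = traj_derivs(5)[OF assms]
  have "(W t)\<^sup>2 \<le> (r t * s)\<^sup>2" "(\<Lambda> t)\<^sup>2 \<le> (r t * s)\<^sup>2"
    using eq zero_le_power2[of "W t"] zero_le_power2[of "\<Lambda> t"] by linarith+
  then show "\<bar>W t\<bar> \<le> r t * s" "\<bar>\<Lambda> t\<bar> \<le> r t * s"
    using assms s_pos by (simp_all add: abs_le_square_iff[symmetric])
qed

lemma \<beta>\<Lambda>_bound:
  assumes "traj \<rho> r W \<Lambda> A" "0 \<le> t" "a \<le> r t" "r t \<le> R'"
  shows "\<beta> (r t) * \<Lambda> t \<le> \<bar>\<beta> (r t)\<bar> * r t * s"
proof -
  have "\<beta> (r t) * \<Lambda> t \<le> \<bar>\<beta> (r t)\<bar> * \<bar>\<Lambda> t\<bar>"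
    by (metis abs_ge_self abs_mult)
  also have "\<dots> \<le> \<bar>\<beta> (r t)\<bar> * (r t * s)"
    using traj_bounds[OF assms(1,2)] assms a_pos by (intro mult_left_mono) auto
  finally show ?thesis
    by (simp add: mult.assoc)
qed

lemma W_deriv_nonneg:
  assumes "traj \<rho> r W \<Lambda> A" "0 \<le> t" "a \<le> r t" "r t \<le> R'"
  shows "0 \<le> s\<^sup>2 - \<beta> (r t) * \<Lambda> t"
proof -
  have "\<bar>\<beta> (r t)\<bar> * r t * s \<le> s * s"
    using sub_le[OF assms(3,4)] s_pos by (intro mult_right_mono) auto
  then show ?thesis
    using \<beta>\<Lambda>_bound[OF assms] by (simp add: power2_eq_square)
qed

text \<open>Away from the circular orbit the second derivative of \<open>r\<^sup>2 / 2\<close>, which is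
  \<open>s\<^sup>2 - \<beta> (r) \<Lambda>\<close>, is bounded below, because \<open>|\<Lambda>| \<le> r s\<close>. Hence the distance from the centre grows
  at least quadratically.\<close>

lemma growth:
  assumes tr: "traj \<rho> r W \<Lambda> A" and "a \<le> \<rho>'" "0 \<le> \<kappa>"
    and \<kappa>: "\<And>x. \<rho>' \<le> x \<Longrightarrow> x \<le> R' \<Longrightarrow> \<kappa> \<le> s\<^sup>2 - \<bar>\<beta> x\<bar> * x * s"
    and range: "\<And>t. 0 \<le> t \<Longrightarrow> t \<le> T \<Longrightarrow> \<rho>' \<le> r t \<and> r t \<le> R'"
    and t: "0 \<le> t" "t \<le> T"
  shows "\<kappa> * t \<le> W t" "\<rho>\<^sup>2 + \<kappa> * t\<^sup>2 \<le> (r t)\<^sup>2"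
proof -
  have pos: "0 < r u" "a \<le> r u" "r u \<le> R'" if "0 \<le> u" "u \<le> T" for u
    using range[OF that] \<open>a \<le> \<rho>'\<close> a_pos by auto
  have W: "\<kappa> * u \<le> W u" if u: "0 \<le> u" "u \<le> T" for u
  proof -
    have "W 0 - \<kappa> * 0 \<le> W u - \<kappa> * u"
    proof (rule DERIV_nonneg_imp_nondecreasing[OF u(1)])
      fix v assume v: "0 \<le> v" "v \<le> u"
      then have v': "v \<le> T" using u by simp
      have "((\<lambda>u. W u - \<kappa> * u) has_real_derivative (s\<^sup>2 - \<beta> (r v) * \<Lambda> v) - \<kappa>) (at v)"
        using traj_derivs(2)[OF tr v(1) pos(1,3)[OF v(1) v']]
        by (auto intro!: derivative_eq_intros)
      moreover have "\<kappa> \<le> s\<^sup>2 - \<beta> (r v) * \<Lambda> v"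
        using \<beta>\<Lambda>_bound[OF tr v(1) pos(2,3)[OF v(1) v']] \<kappa>[of "r v"] range[OF v(1) v'] by linarith
      ultimately show "\<exists>y. ((\<lambda>u. W u - \<kappa> * u) has_real_derivative y) (at v) \<and> 0 \<le> y"
        by (intro exI conjI) auto
    qed
    then show ?thesis
      using tr by (simp add: traj_def)
  qed
  then show "\<kappa> * t \<le> W t"
    using t by blast
  have "(r 0)\<^sup>2 - \<kappa> * 0\<^sup>2 \<le> (r t)\<^sup>2 - \<kappa> * t\<^sup>2"
  proof (rule DERIV_nonneg_imp_nondecreasing[OF t(1)])
    fix v assume v: "0 \<le> v" "v \<le> t"
    then have v': "v \<le> T" using t by simp
    have "((\<lambda>u. (r u)\<^sup>2 - \<kappa> * u\<^sup>2) has_real_derivative 2 * W v - 2 * \<kappa> * v) (at v)"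
      using traj_derivs(1)[OF tr v(1) pos(1,3)[OF v(1) v']] pos(1)[OF v(1) v']
      by (auto intro!: derivative_eq_intros simp: power2_eq_square)
    then show "\<exists>y. ((\<lambda>u. (r u)\<^sup>2 - \<kappa> * u\<^sup>2) has_real_derivative y) (at v) \<and> 0 \<le> y"
      using W[OF v(1) v'] by (intro exI conjI) auto
  qed
  then show "\<rho>\<^sup>2 + \<kappa> * t\<^sup>2 \<le> (r t)\<^sup>2"
    using tr by (simp add: traj_def)
qed

text \<open>The convexity of \<open>r\<^sup>2\<close> is available only outside radius \<open>a\<close>. A trajectory cannot return to a
  radius \<open>\<rho>'\<close> between \<open>a\<close> and \<open>\<rho>\<close>, since up to the first return the convexity would have kept it
  beyond \<open>\<rho>\<close>.\<close>

lemma stays_outside: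
  assumes tr: "traj \<rho> r W \<Lambda> A" and \<rho>: "a < \<rho>"
    and below: "\<And>t. 0 \<le> t \<Longrightarrow> t \<le> T \<Longrightarrow> r t \<le> R'"
    and t: "0 \<le> t" "t \<le> T"
  shows "\<rho> \<le> r t"
proof -
  define \<rho>' where "\<rho>' = (a + \<rho>) / 2"
  have \<rho>': "a < \<rho>'" "\<rho>' < \<rho>"
    using \<rho> by (auto simp: \<rho>'_def)
  have *: "\<rho> \<le> r u" if u: "0 \<le> u" "\<And>v. 0 \<le> v \<Longrightarrow> v \<le> u \<Longrightarrow> \<rho>' \<le> r v \<and> r v \<le> R'" for u
  proof -
    have "0 \<le> s\<^sup>2 - \<bar>\<beta> x\<bar> * x * s" if "\<rho>' \<le> x" "x \<le> R'" for x
      using mult_right_mono[OF sub_le[of x], of s] that \<rho>' s_pos by (simp add: power2_eq_square)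
    from growth(2)[OF tr _ _ this u(2), of u] have "\<rho>\<^sup>2 \<le> (r u)\<^sup>2"
      using \<rho>' u(1) by auto
    moreover have "0 \<le> r u"
      using u(2)[of u] u(1) \<rho>' a_pos by auto
    ultimately show ?thesis
      using power2_le_imp_le by blast
  qed
  have r0: "r 0 = \<rho>" and cont: "continuous_on {0..} r"
    using tr by (auto simp: traj_def)
  have low: "\<rho>' < r u" if u: "0 \<le> u" "u \<le> T" for u
  proof (rule ccontr)
    assume "\<not> \<rho>' < r u"
    then have "- r 0 \<le> - \<rho>'" "- \<rho>' \<le> - r u"
      using \<rho>' r0 by auto
    moreover have "continuous_on {0..u} (\<lambda>t. - r t)"
      by (intro continuous_intros continuous_on_subset[OF cont]) auto
    ultimately obtain t1 where t1: "0 \<le> t1" "t1 \<le> u" "r t1 = \<rho>'"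
        and min: "\<And>v. 0 \<le> v \<Longrightarrow> v < t1 \<Longrightarrow> - r v < - \<rho>'"
      using first_hitting_time[of u "\<lambda>t. - r t" "- \<rho>'"] u by auto
    have "\<rho> \<le> r t1"
    proof (rule *[OF t1(1)])
      fix v assume "0 \<le> v" "v \<le> t1"
      then show "\<rho>' \<le> r v \<and> r v \<le> R'"
        using min[of v] t1 below[of v] u by (cases "v = t1") auto
    qed
    then show False
      using t1 \<rho>' by simp
  qed
  show ?thesis
    using * low below t by (meson less_imp_le order_trans)
qed

lemma uniform_acceleration:
  assumes "a < \<rho>"
  obtains \<kappa> where "0 < \<kappa>" "\<And>x. \<rho> \<le> x \<Longrightarrow> x \<le> R' \<Longrightarrow> \<kappa> \<le> s\<^sup>2 - \<bar>\<beta> x\<bar> * x * s"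
proof (cases "\<rho> \<le> R'")
  case True
  have "continuous_on {a..R'} \<beta>"
    using lip by (rule lipschitz_on_continuous_on)
  then have "continuous_on {\<rho>..R'} \<beta>"
    by (rule continuous_on_subset) (use assms in auto)
  then have cont: "continuous_on {\<rho>..R'} (\<lambda>x. s\<^sup>2 - \<bar>\<beta> x\<bar> * x * s)"
    by (intro continuous_intros)
  have "{\<rho>..R'} \<noteq> {}"
    using True by simp
  from continuous_attains_inf[OF compact_Icc this cont] obtain x0 where x0: "x0 \<in> {\<rho>..R'}"
      "\<And>x. x \<in> {\<rho>..R'} \<Longrightarrow> s\<^sup>2 - \<bar>\<beta> x0\<bar> * x0 * s \<le> s\<^sup>2 - \<bar>\<beta> x\<bar> * x * s"
    by blast
  have "\<bar>\<beta> x0\<bar> * x0 * s < s * s"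
    using sub[of x0] x0 assms s_pos by (intro mult_strict_right_mono) auto
  then show ?thesis
    using x0 by (intro that[of "s\<^sup>2 - \<bar>\<beta> x0\<bar> * x0 * s"]) (auto simp: power2_eq_square)
qed (use that[of 1] in auto)

text \<open>Quadratic growth of \<open>r\<^sup>2\<close> forces every trajectory that turns outside the circular orbit to leave.\<close>

lemma escape:
  assumes tr: "traj \<rho> r W \<Lambda> A" and \<rho>: "a < \<rho>" "\<rho> < R"
  obtains \<tau> T where "passage \<rho> r W \<Lambda> A \<tau> T"
proof -
  obtain \<kappa> where \<kappa>: "0 < \<kappa>" "\<And>x. \<rho> \<le> x \<Longrightarrow> x \<le> R' \<Longrightarrow> \<kappa> \<le> s\<^sup>2 - \<bar>\<beta> x\<bar> * x * s"
    using uniform_acceleration[OF \<rho>(1)] by blast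
  have r0: "r 0 = \<rho>" and cont: "continuous_on {0..} r"
    using tr by (auto simp: traj_def)
  have range: "\<rho> \<le> r u \<and> r u \<le> R'" if "\<And>t. 0 \<le> t \<Longrightarrow> t \<le> T \<Longrightarrow> r t \<le> R'" "0 \<le> u" "u \<le> T" for u T
    using stays_outside[OF tr \<rho>(1) that(1), of T u] that by auto
  \<comment> \<open>by \<open>growth\<close>, staying below radius \<open>R' + 1\<close> is impossible after this time\<close>
  define T0 where "T0 = (R' + 1) / sqrt \<kappa>"
  have T0: "0 \<le> T0" "\<kappa> * T0\<^sup>2 = (R' + 1)\<^sup>2"
    using \<kappa>(1) R'_pos by (auto simp: T0_def power_divide)
  have "\<exists>u. 0 \<le> u \<and> u \<le> T0 \<and> R' < r u"
  proof (rule ccontr)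
    assume "\<not> ?thesis"
    then have b: "r u \<le> R'" if "0 \<le> u" "u \<le> T0" for u
      using that by force
    have rg: "\<rho> \<le> r u \<and> r u \<le> R'" if "0 \<le> u" "u \<le> T0" for u
      using range[OF b that] by simp
    have "\<rho>\<^sup>2 + \<kappa> * T0\<^sup>2 \<le> (r T0)\<^sup>2"
      by (rule growth(2)[OF tr _ _ \<kappa>(2) rg T0(1)]) (use \<rho> \<kappa>(1) in auto)
    moreover have "(r T0)\<^sup>2 \<le> R'\<^sup>2"
      by (rule power_mono) (use rg[OF T0(1)] \<rho> a_pos in auto)
    moreover have "R'\<^sup>2 < (R' + 1)\<^sup>2"
      using R'_pos by (intro power_strict_mono) auto
    ultimately show False
      using T0 zero_le_power2[of \<rho>] by linarith
  qed
  then obtain u where u: "0 \<le> u" "R' < r u" by blast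
  obtain T where T: "0 \<le> T" "r T = R'" and min: "\<And>v. 0 \<le> v \<Longrightarrow> v < T \<Longrightarrow> r v < R'"
    using first_hitting_time[of u r R'] u r0 \<rho> R_less continuous_on_subset[OF cont, of "{0..u}"] by auto
  have below: "r v \<le> R'" if "0 \<le> v" "v \<le> T" for v
    using min[of v] T that by (cases "v = T") auto
  note rg = range[OF below]
  have W: "0 < W v" if "0 < v" "v \<le> T" for v
  proof -
    have "\<kappa> * v \<le> W v"
      by (rule growth(1)[OF tr _ _ \<kappa>(2) rg, of T]) (use that \<rho> \<kappa>(1) in auto)
    then show ?thesis
      using mult_pos_pos[OF \<kappa>(1) that(1)] by linarith
  qed
  obtain \<tau> where \<tau>: "0 \<le> \<tau>" "\<tau> \<le> T" "r \<tau> = R"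
    using IVT'[of r 0 R T] T r0 \<rho> R_less continuous_on_subset[OF cont, of "{0..T}"] by auto
  have "\<tau> \<noteq> 0" "\<tau> \<noteq> T"
    using \<tau> r0 \<rho> T R_less by auto
  then show ?thesis
    using \<tau> T tr rg W by (intro that[of \<tau> T]) (auto simp: passage_def)
qed

lemma passage_range:
  assumes "passage \<rho> r W \<Lambda> A \<tau> T" "a \<le> \<rho>" "0 \<le> t" "t \<le> T"
  shows "0 < r t" "a \<le> r t" "r t \<le> R'"
proof -
  have "\<rho> \<le> r t \<and> r t \<le> R'"
    using assms by (auto simp: passage_def)
  then show "0 < r t" "a \<le> r t" "r t \<le> R'"
    using assms(2) a_pos by auto
qed

lemma passage_strict_mono:
  assumes p: "passage \<rho> r W \<Lambda> A \<tau> T" "a \<le> \<rho>" and tu: "0 \<le> t" "t < u" "u \<le> T"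
  shows "r t < r u"
proof (rule has_real_derivative_pos_imp_increasing_open[OF tu(2)])
  have "continuous_on {0..} r" using p by (auto simp: passage_def traj_def)
  then show "continuous_on {t..u} r"
    by (rule continuous_on_subset) (use tu in auto)
next
  fix x assume x: "t < x" "x < u"
  then show "(r has_real_derivative W x / r x) (at x)"
    using p tu passage_range[OF p, of x] by (intro traj_derivs(1)) (auto simp: passage_def)
  show "0 < W x / r x"
    using p x tu passage_range[OF p, of x] by (auto simp: passage_def)
qed

lemma passage_inside:
  assumes p: "passage \<rho> r W \<Lambda> A \<tau> T" "a \<le> \<rho>" and t: "0 \<le> t" "t \<le> \<tau>"
  shows "r t \<le> R"
  using passage_strict_mono[OF p, of t \<tau>] p t by (cases "t = \<tau>") (auto simp: passage_def)

lemma passage_angle_after_exit: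
  assumes p: "passage \<rho> r W \<Lambda> A \<tau> T" "a \<le> \<rho>" and t: "R \<le> r t" "0 \<le> t" "t \<le> T"
  shows "A t = A \<tau>"
proof -
  have "\<tau> \<le> t"
    using passage_strict_mono[OF p, of t \<tau>] p t by (force simp: passage_def)
  have "(A has_real_derivative 0) (at x within {\<tau>..t})" if "x \<in> {\<tau>..t}" for x
  proof -
    have x: "0 \<le> x" "x \<le> T" "\<tau> \<le> x"
      using that t p by (auto simp: passage_def)
    have "R \<le> r x"
      using passage_strict_mono[OF p, of \<tau> x] p x by (cases "x = \<tau>") (auto simp: passage_def)
    then have "\<beta> (r x) = 0"
      using passage_range[OF p x(1,2)] by (intro off) auto
    then show ?thesis
      using traj_derivs(4)[OF _ x(1), of \<rho> r W \<Lambda> A] p passage_range[OF p x(1,2)]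
      by (auto simp: passage_def intro: has_field_derivative_at_within)
  qed
  then have "A t = A \<tau>"
    using has_field_derivative_zero_constant[of "{\<tau>..t}" A] \<open>\<tau> \<le> t\<close> by force
  then show ?thesis .
qed

end

section \<open>Duration and turn of a passage\<close>

lemma abs_mult_diff_le:
  fixes x y x' y' :: real
  assumes "\<bar>x\<bar> \<le> X" "\<bar>y'\<bar> \<le> Y" "\<bar>x - x'\<bar> \<le> P" "\<bar>y - y'\<bar> \<le> Q"
  shows "\<bar>x * y - x' * y'\<bar> \<le> X * Q + P * Y"
proof -
  have "\<bar>x * y - x' * y'\<bar> = \<bar>x * (y - y') + (x - x') * y'\<bar>"
    by (simp add: algebra_simps)
  also have "\<dots> \<le> \<bar>x\<bar> * \<bar>y - y'\<bar> + \<bar>x - x'\<bar> * \<bar>y'\<bar>"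
    by (metis abs_mult abs_triangle_ineq)
  also have "\<dots> \<le> X * Q + P * Y"
    using assms by (intro add_mono mult_mono) auto
  finally show ?thesis .
qed

context whirl
begin

text \<open>\<open>r s + \<Lambda>\<close> does not decrease, since \<open>|\<beta> (r)| r \<le> s\<close>. It follows that a negative \<open>\<Lambda>\<close> stays away from
  \<open>- r s\<close>, so that the radial speed is then bounded below.\<close>

lemma \<Lambda>_lower:
  assumes p: "passage \<rho> r W \<Lambda> A \<tau> T" "a \<le> \<rho>" and t: "0 \<le> t" "t \<le> T"
  shows "2 * \<rho> * s \<le> r t * s + \<Lambda> t"
proof -
  have tr: "traj \<rho> r W \<Lambda> A"
    using p by (simp add: passage_def)
  have "r 0 * s + \<Lambda> 0 \<le> r t * s + \<Lambda> t"
  proof (rule DERIV_nonneg_imp_nondecreasing[OF t(1)])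
    fix u assume u: "0 \<le> u" "u \<le> t"
    then have u': "u \<le> T" using t by simp
    note rg = passage_range[OF p u(1) u']
    have d: "((\<lambda>u. r u * s + \<Lambda> u) has_real_derivative W u / r u * s + \<beta> (r u) * W u) (at u)"
      using traj_derivs(1,3)[OF tr u(1) rg(1,3)] by (auto intro!: derivative_eq_intros)
    have "0 \<le> W u"
      using p u u' tr by (cases "u = 0") (auto simp: passage_def traj_def less_imp_le)
    moreover have "0 \<le> s + \<beta> (r u) * r u"
      using sub_le[OF rg(2,3)] abs_mult[of "\<beta> (r u)" "r u"] rg(1) by auto
    moreover have "W u / r u * s + \<beta> (r u) * W u = W u * (s + \<beta> (r u) * r u) / r u"
      using rg(1) by (simp add: field_simps)
    ultimately have "0 \<le> W u / r u * s + \<beta> (r u) * W u"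
      using rg(1) by simp
    then show "\<exists>y. ((\<lambda>u. r u * s + \<Lambda> u) has_real_derivative y) (at u) \<and> 0 \<le> y"
      using d by blast
  qed
  then show ?thesis
    using tr by (simp add: traj_def)
qed

text \<open>The time spent inside the disc is controlled by the turn of the velocity, with constants that
  depend on the geometry but on the energy only through a lower bound \<open>a0\<close> for \<open>a\<close>. This is what
  makes the entropy estimate proportional to the square root of the energy. The mechanism is a
  pointwise inequality \<open>\<beta> \<ge> s / (2 R) - C\<^sub>1 W' / s - C\<^sub>2 W\<close>: where \<open>\<Lambda> < 0\<close> the particle moves outwards fast
  and the last term dominates; where \<open>\<beta> \<Lambda> < s\<^sup>2 / 2\<close> it accelerates outwards and the middle term
  dominates; elsewhere \<open>\<beta> \<ge> s / (2 R)\<close>. The integrals of \<open>W'\<close> and \<open>W\<close> over the passage are bounded by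
  \<open>R s\<close> and \<open>R\<^sup>2 / 2\<close>.\<close>

lemma angle_lower_bound:
  assumes p: "passage \<rho> r W \<Lambda> A \<tau> T" "a \<le> \<rho>" and a0: "0 < a0" "a0 \<le> a"
  defines "k \<equiv> 1 / (2 * R) + 1 / a0"
  shows "s * \<tau> / (2 * R) - (2 * k * R + k / a0 * R\<^sup>2 / 2) \<le> A \<tau>"
proof -
  have tr: "traj \<rho> r W \<Lambda> A" and \<tau>: "0 < \<tau>" "\<tau> < T" "r \<tau> = R"
    using p by (auto simp: passage_def)
  have k: "0 < k" "1 / (2 * R) < k" "1 / a0 < k"
    using a0 R_pos by (auto simp: k_def intro: add_pos_pos)
  define \<kappa> where "\<kappa> = 1 / (2 * R)"
  have \<kappa>: "0 < \<kappa>" "k = \<kappa> + 1 / a0"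
    using R_pos by (auto simp: \<kappa>_def k_def)
  \<comment> \<open>the integrated form of the pointwise inequality is the monotonicity of \<open>u\<close>\<close>
  define u where "u t = A t - \<kappa> * s * t + 2 * k * (W t / s) + k / a0 * ((r t)\<^sup>2 / 2)" for t
  have "0 \<le> \<tau>" using \<tau> by simp
  then have "u 0 \<le> u \<tau>"
  proof (rule DERIV_nonneg_imp_nondecreasing)
    fix t assume t: "0 \<le> t" "t \<le> \<tau>"
    then have t': "t \<le> T" using \<tau> by simp
    note rg = passage_range[OF p t(1) t'] and der = traj_derivs[OF tr t(1) passage_range(1,3)[OF p t(1) t']]
    define b where "b = \<beta> (r t)"
    have d: "(u has_real_derivative b - \<kappa> * s + 2 * k * ((s\<^sup>2 - b * \<Lambda> t) / s) + k / a0 * W t) (at t)"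
      unfolding u_def b_def using der rg(1) s_pos a0
      by (auto intro!: derivative_eq_intros simp: field_simps power2_eq_square)
    have W: "0 \<le> W t"
      using p t t' tr by (cases "t = 0") (auto simp: passage_def traj_def less_imp_le)
    have acc: "0 \<le> s\<^sup>2 - b * \<Lambda> t"
      unfolding b_def by (rule W_deriv_nonneg[OF tr t(1) rg(2,3)])
    have b_low: "- (s * (1 / a0)) \<le> b"
    proof -
      have "\<bar>b\<bar> \<le> s / a"
        unfolding b_def by (rule \<beta>_bound[OF rg(2,3)])
      also have "\<dots> \<le> s / a0"
        using a0 s_pos by (intro divide_left_mono) auto
      finally show ?thesis by auto
    qed
    have t1: "0 \<le> 2 * k * ((s\<^sup>2 - b * \<Lambda> t) / s)" and t2: "0 \<le> k / a0 * W t"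
      using acc W k a0 s_pos by auto
    have "0 \<le> b - \<kappa> * s + 2 * k * ((s\<^sup>2 - b * \<Lambda> t) / s) + k / a0 * W t"
    proof (cases "\<Lambda> t < 0")
      case True
      have "2 * \<rho> * s \<le> r t * s + \<Lambda> t"
        by (rule \<Lambda>_lower[OF p t(1) t'])
      then have "(a0 * s) * (a0 * s) \<le> (r t * s - \<Lambda> t) * (r t * s + \<Lambda> t)"
      proof (intro mult_mono)
        show "a0 * s \<le> r t * s - \<Lambda> t"
        proof -
          have "a0 * s \<le> r t * s"
            using a0 rg s_pos by (intro mult_right_mono) auto
          then show ?thesis using True by linarith
        qed
        have "a0 * s \<le> \<rho> * s" "0 \<le> \<rho> * s"
          using a0 p(2) s_pos by (auto intro!: mult_right_mono)
        then show "a0 * s \<le> r t * s + \<Lambda> t"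
          using \<open>2 * \<rho> * s \<le> r t * s + \<Lambda> t\<close> by linarith
        show "0 \<le> r t * s - \<Lambda> t"
          using True mult_pos_pos[OF rg(1) s_pos] by linarith
      qed (use a0 s_pos in auto)
      also have "\<dots> = (W t)\<^sup>2"
        using der(5) by (simp add: algebra_simps power2_eq_square)
      finally have "(a0 * s)\<^sup>2 \<le> (W t)\<^sup>2"
        by (simp add: power2_eq_square)
      then have "a0 * s \<le> W t"
        using W by (rule power2_le_imp_le)
      then have "k / a0 * (a0 * s) \<le> k / a0 * W t"
        using k a0 by (intro mult_left_mono) auto
      then have "k * s \<le> k / a0 * W t"
        using a0 by simp
      moreover have "k * s = \<kappa> * s + s * (1 / a0)"
        by (simp add: \<kappa> algebra_simps)
      ultimately show ?thesis
        using b_low t1 by linarith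
    next
      case nonneg: False
      show ?thesis
      proof (cases "s\<^sup>2 / 2 \<le> b * \<Lambda> t")
        case True
        have L: "\<Lambda> t \<le> R * s"
        proof -
          have "r t * s \<le> R * s"
            using passage_inside[OF p t] s_pos by (intro mult_right_mono) auto
          then show ?thesis
            using traj_bounds(2)[OF tr t(1) rg(1,3)] by linarith
        qed
        have "0 < b * \<Lambda> t"
          using True s_pos by (smt (verit) zero_less_power half_gt_zero)
        then have "0 < b"
          using nonneg by (auto simp: zero_less_mult_iff)
        have "s * s \<le> 2 * (b * \<Lambda> t)"
          using True by (simp add: power2_eq_square)
        also have "\<dots> \<le> 2 * (b * (R * s))"
          using L \<open>0 < b\<close> by simp
        finally have "s * s \<le> (2 * (b * R)) * s"
          by (simp add: algebra_simps)
        then have "s \<le> 2 * (b * R)"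
          using s_pos by simp
        then have "\<kappa> * s \<le> b"
          using R_pos by (simp add: \<kappa>_def field_simps)
        then show ?thesis
          using t1 t2 by linarith
      next
        case False
        then have "s * (s / 2) \<le> s\<^sup>2 - b * \<Lambda> t"
          by (simp add: power2_eq_square)
        then have "s / 2 \<le> (s\<^sup>2 - b * \<Lambda> t) / s"
          using s_pos by (simp add: field_simps)
        then have "2 * k * (s / 2) \<le> 2 * k * ((s\<^sup>2 - b * \<Lambda> t) / s)"
          using k by (intro mult_left_mono) auto
        then have "k * s \<le> 2 * k * ((s\<^sup>2 - b * \<Lambda> t) / s)"
          by simp
        moreover have "k * s = \<kappa> * s + s * (1 / a0)"
          by (simp add: \<kappa> algebra_simps)
        ultimately show ?thesis
          using b_low t2 by linarith
      qed
    qed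
    then show "\<exists>y. (u has_real_derivative y) (at t) \<and> 0 \<le> y"
      using d by blast
  qed
  moreover have "0 \<le> u 0"
    using tr k a0 by (simp add: u_def traj_def)
  moreover have "2 * k * (W \<tau> / s) \<le> 2 * k * R"
  proof -
    have "W \<tau> \<le> R * s"
      using traj_bounds(1)[OF tr, of \<tau>] \<tau> R_pos R_less by auto
    then have "W \<tau> / s \<le> R"
      using s_pos by (simp add: field_simps)
    then show ?thesis
      using k by (intro mult_left_mono) auto
  qed
  ultimately have "0 \<le> A \<tau> - \<kappa> * s * \<tau> + 2 * k * R + k / a0 * (R\<^sup>2 / 2)"
    using \<tau> by (simp add: u_def)
  moreover have "\<kappa> * s * \<tau> = s * \<tau> / (2 * R)"
    by (simp add: \<kappa>_def)
  ultimately show ?thesis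
    by (simp add: algebra_simps)
qed

text \<open>A Lipschitz constant of the reduced system on the annulus between the radii \<open>a\<close> and \<open>R'\<close>.\<close>

definition growth_rate :: real where
  "growth_rate = 1 / a + R' * s / a\<^sup>2 + 2 * (s / a + Lp * (R' * s)) + Lp"

lemma growth_rate_nonneg: "0 \<le> growth_rate"
  using a_pos R'_pos s_pos lip_nonneg by (simp add: growth_rate_def)

lemma traj_close:
  assumes tr1: "traj \<rho>1 r1 W1 \<Lambda>1 A1" and tr2: "traj \<rho>2 r2 W2 \<Lambda>2 A2" and "0 \<le> T"
    and range: "\<And>t. 0 \<le> t \<Longrightarrow> t \<le> T \<Longrightarrow> a \<le> r1 t \<and> r1 t \<le> R' \<and> a \<le> r2 t \<and> r2 t \<le> R'"
  shows "\<bar>r1 T - r2 T\<bar> \<le> exp (growth_rate * T) * ((1 + s) * \<bar>\<rho>1 - \<rho>2\<bar>)"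
    and "\<bar>A1 T - A2 T\<bar> \<le> exp (growth_rate * T) * ((1 + s) * \<bar>\<rho>1 - \<rho>2\<bar>)"
proof -
  define z where "z t = (r1 t - r2 t, W1 t - W2 t, \<Lambda>1 t - \<Lambda>2 t, A1 t - A2 t)" for t
  define z' where "z' t = (W1 t / r1 t - W2 t / r2 t,
      (s\<^sup>2 - \<beta> (r1 t) * \<Lambda>1 t) - (s\<^sup>2 - \<beta> (r2 t) * \<Lambda>2 t),
      \<beta> (r1 t) * W1 t - \<beta> (r2 t) * W2 t, \<beta> (r1 t) - \<beta> (r2 t))" for t
  \<comment> \<open>only for passing between the norm of the state and its coordinates\<close>
  have triple: "norm (x, y, u, v) \<le> \<bar>x\<bar> + \<bar>y\<bar> + \<bar>u\<bar> + \<bar>v\<bar>" for x y u v :: real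
  proof -
    have "norm (x, y, u, v) \<le> norm x + (norm y + (norm u + norm v))"
      by (meson add_left_mono norm_Pair_le order_trans)
    then show ?thesis by simp
  qed
  have comp: "\<bar>r1 t - r2 t\<bar> \<le> norm (z t)" "\<bar>W1 t - W2 t\<bar> \<le> norm (z t)"
     "\<bar>\<Lambda>1 t - \<Lambda>2 t\<bar> \<le> norm (z t)" "\<bar>A1 t - A2 t\<bar> \<le> norm (z t)" for t
    using norm_fst_le[of "r1 t - r2 t" "(W1 t - W2 t, \<Lambda>1 t - \<Lambda>2 t, A1 t - A2 t)"]
      norm_snd_le[of "(W1 t - W2 t, \<Lambda>1 t - \<Lambda>2 t, A1 t - A2 t)" "r1 t - r2 t"]
      norm_fst_le[of "W1 t - W2 t" "(\<Lambda>1 t - \<Lambda>2 t, A1 t - A2 t)"]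
      norm_snd_le[of "(\<Lambda>1 t - \<Lambda>2 t, A1 t - A2 t)" "W1 t - W2 t"]
      norm_fst_le[of "\<Lambda>1 t - \<Lambda>2 t" "A1 t - A2 t"]
      norm_snd_le[of "A1 t - A2 t" "\<Lambda>1 t - \<Lambda>2 t"]
    unfolding z_def by auto
  have "norm (z T) \<le> exp (growth_rate * T) * norm (z 0)"
  proof (rule gronwall_norm[OF _ _ \<open>0 \<le> T\<close>])
    fix t assume t: "0 \<le> t" "t \<le> T"
    have rg: "0 < r1 t" "a \<le> r1 t" "r1 t \<le> R'" "0 < r2 t" "a \<le> r2 t" "r2 t \<le> R'"
      using range[OF t] a_pos by auto
    note d1 = traj_derivs[OF tr1 t(1) rg(1,3)] and d2 = traj_derivs[OF tr2 t(1) rg(4,6)]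
    show "(z has_vector_derivative z' t) (at t)"
      unfolding z_def z'_def
      by (intro has_vector_derivative_Pair has_vector_derivative_diff
          d1[unfolded has_real_derivative_iff_has_vector_derivative]
          d2[unfolded has_real_derivative_iff_has_vector_derivative])
    let ?n = "norm (z t)"
    have b1: "\<bar>\<beta> (r1 t)\<bar> \<le> s / a"
      by (rule \<beta>_bound[OF rg(2,3)])
    have bd: "\<bar>\<beta> (r1 t) - \<beta> (r2 t)\<bar> \<le> Lp * ?n"
      using order_trans[OF \<beta>_diff[OF rg(2,3,5,6)] mult_left_mono[OF comp(1) lip_nonneg]] .
    have w2: "\<bar>W2 t\<bar> \<le> R' * s" "\<bar>\<Lambda>2 t\<bar> \<le> R' * s"
      using order_trans[OF traj_bounds(1)[OF tr2 t(1) rg(4,6)] mult_right_mono[OF rg(6), of s]]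
        order_trans[OF traj_bounds(2)[OF tr2 t(1) rg(4,6)] mult_right_mono[OF rg(6), of s]] s_pos
      by simp_all
    have m1: "\<bar>\<beta> (r1 t) * \<Lambda>1 t - \<beta> (r2 t) * \<Lambda>2 t\<bar> \<le> s / a * ?n + Lp * ?n * (R' * s)"
      by (rule abs_mult_diff_le[OF b1 w2(2) bd comp(3)])
    have m2: "\<bar>\<beta> (r1 t) * W1 t - \<beta> (r2 t) * W2 t\<bar> \<le> s / a * ?n + Lp * ?n * (R' * s)"
      by (rule abs_mult_diff_le[OF b1 w2(1) bd comp(2)])
    have inv: "\<bar>1 / r1 t - 1 / r2 t\<bar> \<le> ?n / a\<^sup>2"
    proof -
      have "\<bar>1 / r1 t - 1 / r2 t\<bar> = \<bar>r1 t - r2 t\<bar> / (r1 t * r2 t)"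
      proof -
        have "1 / r1 t - 1 / r2 t = (r2 t - r1 t) / (r1 t * r2 t)"
          using rg by (simp add: field_simps)
        then show ?thesis
          using rg by (simp add: abs_minus_commute abs_mult)
      qed
      also have "\<dots> \<le> ?n / (a * a)"
        using comp(1) rg a_pos by (intro frac_le mult_mono) auto
      finally show ?thesis by (simp add: power2_eq_square)
    qed
    have "\<bar>1 / r1 t\<bar> \<le> 1 / a"
      using rg a_pos by (simp add: field_simps)
    from abs_mult_diff_le[OF this w2(1) inv comp(2)]
    have m3: "\<bar>W1 t / r1 t - W2 t / r2 t\<bar> \<le> 1 / a * ?n + ?n / a\<^sup>2 * (R' * s)"
      by simp
    have "norm (z' t) \<le> \<bar>W1 t / r1 t - W2 t / r2 t\<bar>
        + \<bar>(s\<^sup>2 - \<beta> (r1 t) * \<Lambda>1 t) - (s\<^sup>2 - \<beta> (r2 t) * \<Lambda>2 t)\<bar>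
        + \<bar>\<beta> (r1 t) * W1 t - \<beta> (r2 t) * W2 t\<bar> + \<bar>\<beta> (r1 t) - \<beta> (r2 t)\<bar>"
      unfolding z'_def by (rule triple)
    also have "\<bar>(s\<^sup>2 - \<beta> (r1 t) * \<Lambda>1 t) - (s\<^sup>2 - \<beta> (r2 t) * \<Lambda>2 t)\<bar>
        = \<bar>\<beta> (r1 t) * \<Lambda>1 t - \<beta> (r2 t) * \<Lambda>2 t\<bar>"
      by (simp add: abs_minus_commute)
    finally have "norm (z' t) \<le> (1 / a * ?n + ?n / a\<^sup>2 * (R' * s)) + (s / a * ?n + Lp * ?n * (R' * s))
       + (s / a * ?n + Lp * ?n * (R' * s)) + Lp * ?n"
      using m1 m2 m3 bd by linarith
    also have "\<dots> = growth_rate * ?n"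
      by (simp add: growth_rate_def algebra_simps)
    finally show "norm (z' t) \<le> growth_rate * norm (z t)" .
  qed
  also have "\<dots> \<le> exp (growth_rate * T) * ((1 + s) * \<bar>\<rho>1 - \<rho>2\<bar>)"
  proof (rule mult_left_mono)
    have "z 0 = (\<rho>1 - \<rho>2, 0, \<rho>1 * s - \<rho>2 * s, 0)"
      using tr1 tr2 by (simp add: z_def traj_def)
    then have "norm (z 0) \<le> \<bar>\<rho>1 - \<rho>2\<bar> + \<bar>\<rho>1 * s - \<rho>2 * s\<bar>"
      using triple[of "\<rho>1 - \<rho>2" 0 "\<rho>1 * s - \<rho>2 * s" 0] by simp
    also have "\<bar>\<rho>1 * s - \<rho>2 * s\<bar> = s * \<bar>\<rho>1 - \<rho>2\<bar>"
      using s_pos by (simp add: left_diff_distrib[symmetric] abs_mult)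
    finally show "norm (z 0) \<le> (1 + s) * \<bar>\<rho>1 - \<rho>2\<bar>"
      by (simp add: algebra_simps)
  qed simp
  finally have "norm (z T) \<le> exp (growth_rate * T) * ((1 + s) * \<bar>\<rho>1 - \<rho>2\<bar>)" .
  then show "\<bar>r1 T - r2 T\<bar> \<le> exp (growth_rate * T) * ((1 + s) * \<bar>\<rho>1 - \<rho>2\<bar>)"
    and "\<bar>A1 T - A2 T\<bar> \<le> exp (growth_rate * T) * ((1 + s) * \<bar>\<rho>1 - \<rho>2\<bar>)"
    using comp(1,4)[of T] by linarith+
qed

lemma small_initial_distance:
  assumes "0 < \<eta>"
  obtains \<delta> where "0 < \<delta>"
    "\<And>x t. \<bar>x\<bar> < \<delta> \<Longrightarrow> 0 \<le> t \<Longrightarrow> t \<le> T \<Longrightarrow> exp (growth_rate * t) * ((1 + s) * \<bar>x\<bar>) < \<eta>"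
proof
  let ?\<delta> = "\<eta> / (exp (growth_rate * T) * (1 + s))"
  show "0 < ?\<delta>"
    using assms s_pos by simp
  fix x t assume x: "\<bar>x\<bar> < ?\<delta>" and t: "0 \<le> t" "t \<le> T"
  have "exp (growth_rate * t) * ((1 + s) * \<bar>x\<bar>) \<le> exp (growth_rate * T) * ((1 + s) * \<bar>x\<bar>)"
    using t growth_rate_nonneg s_pos by (intro mult_right_mono) (auto intro: mult_left_mono)
  also have "\<dots> = \<bar>x\<bar> * (exp (growth_rate * T) * (1 + s))"
    by (simp add: algebra_simps)
  also have "\<dots> < \<eta>"
    using x s_pos by (simp add: pos_less_divide_eq)
  finally show "exp (growth_rate * t) * ((1 + s) * \<bar>x\<bar>) < \<eta>" .
qed

text \<open>\<open>x\<close> is the turn of the velocity between the closest approach at distance \<open>\<rho>\<close> and the exit. It is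
  a relation until existence and uniqueness are known.\<close>

definition turns :: "real \<Rightarrow> real \<Rightarrow> bool" where
  "turns \<rho> x \<longleftrightarrow> (\<exists>r W \<Lambda> A \<tau> T. passage \<rho> r W \<Lambda> A \<tau> T \<and> x = A \<tau>)"

lemma passage_turns: "passage \<rho> r W \<Lambda> A \<tau> T \<Longrightarrow> turns \<rho> (A \<tau>)"
  unfolding turns_def by blast

text \<open>The accumulated turn does not change on the rim, so that it suffices to compare two trajectories at a fixed time at which the first one is in the middle of
  the rim; a close trajectory is then on the rim as well.\<close>

lemma turns_close:
  assumes x1: "turns \<rho>1 x1" and \<rho>1: "a < \<rho>1" and "0 < \<eta>"
  obtains \<delta> where "0 < \<delta>" "\<And>\<rho>2 x2. \<bar>\<rho>1 - \<rho>2\<bar> < \<delta> \<Longrightarrow> a < \<rho>2 \<Longrightarrow> turns \<rho>2 x2 \<Longrightarrow> \<bar>x1 - x2\<bar> < \<eta>"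
proof -
  obtain r1 W1 \<Lambda>1 A1 \<tau>1 T1 where p1: "passage \<rho>1 r1 W1 \<Lambda>1 A1 \<tau>1 T1" and x1: "x1 = A1 \<tau>1"
    using x1 by (auto simp: turns_def)
  define t where "t = (\<tau>1 + T1) / 2"
  have t: "\<tau>1 < t" "t < T1" "0 < t" and ends: "r1 \<tau>1 = R" "r1 T1 = R'"
    using p1 by (auto simp: t_def passage_def)
  have t_range: "R < r1 t" "r1 t < R'"
    using passage_strict_mono[OF p1, of \<tau>1 t] passage_strict_mono[OF p1, of t T1] t \<rho>1 p1 ends
    by (auto simp: passage_def)
  define \<eta>' where "\<eta>' = min \<eta> (min (r1 t - R) (R' - r1 t))"
  have "0 < \<eta>'"
    using t_range \<open>0 < \<eta>\<close> by (auto simp: \<eta>'_def)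
  then obtain \<delta> where \<delta>: "0 < \<delta>"
     "\<And>x u. \<bar>x\<bar> < \<delta> \<Longrightarrow> 0 \<le> u \<Longrightarrow> u \<le> t \<Longrightarrow> exp (growth_rate * u) * ((1 + s) * \<bar>x\<bar>) < \<eta>'"
    using small_initial_distance by metis
  show thesis
  proof (rule that[OF \<delta>(1)])
    fix \<rho>2 x2 assume close: "\<bar>\<rho>1 - \<rho>2\<bar> < \<delta>" and \<rho>2: "a < \<rho>2" and "turns \<rho>2 x2"
    then obtain r2 W2 \<Lambda>2 A2 \<tau>2 T2 where p2: "passage \<rho>2 r2 W2 \<Lambda>2 A2 \<tau>2 T2" and x2: "x2 = A2 \<tau>2"
      by (auto simp: turns_def)
    have tr: "traj \<rho>1 r1 W1 \<Lambda>1 A1" "traj \<rho>2 r2 W2 \<Lambda>2 A2"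
      using p1 p2 by (auto simp: passage_def)
    have rg: "a \<le> r1 u \<and> r1 u \<le> R' \<and> a \<le> r2 u \<and> r2 u \<le> R'" if "0 \<le> u" "u \<le> t" "u \<le> T2" for u
      using passage_range[OF p1, of u] passage_range[OF p2, of u] that t \<rho>1 \<rho>2 by auto
    have near: "\<bar>r1 u - r2 u\<bar> < \<eta>' \<and> \<bar>A1 u - A2 u\<bar> < \<eta>'" if u: "0 \<le> u" "u \<le> t" "u \<le> T2" for u
    proof -
      have "a \<le> r1 v \<and> r1 v \<le> R' \<and> a \<le> r2 v \<and> r2 v \<le> R'" if "0 \<le> v" "v \<le> u" for v
        by (rule rg) (use that u in auto)
      note traj_close[OF tr u(1) this]
      then show ?thesis
        using \<delta>(2)[OF close u(1,2)] by (blast intro: le_less_trans)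
    qed
    have T2: "0 \<le> T2" "r2 T2 = R'"
      using p2 by (auto simp: passage_def)
    have "t < T2"
    proof (rule ccontr)
      assume "\<not> t < T2"
      then have "T2 \<le> t" by simp
      then have "\<bar>r1 T2 - R'\<bar> < \<eta>'"
        using near[of T2] T2 by auto
      moreover have "r1 T2 \<le> r1 t"
        using passage_strict_mono[OF p1, of T2 t] \<open>T2 \<le> t\<close> T2 t \<rho>1 by (cases "T2 = t") auto
      ultimately show False
        by (auto simp: \<eta>'_def)
    qed
    then have n: "\<bar>r1 t - r2 t\<bar> < \<eta>'" "\<bar>A1 t - A2 t\<bar> < \<eta>'"
      using near[of t] t by auto
    then have "R \<le> r2 t"
      by (auto simp: \<eta>'_def)
    then have "A2 t = x2"
      using passage_angle_after_exit[OF p2, of t] \<rho>2 t \<open>t < T2\<close> x2 by auto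
    moreover have "A1 t = x1"
      using passage_angle_after_exit[OF p1, of t] \<rho>1 t t_range x1 by auto
    ultimately show "\<bar>x1 - x2\<bar> < \<eta>"
      using n by (auto simp: \<eta>'_def)
  qed
qed

lemma turns_unique:
  assumes "turns \<rho> x" "turns \<rho> y" "a < \<rho>"
  shows "x = y"
proof (rule ccontr)
  assume "x \<noteq> y"
  then have "0 < \<bar>x - y\<bar>" by simp
  then show False
    using turns_close[OF assms(1,3)] assms(2,3) by (metis abs_zero diff_self less_irrefl)
qed

lemma circular_traj: "traj a (\<lambda>_. a) (\<lambda>_. 0) (\<lambda>_. a * s) (\<lambda>t. \<beta> a * t)"
proof -
  have "s\<^sup>2 = \<beta> a * (a * s)"
    using crit by (simp add: power2_eq_square mult.assoc[symmetric])
  then show ?thesis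
    unfolding traj_def by (auto intro!: derivative_eq_intros)
qed

text \<open>A trajectory that starts close to the circular orbit follows it for a long time, and a long stay
  means a large turn by \<open>angle_lower_bound\<close>.\<close>

lemma turns_large_near_circular_orbit:
  obtains \<rho>0 where "a < \<rho>0" "\<rho>0 < R" "\<And>\<rho> x. a < \<rho> \<Longrightarrow> \<rho> \<le> \<rho>0 \<Longrightarrow> turns \<rho> x \<Longrightarrow> M \<le> x"
proof -
  define C where "C = 2 * (1 / (2 * R) + 1 / a) * R + (1 / (2 * R) + 1 / a) / a * R\<^sup>2 / 2"
  define T0 where "T0 = max 0 (2 * R * (M + C) / s)"
  have T0: "0 \<le> T0" "M + C \<le> s * T0 / (2 * R)"
  proof -
    have "2 * R * (M + C) / s \<le> T0"
      by (simp add: T0_def)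
    then show "M + C \<le> s * T0 / (2 * R)"
      using s_pos R_pos by (simp add: field_simps)
  qed (simp add: T0_def)
  have "0 < R - a" using a_less by simp
  then obtain \<delta> where \<delta>: "0 < \<delta>"
      "\<And>x t. \<bar>x\<bar> < \<delta> \<Longrightarrow> 0 \<le> t \<Longrightarrow> t \<le> T0 \<Longrightarrow> exp (growth_rate * t) * ((1 + s) * \<bar>x\<bar>) < R - a"
    using small_initial_distance by metis
  show thesis
  proof (rule that[of "min (a + \<delta> / 2) ((a + R) / 2)"])
    fix \<rho> x assume \<rho>: "a < \<rho>" "\<rho> \<le> min (a + \<delta> / 2) ((a + R) / 2)" and "turns \<rho> x"
    then obtain r W \<Lambda> A \<tau> T where p: "passage \<rho> r W \<Lambda> A \<tau> T" and x: "x = A \<tau>"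
      by (auto simp: turns_def)
    have tr: "traj \<rho> r W \<Lambda> A" and \<tau>: "0 < \<tau>" "\<tau> < T" "r \<tau> = R"
      using p by (auto simp: passage_def)
    have "T0 \<le> \<tau>"
    proof (rule ccontr)
      assume "\<not> T0 \<le> \<tau>"
      have "\<bar>r \<tau> - a\<bar> \<le> exp (growth_rate * \<tau>) * ((1 + s) * \<bar>\<rho> - a\<bar>)"
      proof (rule traj_close(1)[OF tr circular_traj])
        fix t assume t: "0 \<le> t" "t \<le> \<tau>"
        then show "a \<le> r t \<and> r t \<le> R' \<and> a \<le> a \<and> a \<le> R'"
          using passage_range[OF p, of t] \<rho> \<tau> a_less R_less by auto
      qed (use \<tau> in simp)
      also have "\<dots> < R - a"
        using \<delta> \<rho> \<tau> \<open>\<not> T0 \<le> \<tau>\<close> by (intro \<delta>(2)) auto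
      finally show False
        using \<tau> a_less by auto
    qed
    then have "s * T0 / (2 * R) \<le> s * \<tau> / (2 * R)"
      using s_pos R_pos by (simp add: divide_right_mono)
    moreover have "s * \<tau> / (2 * R) - C \<le> A \<tau>"
      using angle_lower_bound[OF p, of a] \<rho> a_pos by (simp add: C_def)
    ultimately show "M \<le> x"
      using T0 x by simp
  qed (use a_less \<delta> in \<open>auto simp: min_less_iff_disj\<close>)
qed

text \<open>Near the boundary the field is weak, so that \<open>growth\<close> holds with \<open>\<kappa> = s\<^sup>2 / 2\<close> and the passage is
  short.\<close>

lemma turns_small_near_boundary:
  assumes "0 < \<eta>"
  obtains \<rho>0 where "a < \<rho>0" "\<rho>0 < R" "\<And>\<rho> x. \<rho>0 < \<rho> \<Longrightarrow> \<rho> < R \<Longrightarrow> turns \<rho> x \<Longrightarrow> \<bar>x\<bar> \<le> \<eta>"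
proof -
  define \<delta> where "\<delta> = min (R - a) (min (s / (2 * (Lp * R + 1))) (\<eta>\<^sup>2 * a\<^sup>2 / (4 * R)))"
  have den: "0 < Lp * R + 1"
    using lip_nonneg R_pos by (simp add: add_nonneg_pos)
  have \<delta>: "0 < \<delta>" "\<delta> \<le> R - a" "\<delta> \<le> s / (2 * (Lp * R + 1))" "\<delta> \<le> \<eta>\<^sup>2 * a\<^sup>2 / (4 * R)"
    using a_less s_pos assms a_pos R_pos den by (auto simp: \<delta>_def)
  have half: "s\<^sup>2 / 2 \<le> s\<^sup>2 - \<bar>\<beta> x\<bar> * x * s" if x: "R - \<delta> \<le> x" "x \<le> R'" for x
  proof (cases "R \<le> x")
    case True
    then show ?thesis using off[OF True x(2)] by simp
  next
    case False
    have "\<bar>\<beta> x\<bar> \<le> Lp * (R - x)"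
      using \<beta>_diff[of x R] x False off[of R] R_less \<delta> by auto
    also have "\<dots> \<le> Lp * \<delta>"
      using x lip_nonneg by (intro mult_left_mono) auto
    finally have "\<bar>\<beta> x\<bar> * x \<le> (Lp * \<delta>) * R"
      using False x \<delta> a_pos lip_nonneg by (intro mult_mono) auto
    also have "\<dots> \<le> (Lp * R + 1) * \<delta>"
      using \<delta>(1) by (simp add: algebra_simps)
    also have "\<dots> \<le> s / 2"
      using \<delta>(3) den by (simp add: field_simps)
    finally have "\<bar>\<beta> x\<bar> * x * s \<le> s / 2 * s"
      using s_pos by (intro mult_right_mono) auto
    then show ?thesis
      by (simp add: power2_eq_square)
  qed
  show thesis
  proof (rule that[of "R - \<delta> / 2"])
    fix \<rho> x assume \<rho>: "R - \<delta> / 2 < \<rho>" "\<rho> < R" and "turns \<rho> x"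
    then obtain r W \<Lambda> A \<tau> T where p: "passage \<rho> r W \<Lambda> A \<tau> T" and x: "x = A \<tau>"
      by (auto simp: turns_def)
    have tr: "traj \<rho> r W \<Lambda> A" and \<tau>: "0 < \<tau>" "\<tau> < T" "r \<tau> = R"
      using p by (auto simp: passage_def)
    have \<rho>': "a \<le> \<rho>" using \<rho> \<delta> by auto
    have "\<rho>\<^sup>2 + s\<^sup>2 / 2 * \<tau>\<^sup>2 \<le> (r \<tau>)\<^sup>2"
    proof (rule growth(2)[OF tr \<rho>'])
      show "\<And>x. \<rho> \<le> x \<Longrightarrow> x \<le> R' \<Longrightarrow> s\<^sup>2 / 2 \<le> s\<^sup>2 - \<bar>\<beta> x\<bar> * x * s"
        using half \<rho> \<delta> by auto
      show "\<And>t. 0 \<le> t \<Longrightarrow> t \<le> T \<Longrightarrow> \<rho> \<le> r t \<and> r t \<le> R'"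
        using p by (auto simp: passage_def)
    qed (use \<tau> in auto)
    then have "(s * \<tau>)\<^sup>2 \<le> 2 * (R\<^sup>2 - \<rho>\<^sup>2)"
      using \<tau> by (simp add: power_mult_distrib)
    also have "\<dots> = 2 * ((R - \<rho>) * (R + \<rho>))"
      by (simp add: algebra_simps power2_eq_square)
    also have "\<dots> \<le> 2 * (\<delta> * (2 * R))"
      using \<rho> \<delta> a_pos by (intro mult_left_mono mult_mono) auto
    also have "\<dots> = \<delta> * (4 * R)"
      by simp
    also have "\<dots> \<le> \<eta>\<^sup>2 * a\<^sup>2"
      using \<delta>(4) R_pos by (subst (asm) pos_le_divide_eq) auto
    also have "\<dots> = (\<eta> * a)\<^sup>2"
      by (simp add: power_mult_distrib)
    finally have "s * \<tau> \<le> \<eta> * a"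
      by (rule power2_le_imp_le) (use assms a_pos in simp)
    moreover have "\<bar>A \<tau>\<bar> \<le> s / a * \<tau>"
    proof -
      have d: "\<bar>\<beta> (r t)\<bar> \<le> s / a" "(A has_real_derivative \<beta> (r t)) (at t)" if "0 \<le> t" "t \<le> \<tau>" for t
        using passage_range[OF p \<rho>', of t] that \<tau> traj_derivs(4)[OF tr, of t] by (auto intro: \<beta>_bound)
      have "A \<tau> - s / a * \<tau> \<le> A 0 - s / a * 0"
      proof (rule DERIV_nonpos_imp_nonincreasing[where f = "\<lambda>t. A t - s / a * t"])
        fix t assume t: "0 \<le> t" "t \<le> \<tau>"
        have "((\<lambda>t. A t - s / a * t) has_real_derivative \<beta> (r t) - s / a) (at t)"
          using d(2)[OF t] a_pos by (auto intro!: derivative_eq_intros)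
        then show "\<exists>y. ((\<lambda>t. A t - s / a * t) has_real_derivative y) (at t) \<and> y \<le> 0"
          using d(1)[OF t] by (intro exI conjI) auto
      qed (use \<tau> in simp)
      moreover have "A 0 + s / a * 0 \<le> A \<tau> + s / a * \<tau>"
      proof (rule DERIV_nonneg_imp_nondecreasing[where f = "\<lambda>t. A t + s / a * t"])
        fix t assume t: "0 \<le> t" "t \<le> \<tau>"
        have "((\<lambda>t. A t + s / a * t) has_real_derivative \<beta> (r t) + s / a) (at t)"
          using d(2)[OF t] a_pos by (auto intro!: derivative_eq_intros)
        then show "\<exists>y. ((\<lambda>t. A t + s / a * t) has_real_derivative y) (at t) \<and> 0 \<le> y"
          using d(1)[OF t] by (intro exI conjI) auto
      qed (use \<tau> in simp)
      moreover have "A 0 = 0"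
        using tr by (simp add: traj_def)
      ultimately show ?thesis by simp
    qed
    moreover have "s / a * \<tau> \<le> \<eta> \<longleftrightarrow> s * \<tau> \<le> \<eta> * a"
      using a_pos by (simp add: field_simps)
    ultimately show "\<bar>x\<bar> \<le> \<eta>"
      using x by linarith
  qed (use \<delta> in auto)
qed

text \<open>The value of \<open>\<Lambda>\<close> on the boundary of the disc, obtained from \<open>d\<Lambda> / dr = \<beta> (r) r\<close>. At \<open>\<rho> = a\<close> it is
  the critical momentum up to the sign \<open>- \<epsilon>\<close>, and at \<open>\<rho> = R\<close> it is the momentum of a tangent.\<close>

definition exit_moment :: "real \<Rightarrow> real" where
  "exit_moment \<rho> = \<rho> * s + integral {\<rho>..R} (\<lambda>x. \<beta> x * x)"

lemma continuous_on_moment_density: "a \<le> x \<Longrightarrow> continuous_on {x..y} (\<lambda>x. \<beta> x * x)" if "y \<le> R'"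
proof -
  assume "a \<le> x"
  then have "continuous_on {x..y} \<beta>"
    using that lipschitz_on_continuous_on[OF lip] by (elim continuous_on_subset) auto
  then show ?thesis
    by (intro continuous_intros)
qed

lemma passage_exit_moment:
  assumes p: "passage \<rho> r W \<Lambda> A \<tau> T" "a \<le> \<rho>"
  shows "\<Lambda> \<tau> = exit_moment \<rho>"
proof -
  define P where "P x = integral {\<rho>..x} (\<lambda>x. \<beta> x * x)" for x
  have tr: "traj \<rho> r W \<Lambda> A" and \<tau>: "0 < \<tau>" "\<tau> < T" "r \<tau> = R"
    using p by (auto simp: passage_def)
  have \<rho>R: "\<rho> \<le> R"
  proof -
    have "0 \<le> \<tau> \<and> \<tau> \<le> T \<longrightarrow> \<rho> \<le> r \<tau>"
      using p(1) unfolding passage_def by blast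
    then show ?thesis using \<tau> by simp
  qed
  have cont: "continuous_on {\<rho>..R} (\<lambda>x. \<beta> x * x)"
    using continuous_on_moment_density[of R \<rho>] R_less p(2) by simp
  have der: "(P has_real_derivative \<beta> x * x) (at x)" if x: "\<rho> < x" "x < R" for x
    using integral_has_real_derivative[OF cont, of x] x unfolding P_def
    by (simp add: at_within_Icc_at)
  have cP: "continuous_on {\<rho>..R} P"
    unfolding P_def using cont by (intro indefinite_integral_continuous_1 integrable_continuous_real)
  have r_range: "\<rho> \<le> r t \<and> r t \<le> R" if "0 \<le> t" "t \<le> \<tau>" for t
    using passage_inside[OF p that] p that \<tau> by (auto simp: passage_def)
  have r0: "r 0 = \<rho>" using tr by (simp add: traj_def)
  have "\<Lambda> \<tau> - P (r \<tau>) = \<Lambda> 0 - P (r 0)"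
  proof (rule DERIV_isconst_end[OF \<tau>(1)])
    have "continuous_on {0..\<tau>} \<Lambda>"
    proof (rule DERIV_continuous_on)
      fix t assume t: "t \<in> {0..\<tau>}"
      show "(\<Lambda> has_real_derivative \<beta> (r t) * W t) (at t within {0..\<tau>})"
        using traj_derivs(3)[OF tr, of t] passage_range[OF p, of t] t \<tau>
        by (auto intro: has_field_derivative_at_within)
    qed
    moreover have "continuous_on {0..\<tau>} (\<lambda>t. P (r t))"
    proof (rule continuous_on_compose2[OF cP])
      show "continuous_on {0..\<tau>} r"
        using tr by (auto simp: traj_def elim: continuous_on_subset)
    qed (use r_range in auto)
    ultimately show "continuous_on {0..\<tau>} (\<lambda>t. \<Lambda> t - P (r t))"
      by (intro continuous_intros)
  next
    fix t assume t: "0 < t" "t < \<tau>"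
    note rg = passage_range[OF p, of t]
    have "\<rho> < r t" "r t < R"
      using passage_strict_mono[OF p, of 0 t] passage_strict_mono[OF p, of t \<tau>] t \<tau> r0 by auto
    then have "((\<lambda>t. P (r t)) has_real_derivative \<beta> (r t) * r t * (W t / r t)) (at t)"
      using traj_derivs(1)[OF tr, of t] rg t \<tau> by (intro DERIV_chain2[where f = P] der) auto
    then have "((\<lambda>t. \<Lambda> t - P (r t)) has_real_derivative \<beta> (r t) * W t - \<beta> (r t) * r t * (W t / r t)) (at t)"
      using traj_derivs(3)[OF tr, of t] rg t \<tau> by (intro DERIV_diff) auto
    then show "((\<lambda>t. \<Lambda> t - P (r t)) has_real_derivative 0) (at t)"
      using rg(1) t \<tau> by simp
  qed
  then show ?thesis
    using \<tau> tr by (simp add: exit_moment_def P_def traj_def)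
qed

lemma exit_moment_mono:
  assumes "a \<le> \<rho>" "\<rho> \<le> \<rho>'" "\<rho>' \<le> R"
  shows "exit_moment \<rho> \<le> exit_moment \<rho>'"
proof -
  have int: "(\<lambda>x. \<beta> x * x) integrable_on {\<rho>..R}" "(\<lambda>x. \<beta> x * x) integrable_on {\<rho>..\<rho>'}"
    using continuous_on_moment_density[of R \<rho>] continuous_on_moment_density[of \<rho>' \<rho>] assms R_less
    by (auto intro!: integrable_continuous_real)
  have "integral {\<rho>..R} (\<lambda>x. \<beta> x * x)
      = integral {\<rho>..\<rho>'} (\<lambda>x. \<beta> x * x) + integral {\<rho>'..R} (\<lambda>x. \<beta> x * x)"
    using Henstock_Kurzweil_Integration.integral_combine[OF assms(2,3) int(1)] by simp
  moreover have "integral {\<rho>..\<rho>'} (\<lambda>x. \<beta> x * x) \<le> integral {\<rho>..\<rho>'} (\<lambda>x. s)"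
  proof (intro integral_le int(2))
    fix x assume x: "x \<in> {\<rho>..\<rho>'}"
    then have "\<bar>\<beta> x * x\<bar> \<le> s"
      using sub_le[of x] assms a_pos R_less by (auto simp: abs_mult)
    then show "\<beta> x * x \<le> s" by linarith
  qed auto
  ultimately show ?thesis
    using assms by (simp add: exit_moment_def algebra_simps)
qed

lemma continuous_on_exit_moment: "continuous_on {a..R} exit_moment"
proof -
  have "(\<lambda>x. \<beta> x * x) integrable_on {a..R}"
    using continuous_on_moment_density[of R a] R_less by (auto intro!: integrable_continuous_real)
  then have "continuous_on {a..R} (\<lambda>\<rho>. integral {\<rho>..R} (\<lambda>x. \<beta> x * x))"
    by (rule indefinite_integral_continuous_1')
  then show ?thesis
    unfolding exit_moment_def[abs_def] by (intro continuous_intros)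
qed

lemma exit_moment_boundary: "exit_moment R = R * s"
  by (simp add: exit_moment_def)

lemma exit_moment_lower: "(2 * a - R) * s \<le> exit_moment a"
proof -
  have "integral {a..R} (\<lambda>x. - s) \<le> integral {a..R} (\<lambda>x. \<beta> x * x)"
  proof (intro integral_le)
    show "(\<lambda>x. \<beta> x * x) integrable_on {a..R}"
      using continuous_on_moment_density[of R a] R_less by (auto intro!: integrable_continuous_real)
    fix x assume x: "x \<in> {a..R}"
    then have "\<bar>\<beta> x * x\<bar> \<le> s"
      using sub_le[of x] a_pos R_less by (auto simp: abs_mult)
    then show "- s \<le> \<beta> x * x" by linarith
  qed auto
  then show ?thesis
    using a_less by (simp add: exit_moment_def algebra_simps)
qed

lemma exit_moment_range:
  assumes "a \<le> \<rho>" "\<rho> \<le> R"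
  shows "- (R * s) < exit_moment \<rho>" "exit_moment \<rho> \<le> R * s" "exit_moment a \<le> exit_moment \<rho>"
proof -
  show *: "exit_moment a \<le> exit_moment \<rho>" "exit_moment \<rho> \<le> R * s"
    using exit_moment_mono[of a \<rho>] exit_moment_mono[of \<rho> R] assms a_less exit_moment_boundary by auto
  have "0 < a * s" using a_pos s_pos by simp
  then show "- (R * s) < exit_moment \<rho>"
    using * exit_moment_lower by (simp add: algebra_simps)
qed

definition half_angle :: "real \<Rightarrow> real" where
  "half_angle \<rho> = (THE x. turns \<rho> x)"

lemma half_angle_eq: "turns \<rho> x \<Longrightarrow> a < \<rho> \<Longrightarrow> half_angle \<rho> = x"
  unfolding half_angle_def by (rule the_equality) (auto dest: turns_unique)

lemma continuous_on_half_angle: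
  assumes ex: "\<And>\<rho>. a < \<rho> \<Longrightarrow> \<rho> < R \<Longrightarrow> \<exists>x. turns \<rho> x"
  shows "continuous_on {a<..<R} half_angle"
  unfolding continuous_on_iff
proof (intro ballI allI impI)
  fix \<rho> \<eta> :: real assume \<rho>: "\<rho> \<in> {a<..<R}" and "0 < \<eta>"
  then obtain x where x: "turns \<rho> x" using ex by auto
  obtain \<delta> where \<delta>: "0 < \<delta>" "\<And>\<rho>2 x2. \<bar>\<rho> - \<rho>2\<bar> < \<delta> \<Longrightarrow> a < \<rho>2 \<Longrightarrow> turns \<rho>2 x2 \<Longrightarrow> \<bar>x - x2\<bar> < \<eta>"
    using turns_close[OF x _ \<open>0 < \<eta>\<close>] \<rho> by auto
  show "\<exists>d>0. \<forall>\<rho>'\<in>{a<..<R}. dist \<rho>' \<rho> < d \<longrightarrow> dist (half_angle \<rho>') (half_angle \<rho>) < \<eta>"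
  proof (intro exI conjI ballI impI)
    fix \<rho>' assume \<rho>': "\<rho>' \<in> {a<..<R}" "dist \<rho>' \<rho> < \<delta>"
    then obtain x' where x': "turns \<rho>' x'" using ex by auto
    then have "\<bar>x - x'\<bar> < \<eta>"
      using \<delta>(2) \<rho>' by (auto simp: dist_real_def abs_minus_commute)
    then show "dist (half_angle \<rho>') (half_angle \<rho>) < \<eta>"
      using half_angle_eq[OF x] half_angle_eq[OF x'] \<rho> \<rho>' by (auto simp: dist_real_def abs_minus_commute)
  qed (rule \<delta>(1))
qed

end

section \<open>Orbits in the plane\<close>

abbreviation J :: "real ^ 2 \<Rightarrow> real ^ 2" where
  "J v \<equiv> Jmat *v v"

lemma inner_real2: "(x :: real ^ 2) \<bullet> y = x $ 1 * y $ 1 + x $ 2 * y $ 2"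
  by (simp add: inner_vec_def sum_2)

lemma J_component [simp]: "J v $ 1 = v $ 2" "J v $ 2 = - v $ 1"
  by (simp_all add: Jmat_def matrix_vector_mult_def sum_2)

lemma bounded_linear_J: "bounded_linear (\<lambda>v. J v)"
  by (rule matrix_vector_mul_bounded_linear)

lemma J_scale: "J (c *\<^sub>R v) = c *\<^sub>R J v" and J_minus: "J (- v) = - J v"
  and J_diff: "J (u - v) = J u - J v"
  by (simp_all add: vec_eq_iff forall_2)

lemma J_J [simp]: "J (J v) = - v"
  by (simp add: vec_eq_iff forall_2)

lemma inner_J_J [simp]: "J v \<bullet> J w = v \<bullet> w"
  by (simp add: inner_real2)

lemma inner_J_self [simp]: "v \<bullet> J v = 0" "J v \<bullet> v = 0"
  by (simp_all add: inner_real2)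

lemma J_inner: "J v \<bullet> w = - (v \<bullet> J w)"
  by (simp add: inner_real2)

lemma norm_J [simp]: "norm (J v) = norm v"
  by (simp add: norm_eq_sqrt_inner)

lemma J_decomposition: "(norm e)\<^sup>2 *\<^sub>R v = (v \<bullet> e) *\<^sub>R e + (v \<bullet> J e) *\<^sub>R J e"
  unfolding power2_norm_eq_inner
  by (simp add: vec_eq_iff forall_2 inner_real2 algebra_simps)

lemma inner_J_pythagoras: "(v \<bullet> e)\<^sup>2 + (v \<bullet> J e)\<^sup>2 = (norm v)\<^sup>2 * (norm e)\<^sup>2"
  unfolding power2_norm_eq_inner
  by (simp add: inner_real2 algebra_simps power2_eq_square)

definition dir :: "real \<Rightarrow> real ^ 2" where
  "dir \<theta> = vector [cos \<theta>, sin \<theta>]"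

lemma dir_component [simp]: "dir \<theta> $ 1 = cos \<theta>" "dir \<theta> $ 2 = sin \<theta>"
  by (simp_all add: dir_def)

lemma dir_inner_dir: "dir \<theta> \<bullet> dir \<phi> = cos (\<theta> - \<phi>)"
  by (simp add: inner_real2 cos_diff)

lemma dir_inner_J_dir: "dir \<theta> \<bullet> J (dir \<phi>) = sin (\<phi> - \<theta>)"
  by (simp add: inner_real2 sin_diff)

lemma norm_dir [simp]: "norm (dir \<theta>) = 1"
  by (simp add: norm_eq_sqrt_inner dir_inner_dir)

lemma dir_add_pi: "dir (\<theta> + pi) = - dir \<theta>"
  by (simp add: vec_eq_iff forall_2)

lemma dir_add_2pi_int: "dir (\<theta> + 2 * pi * of_int m) = dir \<theta>"
proof -
  have "cos (\<theta> + 2 * pi * of_int m) = cos \<theta>" "sin (\<theta> + 2 * pi * of_int m) = sin \<theta>"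
    using cos_int_2pin[of m] sin_int_2pin[of m] by (simp_all add: cos_add sin_add)
  then show ?thesis
    by (simp add: vec_eq_iff forall_2)
qed

lemma unit_vector_dir:
  assumes "norm (e :: real ^ 2) = 1"
  obtains \<theta> where "e = dir \<theta>"
proof -
  have "(e $ 1)\<^sup>2 + (e $ 2)\<^sup>2 = 1"
    using assms by (simp add: norm_eq_sqrt_inner inner_real2 power2_eq_square)
  then obtain \<theta> where "e $ 1 = cos \<theta>" "e $ 2 = sin \<theta>"
    using sincos_total_2pi by metis
  then show ?thesis
    using that by (simp add: vec_eq_iff forall_2)
qed

lemma norm_dir_diff: "norm (dir \<theta> - dir \<phi>) = 2 * \<bar>sin ((\<theta> - \<phi>) / 2)\<bar>"
proof (rule power2_eq_imp_eq)
  have "(norm (dir \<theta> - dir \<phi>))\<^sup>2 = 2 - 2 * cos (\<theta> - \<phi>)"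
    by (simp add: power2_norm_eq_inner inner_diff_left inner_diff_right dir_inner_dir cos_diff)
  also have "\<dots> = 4 * (sin ((\<theta> - \<phi>) / 2))\<^sup>2"
  proof -
    have "2 * ((\<theta> - \<phi>) / 2) = \<theta> - \<phi>" by simp
    from cos_double_sin[of "(\<theta> - \<phi>) / 2", unfolded this] show ?thesis by simp
  qed
  finally show "(norm (dir \<theta> - dir \<phi>))\<^sup>2 = (2 * \<bar>sin ((\<theta> - \<phi>) / 2)\<bar>)\<^sup>2"
    by (simp add: power_mult_distrib)
qed auto

lemma has_real_derivative_inner:
  fixes f g :: "real \<Rightarrow> real ^ 2"
  assumes "(f has_vector_derivative f') (at t)" "(g has_vector_derivative g') (at t)"
  shows "((\<lambda>t. f t \<bullet> g t) has_real_derivative f t \<bullet> g' + f' \<bullet> g t) (at t)"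
  using bounded_bilinear.has_vector_derivative[OF bounded_bilinear_inner assms]
  by (simp add: has_real_derivative_iff_has_vector_derivative)

definition orbit :: "(real ^ 2 \<Rightarrow> real) \<Rightarrow> (real \<Rightarrow> real ^ 2) \<Rightarrow> (real \<Rightarrow> real ^ 2) \<Rightarrow> bool" where
  "orbit B q p \<longleftrightarrow> (\<forall>t. (q has_vector_derivative p t) (at t) \<and>
     (p has_vector_derivative B (q t) *\<^sub>R J (p t)) (at t))"

lemma orbit_derivs:
  assumes "orbit B q p"
  shows "(q has_vector_derivative p t) (at t)"
    and "(p has_vector_derivative B (q t) *\<^sub>R J (p t)) (at t)"
  using assms by (auto simp: orbit_def)

lemma orbit_continuous:
  assumes "orbit B q p"
  shows "continuous_on X q" "continuous_on X p"
  using assms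
  by (auto simp: orbit_def intro!: continuous_at_imp_continuous_on dest: has_vector_derivative_continuous)

lemma orbit_speed:
  assumes "orbit B q p"
  shows "norm (p t) = norm (p u)"
proof -
  have "((\<lambda>t. p t \<bullet> p t) has_real_derivative 0) (at x)" for x
    using has_real_derivative_inner[OF orbit_derivs(2,2)[OF assms, of x]]
    by (simp add: inner_commute)
  then have "p t \<bullet> p t = p u \<bullet> p u"
    using DERIV_isconst_all by blast
  then show ?thesis
    by (simp add: norm_eq_sqrt_inner)
qed

lemma orbit_reverse:
  assumes "orbit B q p"
  shows "orbit (\<lambda>x. - B x) (\<lambda>t. q (- t)) (\<lambda>t. - p (- t))"
  unfolding orbit_def
proof (intro allI conjI)
  fix t
  have m: "((\<lambda>t::real. - t) has_vector_derivative -1) (at t)"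
    by (auto intro!: derivative_eq_intros simp: has_real_derivative_iff_has_vector_derivative[symmetric])
  show "((\<lambda>t. q (- t)) has_vector_derivative - p (- t)) (at t)"
    using vector_diff_chain_at[OF m orbit_derivs(1)[OF assms]] by (simp add: o_def)
  show "((\<lambda>t. - p (- t)) has_vector_derivative - B (q (- t)) *\<^sub>R J (- p (- t))) (at t)"
    using has_vector_derivative_minus[OF vector_diff_chain_at[OF m orbit_derivs(2)[OF assms]]]
    by (simp add: o_def J_minus)
qed

text \<open>The velocity rotates with angular speed \<open>- B\<close>. The integral of the field along the orbit is
  therefore an explicit continuous lift of the direction of motion.\<close>

lemma angle_lift:
  assumes orb: "orbit B q p" and p0: "p 0 = s *\<^sub>R dir \<omega>" and \<theta>0: "\<theta> 0 = \<omega>"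
    and \<theta>: "\<And>t. (\<theta> has_real_derivative - B (q t)) (at t)"
  shows "p t = s *\<^sub>R dir (\<theta> t)"
proof -
  define x where "x t = p t \<bullet> dir (\<theta> t)" for t
  define y where "y t = p t \<bullet> J (dir (\<theta> t))" for t
  have x_eq: "x t = p t $ 1 * cos (\<theta> t) + p t $ 2 * sin (\<theta> t)"
    and y_eq: "y t = p t $ 1 * sin (\<theta> t) - p t $ 2 * cos (\<theta> t)" for t
    by (simp_all add: x_def y_def inner_real2)
  have comp: "((\<lambda>t. p t $ i) has_real_derivative B (q t) * J (p t) $ i) (at t)" for i t
    using bounded_linear.has_vector_derivative[OF bounded_linear_vec_nth orbit_derivs(2)[OF orb, of t], of i]
    by (simp add: has_real_derivative_iff_has_vector_derivative)
  have "(x has_real_derivative 0) (at t)" for t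
    unfolding x_eq[abs_def]
    by (rule derivative_eq_intros comp \<theta> refl)+ (simp add: algebra_simps)
  moreover have "(y has_real_derivative 0) (at t)" for t
    unfolding y_eq[abs_def]
    by (rule derivative_eq_intros comp \<theta> refl)+ (simp add: algebra_simps)
  ultimately have "x t = x 0" "y t = y 0"
    using DERIV_isconst_all by blast+
  moreover have "x 0 = s" "y 0 = 0"
    by (simp_all add: x_def y_def p0 \<theta>0 dir_inner_dir)
  ultimately have "p t \<bullet> dir (\<theta> t) = s" "p t \<bullet> J (dir (\<theta> t)) = 0"
    by (simp_all add: x_def y_def)
  then show ?thesis
    using J_decomposition[of "dir (\<theta> t)" "p t"] by simp
qed

lemma global_antiderivative:
  fixes f :: "real \<Rightarrow> real"
  assumes "continuous_on UNIV f"
  obtains F where "F 0 = 0" "\<And>t. (F has_real_derivative f t) (at t)"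
proof -
  have "\<exists>F. \<forall>x::real. - \<infinity> < ereal x \<longrightarrow> ereal x < \<infinity> \<longrightarrow> (F has_vector_derivative f x) (at x)"
    using assms by (intro einterval_antiderivative) (auto simp: continuous_on_eq_continuous_at)
  then obtain F where F: "\<And>t. (F has_real_derivative f t) (at t)"
    by (auto simp: has_real_derivative_iff_has_vector_derivative)
  have "((\<lambda>t. F t - F 0) has_real_derivative f t) (at t)" for t
    using DERIV_diff[OF F[of t] DERIV_const[of "F 0"]] by simp
  then show ?thesis
    using that[of "\<lambda>t. F t - F 0"] by simp
qed

text \<open>The equations of the reduced system for an arbitrary centre \<open>c\<close>.\<close>

lemma orbit_radial_derivs:
  assumes orb: "orbit B q p" and speed: "norm (p 0) = s"
  shows "((\<lambda>t. (q t - c) \<bullet> p t) has_real_derivative s\<^sup>2 + B (q t) * ((q t - c) \<bullet> J (p t))) (at t)"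
    and "((\<lambda>t. (q t - c) \<bullet> J (p t)) has_real_derivative - B (q t) * ((q t - c) \<bullet> p t)) (at t)"
    and "q t \<noteq> c \<Longrightarrow> ((\<lambda>t. norm (q t - c)) has_real_derivative (q t - c) \<bullet> p t / norm (q t - c)) (at t)"
    and "((q t - c) \<bullet> p t)\<^sup>2 + ((q t - c) \<bullet> J (p t))\<^sup>2 = (norm (q t - c) * s)\<^sup>2"
proof -
  have sp: "p t \<bullet> p t = s\<^sup>2"
    using orbit_speed[OF orb, of t 0] speed by (simp add: power2_norm_eq_inner[symmetric])
  have dq: "((\<lambda>t. q t - c) has_vector_derivative p t) (at t)"
    using has_vector_derivative_diff[OF orbit_derivs(1)[OF orb, of t] has_vector_derivative_const[of c]] by simp
  note dp = orbit_derivs(2)[OF orb, of t]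
  have dJ: "((\<lambda>t. J (p t)) has_vector_derivative J (B (q t) *\<^sub>R J (p t))) (at t)"
    by (rule bounded_linear.has_vector_derivative[OF bounded_linear_J dp])
  show "((\<lambda>t. (q t - c) \<bullet> p t) has_real_derivative s\<^sup>2 + B (q t) * ((q t - c) \<bullet> J (p t))) (at t)"
    using has_real_derivative_inner[OF dq dp] by (simp add: sp add.commute)
  show "((\<lambda>t. (q t - c) \<bullet> J (p t)) has_real_derivative - B (q t) * ((q t - c) \<bullet> p t)) (at t)"
    using has_real_derivative_inner[OF dq dJ] by (simp add: J_scale)
  show "((q t - c) \<bullet> p t)\<^sup>2 + ((q t - c) \<bullet> J (p t))\<^sup>2 = (norm (q t - c) * s)\<^sup>2"
    using inner_J_pythagoras[of "q t - c" "p t"] sp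
    by (simp add: power_mult_distrib power2_norm_eq_inner)
  assume ne: "q t \<noteq> c"
  have "((\<lambda>t. (q t - c) \<bullet> (q t - c)) has_real_derivative 2 * ((q t - c) \<bullet> p t)) (at t)"
    using has_real_derivative_inner[OF dq dq] by (simp add: inner_commute)
  then have "((\<lambda>t. sqrt ((q t - c) \<bullet> (q t - c))) has_real_derivative
      inverse (sqrt ((q t - c) \<bullet> (q t - c))) / 2 * (2 * ((q t - c) \<bullet> p t))) (at t)"
    using ne by (intro DERIV_chain2[where f = sqrt] DERIV_real_sqrt) auto
  then show "((\<lambda>t. norm (q t - c)) has_real_derivative (q t - c) \<bullet> p t / norm (q t - c)) (at t)"
    unfolding norm_eq_sqrt_inner by (simp only: divide_inverse mult_ac) simp
qed

text \<open>Stated for curves that solve the equation of motion on a bounded time interval only, so that it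
  also yields the uniqueness of solutions.\<close>

lemma orbits_close:
  assumes q: "\<And>t. 0 \<le> t \<Longrightarrow> t \<le> T \<Longrightarrow> (q has_vector_derivative p t) (at t)"
    and p: "\<And>t. 0 \<le> t \<Longrightarrow> t \<le> T \<Longrightarrow> (p has_vector_derivative B (q t) *\<^sub>R J (p t)) (at t)"
    and q': "\<And>t. 0 \<le> t \<Longrightarrow> t \<le> T \<Longrightarrow> (q' has_vector_derivative p' t) (at t)"
    and p': "\<And>t. 0 \<le> t \<Longrightarrow> t \<le> T \<Longrightarrow> (p' has_vector_derivative B (q' t) *\<^sub>R J (p' t)) (at t)"
    and speed: "\<And>t. 0 \<le> t \<Longrightarrow> t \<le> T \<Longrightarrow> norm (p' t) \<le> s"
    and lip: "Lp-lipschitz_on UNIV B" and bd: "\<And>x. \<bar>B x\<bar> \<le> M" and "0 \<le> T"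
  shows "dist (q T, p T) (q' T, p' T) \<le> exp ((1 + M + Lp * s) * T) * dist (q 0, p 0) (q' 0, p' 0)"
proof -
  define z where "z t = (q t - q' t, p t - p' t)" for t
  define z' where "z' t = (p t - p' t, B (q t) *\<^sub>R J (p t) - B (q' t) *\<^sub>R J (p' t))" for t
  have "norm (z T) \<le> exp ((1 + M + Lp * s) * T) * norm (z 0)"
  proof (rule gronwall_norm[OF _ _ \<open>0 \<le> T\<close>])
    fix t assume t: "0 \<le> t" "t \<le> T"
    show "(z has_vector_derivative z' t) (at t)"
      unfolding z_def z'_def using q[OF t] p[OF t] q'[OF t] p'[OF t]
      by (intro has_vector_derivative_Pair has_vector_derivative_diff)
    have n1: "norm (q t - q' t) \<le> norm (z t)" and n2: "norm (p t - p' t) \<le> norm (z t)"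
      using norm_fst_le[of "q t - q' t" "p t - p' t"] norm_snd_le[of "p t - p' t" "q t - q' t"]
      by (auto simp: z_def)
    have "B (q t) *\<^sub>R J (p t) - B (q' t) *\<^sub>R J (p' t)
        = B (q t) *\<^sub>R J (p t - p' t) + (B (q t) - B (q' t)) *\<^sub>R J (p' t)"
      by (simp add: J_diff algebra_simps)
    then have "norm (B (q t) *\<^sub>R J (p t) - B (q' t) *\<^sub>R J (p' t))
        \<le> \<bar>B (q t)\<bar> * norm (p t - p' t) + \<bar>B (q t) - B (q' t)\<bar> * norm (p' t)"
      by (metis norm_J norm_scaleR norm_triangle_ineq)
    also have "\<dots> \<le> M * norm (z t) + (Lp * norm (z t)) * s"
    proof (intro add_mono mult_mono)
      have "\<bar>B (q t) - B (q' t)\<bar> \<le> Lp * norm (q t - q' t)"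
        using lipschitz_onD[OF lip, of "q t" "q' t"] by (simp add: dist_norm)
      also have "\<dots> \<le> Lp * norm (z t)"
        using n1 lipschitz_on_nonneg[OF lip] by (rule mult_left_mono)
      finally show "\<bar>B (q t) - B (q' t)\<bar> \<le> Lp * norm (z t)" .
      show "0 \<le> M" using bd[of 0] by linarith
    qed (use bd n2 speed[OF t] lipschitz_on_nonneg[OF lip] in auto)
    finally have n3: "norm (B (q t) *\<^sub>R J (p t) - B (q' t) *\<^sub>R J (p' t))
        \<le> M * norm (z t) + Lp * norm (z t) * s" .
    have "norm (z' t) \<le> norm (p t - p' t) + norm (B (q t) *\<^sub>R J (p t) - B (q' t) *\<^sub>R J (p' t))"
      unfolding z'_def by (rule norm_Pair_le)
    then show "norm (z' t) \<le> (1 + M + Lp * s) * norm (z t)"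
      using n2 n3 by (simp add: algebra_simps)
  qed
  then show ?thesis
    by (simp add: z_def dist_norm minus_prod_def)
qed

section \<open>The flow and the passage of a bump\<close>

locale magnetic_flow =
  fixes B :: "real ^ 2 \<Rightarrow> real" and \<Phi> :: "real \<Rightarrow> phase \<Rightarrow> phase" and LB M :: real
  assumes flow: "is_magnetic_flow B \<Phi>" and B_lip: "LB-lipschitz_on UNIV B" and B_bound: "\<And>x. \<bar>B x\<bar> \<le> M"
begin

lemma flow_0 [simp]: "\<Phi> 0 x = x"
  using flow unfolding is_magnetic_flow_def by blast

lemma orbit_flow: "orbit B (\<lambda>t. fst (\<Phi> t x)) (\<lambda>t. snd (\<Phi> t x))"
proof -
  have d: "((\<lambda>s. \<Phi> s x) has_vector_derivative
      (snd (\<Phi> t x), B (fst (\<Phi> t x)) *\<^sub>R J (snd (\<Phi> t x)))) (at t)" for t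
    using flow unfolding is_magnetic_flow_def by blast
  show ?thesis
    unfolding orbit_def
    using bounded_linear.has_vector_derivative[OF bounded_linear_fst d]
      bounded_linear.has_vector_derivative[OF bounded_linear_snd d] by simp
qed

lemma speed_flow: "norm (snd (\<Phi> t x)) = norm (snd x)"
  using orbit_speed[OF orbit_flow, of t x 0] by simp

lemma continuous_flow: "continuous_on X (\<lambda>t. fst (\<Phi> t x))" "continuous_on X (\<lambda>t. snd (\<Phi> t x))"
  by (rule orbit_continuous[OF orbit_flow])+

lemma flow_close:
  assumes "norm (snd y) \<le> s" "0 \<le> t"
  shows "dist (\<Phi> t x) (\<Phi> t y) \<le> exp ((1 + M + LB * s) * t) * dist x y"
  using orbits_close[OF orbit_derivs(1)[OF orbit_flow] orbit_derivs(2)[OF orbit_flow]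
      orbit_derivs(1)[OF orbit_flow] orbit_derivs(2)[OF orbit_flow] _ B_lip B_bound assms(2), of y s x]
    assms(1) by (simp add: speed_flow)

lemma flow_unique:
  assumes q: "\<And>t. 0 \<le> t \<Longrightarrow> t \<le> T \<Longrightarrow> (q has_vector_derivative p t) (at t)"
    and p: "\<And>t. 0 \<le> t \<Longrightarrow> t \<le> T \<Longrightarrow> (p has_vector_derivative B (q t) *\<^sub>R J (p t)) (at t)"
    and x: "x = (q 0, p 0)" and "0 \<le> T"
  shows "\<Phi> T x = (q T, p T)"
proof -
  have "dist (q T, p T) (fst (\<Phi> T x), snd (\<Phi> T x))
      \<le> exp ((1 + M + LB * norm (snd x)) * T) * dist (q 0, p 0) (fst (\<Phi> 0 x), snd (\<Phi> 0 x))"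
    by (rule orbits_close[OF q p orbit_derivs(1)[OF orbit_flow] orbit_derivs(2)[OF orbit_flow] _ B_lip B_bound \<open>0 \<le> T\<close>])
      (simp_all add: speed_flow)
  then show ?thesis
    unfolding x by (simp add: prod_eq_iff)
qed

lemma flow_add:
  assumes "0 \<le> t"
  shows "\<Phi> (t + u) x = \<Phi> t (\<Phi> u x)"
proof -
  have sh: "((\<lambda>t. t + u) has_vector_derivative 1) (at v)" for v
    by (auto intro!: derivative_eq_intros simp: has_real_derivative_iff_has_vector_derivative[symmetric])
  have "\<Phi> t (\<Phi> u x) = (fst (\<Phi> (t + u) x), snd (\<Phi> (t + u) x))"
  proof (rule flow_unique[OF _ _ _ assms])
    fix v
    show "((\<lambda>t. fst (\<Phi> (t + u) x)) has_vector_derivative snd (\<Phi> (v + u) x)) (at v)"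
      using vector_diff_chain_at[OF sh orbit_derivs(1)[OF orbit_flow]] by (simp add: o_def)
    show "((\<lambda>t. snd (\<Phi> (t + u) x)) has_vector_derivative
        B (fst (\<Phi> (v + u) x)) *\<^sub>R J (snd (\<Phi> (v + u) x))) (at v)"
      using vector_diff_chain_at[OF sh orbit_derivs(2)[OF orbit_flow]] by (simp add: o_def)
  qed simp
  then show ?thesis by simp
qed

lemma time_one_iterate: "(\<Phi> 1 ^^ i) x = \<Phi> (real i) x"
proof (induction i)
  case (Suc i)
  then show ?case
    using flow_add[of 1 "real i" x] by (simp add: add.commute)
qed simp

text \<open>The lifted turn of the velocity along the orbit of \<open>x\<close>, normalised to vanish at time \<open>0\<close>.\<close>

definition turn :: "phase \<Rightarrow> real \<Rightarrow> real" where
  "turn x = (SOME f. f 0 = 0 \<and> (\<forall>t. (f has_real_derivative - B (fst (\<Phi> t x))) (at t)))"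

lemma turn_0 [simp]: "turn x 0 = 0" and turn_deriv: "(turn x has_real_derivative - B (fst (\<Phi> t x))) (at t)"
proof -
  have "continuous_on UNIV (\<lambda>t. - B (fst (\<Phi> t x)))"
    by (intro continuous_intros continuous_on_compose2[OF lipschitz_on_continuous_on[OF B_lip]]
        continuous_flow) auto
  then have "\<exists>f. f 0 = 0 \<and> (\<forall>t. (f has_real_derivative - B (fst (\<Phi> t x))) (at t))"
    by (metis global_antiderivative)
  from someI_ex[OF this]
  show "turn x 0 = 0" "(turn x has_real_derivative - B (fst (\<Phi> t x))) (at t)"
    by (auto simp: turn_def)
qed

lemma turn_add:
  assumes "0 \<le> t"
  shows "turn x (t + u) = turn x u + turn (\<Phi> u x) t"
proof -
  have "((\<lambda>v. turn x (v + u) - turn (\<Phi> u x) v) has_real_derivative 0) (at v within {0..t})" if "v \<in> {0..t}" for v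
  proof -
    have "((\<lambda>v. turn x (v + u)) has_real_derivative - B (fst (\<Phi> (v + u) x))) (at v)"
      using turn_deriv[of x "v + u"] by (simp add: DERIV_shift)
    from DERIV_diff[OF this turn_deriv[of "\<Phi> u x" v]] show ?thesis
      using that flow_add[of v u x] by (auto intro: has_field_derivative_at_within)
  qed
  then have "\<exists>c. \<forall>v\<in>{0..t}. turn x (v + u) - turn (\<Phi> u x) v = c"
    using has_field_derivative_zero_constant[of "{0..t}"] by auto
  then have "turn x (t + u) - turn (\<Phi> u x) t = turn x (0 + u) - turn (\<Phi> u x) 0"
    using assms by (metis atLeastAtMost_iff order_refl)
  then show ?thesis by simp
qed

lemma momentum_direction:
  assumes "snd x = s *\<^sub>R dir \<omega>"
  shows "snd (\<Phi> t x) = s *\<^sub>R dir (\<omega> + turn x t)"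
proof (rule angle_lift[OF orbit_flow])
  show "((\<lambda>t. \<omega> + turn x t) has_real_derivative - B (fst (\<Phi> t x))) (at t)" for t
    using DERIV_add[OF DERIV_const turn_deriv, of \<omega> x t] by simp
qed (use assms in auto)

end

text \<open>The state on the boundary of the disc of radius \<open>R\<close> about \<open>c\<close> with speed \<open>s\<close>, direction \<open>\<theta>\<close> and
  momentum \<open>b\<close> about \<open>c\<close>: the state at the exit for \<open>\<sigma> = 1\<close> and at the entry for \<open>\<sigma> = - 1\<close>.\<close>

definition boundary_state :: "real \<Rightarrow> real ^ 2 \<Rightarrow> real \<Rightarrow> real \<Rightarrow> real \<Rightarrow> real \<Rightarrow> phase" where
  "boundary_state \<sigma> c R s b \<theta> =
     (c + (\<sigma> * sqrt ((R * s)\<^sup>2 - b\<^sup>2) / s) *\<^sub>R dir \<theta> + (b / s) *\<^sub>R J (dir \<theta>), s *\<^sub>R dir \<theta>)"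

lemma boundary_state_eqI:
  assumes s: "0 < s" and R: "norm (q - c) = R" and b: "(q - c) \<bullet> J (s *\<^sub>R dir \<theta>) = b"
    and \<sigma>: "\<sigma>\<^sup>2 = 1" "0 \<le> \<sigma> * ((q - c) \<bullet> (s *\<^sub>R dir \<theta>))"
  shows "(q, s *\<^sub>R dir \<theta>) = boundary_state \<sigma> c R s b \<theta>"
proof -
  let ?W = "(q - c) \<bullet> (s *\<^sub>R dir \<theta>)"
  have "?W\<^sup>2 + b\<^sup>2 = (R * s)\<^sup>2"
    using inner_J_pythagoras[of "q - c" "s *\<^sub>R dir \<theta>"] b R s by (simp add: power_mult_distrib)
  then have "(R * s)\<^sup>2 - b\<^sup>2 = (\<sigma> * ?W)\<^sup>2"
    using \<sigma> by (simp add: power_mult_distrib)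
  then have "sqrt ((R * s)\<^sup>2 - b\<^sup>2) = \<sigma> * ?W"
    using \<sigma>(2) by simp
  then have W: "\<sigma> * sqrt ((R * s)\<^sup>2 - b\<^sup>2) = ?W"
    using \<sigma>(1) by (simp add: power2_eq_square mult.assoc[symmetric])
  have "q - c = ((q - c) \<bullet> dir \<theta>) *\<^sub>R dir \<theta> + ((q - c) \<bullet> J (dir \<theta>)) *\<^sub>R J (dir \<theta>)"
    using J_decomposition[of "dir \<theta>" "q - c"] by simp
  also have "(q - c) \<bullet> dir \<theta> = \<sigma> * sqrt ((R * s)\<^sup>2 - b\<^sup>2) / s"
    using s unfolding W by simp
  also have "(q - c) \<bullet> J (dir \<theta>) = b / s"
    using s b[symmetric] by (simp add: J_scale)
  finally have "q = c + (\<sigma> * sqrt ((R * s)\<^sup>2 - b\<^sup>2) / s) *\<^sub>R dir \<theta> + (b / s) *\<^sub>R J (dir \<theta>)"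
    by (simp add: algebra_simps)
  then show ?thesis
    by (simp add: boundary_state_def)
qed

text \<open>Applied to the given orbit, and to the reversed orbit, which is an orbit of \<open>- B\<close> with the opposite
  sign \<open>\<epsilon>\<close> but with the same \<open>\<beta>\<close>.\<close>

lemma (in whirl) orbit_traj:
  assumes orb: "orbit B q p" and speed: "norm (p 0) = s" and \<epsilon>: "\<epsilon> * \<epsilon> = (1::real)"
    and field: "\<And>x. norm (x - c) \<le> R' \<Longrightarrow> B x = \<epsilon> * \<beta> (norm (x - c))"
    and start: "norm (q 0 - c) = \<rho>" "(q 0 - c) \<bullet> p 0 = 0" "(q 0 - c) \<bullet> J (p 0) = - \<epsilon> * \<rho> * s"
    and A: "A 0 = 0" "\<And>t. (A has_real_derivative \<epsilon> * B (q t)) (at t)"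
  shows "traj \<rho> (\<lambda>t. norm (q t - c)) (\<lambda>t. (q t - c) \<bullet> p t) (\<lambda>t. - \<epsilon> * ((q t - c) \<bullet> J (p t))) A"
proof -
  have "continuous_on {0..} (\<lambda>t. norm (q t - c))"
    by (intro continuous_intros orbit_continuous[OF orb])
  moreover have "- \<epsilon> * ((q 0 - c) \<bullet> J (p 0)) = \<rho> * s"
    using \<epsilon> by (simp add: start mult.assoc[symmetric])
  moreover have "((\<lambda>t. norm (q t - c)) has_real_derivative (q t - c) \<bullet> p t / norm (q t - c)) (at t) \<and>
      ((\<lambda>t. (q t - c) \<bullet> p t) has_real_derivative
         s\<^sup>2 - \<beta> (norm (q t - c)) * (- \<epsilon> * ((q t - c) \<bullet> J (p t)))) (at t) \<and>
      ((\<lambda>t. - \<epsilon> * ((q t - c) \<bullet> J (p t))) has_real_derivative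
         \<beta> (norm (q t - c)) * ((q t - c) \<bullet> p t)) (at t) \<and>
      (A has_real_derivative \<beta> (norm (q t - c))) (at t) \<and>
      ((q t - c) \<bullet> p t)\<^sup>2 + (- \<epsilon> * ((q t - c) \<bullet> J (p t)))\<^sup>2 = (norm (q t - c) * s)\<^sup>2"
    if "0 < norm (q t - c)" "norm (q t - c) \<le> R'" for t
  proof -
    note d = orbit_radial_derivs[OF orb speed, where c = c and t = t]
    have f: "B (q t) = \<epsilon> * \<beta> (norm (q t - c))"
      by (rule field[OF that(2)])
    have \<beta>: "\<beta> (norm (q t - c)) = \<epsilon> * B (q t)"
      using \<epsilon> by (simp add: f mult.assoc[symmetric])
    have "s\<^sup>2 - \<beta> (norm (q t - c)) * (- \<epsilon> * ((q t - c) \<bullet> J (p t)))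
        = s\<^sup>2 + (\<epsilon> * \<epsilon>) * B (q t) * ((q t - c) \<bullet> J (p t))"
      unfolding \<beta> by (simp add: mult_ac)
    then have W: "s\<^sup>2 - \<beta> (norm (q t - c)) * (- \<epsilon> * ((q t - c) \<bullet> J (p t)))
        = s\<^sup>2 + B (q t) * ((q t - c) \<bullet> J (p t))"
      by (simp add: \<epsilon>)
    have \<Lambda>: "\<beta> (norm (q t - c)) * ((q t - c) \<bullet> p t) = - \<epsilon> * (- B (q t) * ((q t - c) \<bullet> p t))"
      unfolding \<beta> by simp
    have "(- \<epsilon> * x)\<^sup>2 = (\<epsilon> * \<epsilon>) * x\<^sup>2" for x
      by (simp add: power_mult_distrib power2_eq_square)
    then have sq: "(- \<epsilon> * x)\<^sup>2 = x\<^sup>2" for x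
      by (simp add: \<epsilon>)
    show ?thesis
      unfolding W \<Lambda> sq unfolding \<beta>
      using d(1,4) d(3)[unfolded zero_less_norm_iff] that(1) A(2) DERIV_cmult[OF d(2), of "- \<epsilon>"] by auto
  qed
  ultimately show ?thesis
    unfolding traj_def using start A(1) by auto
qed

locale scatterer = magnetic_flow B \<Phi> LB M + whirl \<beta> a R R' s Lp
  for B \<Phi> LB M \<beta> a R R' s Lp +
  fixes c :: "real ^ 2" and \<epsilon> :: real
  assumes sign: "\<epsilon> * \<epsilon> = 1"
    and field: "\<And>x. norm (x - c) \<le> R' \<Longrightarrow> B x = \<epsilon> * \<beta> (norm (x - c))"
begin

abbreviation "turning_point \<rho> \<omega> \<equiv> (c - (\<epsilon> * \<rho>) *\<^sub>R J (dir \<omega>), s *\<^sub>R dir \<omega>)"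

lemma \<epsilon>_cases: "\<epsilon> = 1 \<or> \<epsilon> = - 1"
  using sign by (simp add: square_eq_1_iff)

lemma sign_cancel: "- \<epsilon> * x = y \<Longrightarrow> x = - \<epsilon> * y"
  using \<epsilon>_cases by auto

lemma forward_traj:
  fixes \<rho> \<omega> :: real
  assumes "0 < \<rho>"
  defines "x \<equiv> turning_point \<rho> \<omega>"
  shows "traj \<rho> (\<lambda>t. norm (fst (\<Phi> t x) - c)) (\<lambda>t. (fst (\<Phi> t x) - c) \<bullet> snd (\<Phi> t x))
     (\<lambda>t. - \<epsilon> * ((fst (\<Phi> t x) - c) \<bullet> J (snd (\<Phi> t x)))) (\<lambda>t. - \<epsilon> * turn x t)"
proof (rule orbit_traj[OF orbit_flow _ sign field])
  show "norm (fst (\<Phi> 0 x) - c) = \<rho>"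
    using assms \<epsilon>_cases by auto
  show "((\<lambda>t. - \<epsilon> * turn x t) has_real_derivative \<epsilon> * B (fst (\<Phi> t x))) (at t)" for t
    using DERIV_cmult[OF turn_deriv, of "- \<epsilon>" x t] by simp
qed (use s_pos in \<open>simp_all add: x_def J_scale J_inner dir_inner_dir\<close>)

lemma backward_traj:
  fixes \<rho> \<omega> :: real
  assumes "0 < \<rho>"
  defines "x \<equiv> turning_point \<rho> \<omega>"
  shows "traj \<rho> (\<lambda>t. norm (fst (\<Phi> (- t) x) - c)) (\<lambda>t. (fst (\<Phi> (- t) x) - c) \<bullet> (- snd (\<Phi> (- t) x)))
     (\<lambda>t. - (- \<epsilon>) * ((fst (\<Phi> (- t) x) - c) \<bullet> J (- snd (\<Phi> (- t) x)))) (\<lambda>t. \<epsilon> * turn x (- t))"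
proof (rule orbit_traj[OF orbit_reverse[OF orbit_flow]])
  show "norm (fst (\<Phi> (- 0) x) - c) = \<rho>"
    using assms \<epsilon>_cases by auto
  have "((\<lambda>t. turn x (- t)) has_real_derivative - (- B (fst (\<Phi> (- t) x)))) (at t)" for t
    using turn_deriv[of x "- t"] DERIV_mirror[of "turn x" "- B (fst (\<Phi> (- t) x))" t] by simp
  from DERIV_cmult[OF this, of \<epsilon>]
  show "((\<lambda>t. \<epsilon> * turn x (- t)) has_real_derivative - \<epsilon> * - B (fst (\<Phi> (- t) x))) (at t)" for t
    by simp
  show "- \<epsilon> * - \<epsilon> = 1" using sign by simp
qed (use s_pos field in \<open>simp_all add: x_def J_scale J_inner J_minus dir_inner_dir\<close>)

lemma turns_exists:
  assumes "a < \<rho>" "\<rho> < R"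
  shows "\<exists>x. turns \<rho> x"
proof -
  have "0 < \<rho>" using assms a_pos by simp
  show ?thesis
    by (rule escape[OF forward_traj[OF \<open>0 < \<rho>\<close>, of 0] assms]) (rule exI, erule passage_turns)
qed

abbreviation "entry b \<theta> \<equiv> boundary_state (- 1) c R s b \<theta>"
abbreviation "exit b \<theta> \<equiv> boundary_state 1 c R s b \<theta>"

text \<open>A bump keeps the momentum and turns the direction by \<open>- 2 \<epsilon> h\<close>. The orbit is built from its
  point of closest approach: the halves before and after this point obey the same reduced system and contribute equal angles.\<close>

lemma pass:
  assumes \<rho>: "a < \<rho>" "\<rho> < R" and a0: "0 < a0" "a0 \<le> a"
  defines "b \<equiv> - \<epsilon> * exit_moment \<rho>" and "h \<equiv> half_angle \<rho>" and "k \<equiv> 1 / (2 * R) + 1 / a0"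
  obtains \<tau> where "0 < \<tau>" "\<Phi> \<tau> (entry b \<theta>) = exit b (\<theta> - 2 * \<epsilon> * h)"
    "turn (entry b \<theta>) \<tau> = - 2 * \<epsilon> * h"
    "\<And>t. 0 \<le> t \<Longrightarrow> t \<le> \<tau> \<Longrightarrow> norm (fst (\<Phi> t (entry b \<theta>)) - c) \<le> R"
    "s * \<tau> \<le> 4 * R * (h + (2 * k * R + k / a0 * R\<^sup>2 / 2))"
proof -
  \<comment> \<open>direction of motion at the closest approach, half way between the directions at entry and exit\<close>
  define \<omega> where "\<omega> = \<theta> - \<epsilon> * h"
  define x where "x = turning_point \<rho> \<omega>"
  have \<rho>0: "0 < \<rho>" using \<rho> a_pos by simp
  obtain \<tau>1 T1 where p1: "passage \<rho> (\<lambda>t. norm (fst (\<Phi> t x) - c)) (\<lambda>t. (fst (\<Phi> t x) - c) \<bullet> snd (\<Phi> t x))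
     (\<lambda>t. - \<epsilon> * ((fst (\<Phi> t x) - c) \<bullet> J (snd (\<Phi> t x)))) (\<lambda>t. - \<epsilon> * turn x t) \<tau>1 T1"
    using escape[OF forward_traj[OF \<rho>0, of \<omega>] \<rho>] unfolding x_def by blast
  obtain \<tau>2 T2 where p2: "passage \<rho> (\<lambda>t. norm (fst (\<Phi> (- t) x) - c)) (\<lambda>t. (fst (\<Phi> (- t) x) - c) \<bullet> (- snd (\<Phi> (- t) x)))
     (\<lambda>t. - (- \<epsilon>) * ((fst (\<Phi> (- t) x) - c) \<bullet> J (- snd (\<Phi> (- t) x)))) (\<lambda>t. \<epsilon> * turn x (- t)) \<tau>2 T2"
    using escape[OF backward_traj[OF \<rho>0, of \<omega>] \<rho>] unfolding x_def by blast
  have \<tau>: "0 < \<tau>1" "\<tau>1 < T1" "0 < \<tau>2" "\<tau>2 < T2"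
    and r: "norm (fst (\<Phi> \<tau>1 x) - c) = R" "norm (fst (\<Phi> (- \<tau>2) x) - c) = R"
    using p1 p2 unfolding passage_def by blast+
  have W1: "0 < (fst (\<Phi> \<tau>1 x) - c) \<bullet> snd (\<Phi> \<tau>1 x)"
    using p1 \<tau> unfolding passage_def by (meson less_imp_le)
  have W2: "0 < (fst (\<Phi> (- \<tau>2) x) - c) \<bullet> (- snd (\<Phi> (- \<tau>2) x))"
    using p2 \<tau> unfolding passage_def by (meson less_imp_le)
  have h1: "- \<epsilon> * turn x \<tau>1 = h"
    using half_angle_eq[OF passage_turns[OF p1] \<rho>(1)] by (simp add: h_def)
  have h2: "\<epsilon> * turn x (- \<tau>2) = h"
    using half_angle_eq[OF passage_turns[OF p2] \<rho>(1)] by (simp add: h_def)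
  have turn1: "turn x \<tau>1 = - \<epsilon> * h"
    unfolding h1[symmetric] using sign by (simp add: mult.assoc[symmetric])
  have turn2: "turn x (- \<tau>2) = \<epsilon> * h"
    unfolding h2[symmetric] using sign by (simp add: mult.assoc[symmetric])
  have "- \<epsilon> * ((fst (\<Phi> \<tau>1 x) - c) \<bullet> J (snd (\<Phi> \<tau>1 x))) = exit_moment \<rho>"
    using passage_exit_moment[OF p1] \<rho> by simp
  then have L1: "(fst (\<Phi> \<tau>1 x) - c) \<bullet> J (snd (\<Phi> \<tau>1 x)) = b"
    unfolding b_def by (rule sign_cancel)
  have "- \<epsilon> * ((fst (\<Phi> (- \<tau>2) x) - c) \<bullet> J (snd (\<Phi> (- \<tau>2) x))) = exit_moment \<rho>"
    using passage_exit_moment[OF p2] \<rho> by (simp add: J_minus)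
  then have L2: "(fst (\<Phi> (- \<tau>2) x) - c) \<bullet> J (snd (\<Phi> (- \<tau>2) x)) = b"
    unfolding b_def by (rule sign_cancel)
  have "snd x = s *\<^sub>R dir \<omega>" by (simp add: x_def)
  from momentum_direction[OF this]
  have d1: "snd (\<Phi> \<tau>1 x) = s *\<^sub>R dir (\<theta> - 2 * \<epsilon> * h)" and d2: "snd (\<Phi> (- \<tau>2) x) = s *\<^sub>R dir \<theta>"
    by (simp_all add: turn1 turn2 \<omega>_def algebra_simps)
  have "(fst (\<Phi> \<tau>1 x), s *\<^sub>R dir (\<theta> - 2 * \<epsilon> * h)) = exit b (\<theta> - 2 * \<epsilon> * h)"
    by (rule boundary_state_eqI) (use s_pos r W1 L1 d1 in auto)
  then have x1: "\<Phi> \<tau>1 x = exit b (\<theta> - 2 * \<epsilon> * h)"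
    by (simp add: d1[symmetric])
  have "(fst (\<Phi> (- \<tau>2) x), s *\<^sub>R dir \<theta>) = entry b \<theta>"
    by (rule boundary_state_eqI) (use s_pos r W2 L2 d2 in auto)
  then have x2: "\<Phi> (- \<tau>2) x = entry b \<theta>"
    by (simp add: d2[symmetric])
  have shift: "\<Phi> t (entry b \<theta>) = \<Phi> (t - \<tau>2) x" if "0 \<le> t" for t
    using flow_add[OF that, of "- \<tau>2" x] x2 by simp
  have ap: "a \<le> \<rho>" using \<rho> by simp
  have k: "s * \<tau>1 / (2 * R) - (2 * k * R + k / a0 * R\<^sup>2 / 2) \<le> h"
    "s * \<tau>2 / (2 * R) - (2 * k * R + k / a0 * R\<^sup>2 / 2) \<le> h"
    using angle_lower_bound[OF p1 ap a0] angle_lower_bound[OF p2 ap a0] h1 h2 by (simp_all add: k_def)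
  show thesis
  proof (rule that[of "\<tau>1 + \<tau>2"])
    show "0 < \<tau>1 + \<tau>2" using \<tau> by simp
    show "\<Phi> (\<tau>1 + \<tau>2) (entry b \<theta>) = exit b (\<theta> - 2 * \<epsilon> * h)"
      using shift[of "\<tau>1 + \<tau>2"] x1 \<tau> by simp
    show "turn (entry b \<theta>) (\<tau>1 + \<tau>2) = - 2 * \<epsilon> * h"
      using turn_add[of "\<tau>1 + \<tau>2" x "- \<tau>2"] \<tau> x2 turn1 turn2 by simp
    show "norm (fst (\<Phi> t (entry b \<theta>)) - c) \<le> R" if t: "0 \<le> t" "t \<le> \<tau>1 + \<tau>2" for t
    proof (cases "\<tau>2 \<le> t")
      case True
      then show ?thesis
        using passage_inside[OF p1 ap, of "t - \<tau>2"] t shift[OF t(1)] by simp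
    next
      case False
      then show ?thesis
        using passage_inside[OF p2 ap, of "\<tau>2 - t"] t shift[OF t(1)] by simp
    qed
    have "s * (\<tau>1 + \<tau>2) / (2 * R) \<le> 2 * (h + (2 * k * R + k / a0 * R\<^sup>2 / 2))"
      using k by (simp add: distrib_left add_divide_distrib)
    then show "s * (\<tau>1 + \<tau>2) \<le> 4 * R * (h + (2 * k * R + k / a0 * R\<^sup>2 / 2))"
      using R_pos by (simp add: pos_divide_le_eq mult_ac)
  qed
qed

end

section \<open>Lines and flights between two bumps\<close>

lemma dir_inner_self [simp]: "dir \<theta> \<bullet> dir \<theta> = 1"
  by (simp add: dir_inner_dir)

lemma rotation_dir: "rotation \<phi> *v (r *\<^sub>R dir \<theta>) = r *\<^sub>R dir (\<theta> + \<phi>)"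
  by (simp add: rotation_def matrix_vector_mult_def vec_eq_iff forall_2 sum_2 cos_add sin_add algebra_simps)

lemma dir_eq_imp_cos: "dir x = dir y \<Longrightarrow> cos (x - y) = 1"
  by (metis dir_inner_dir norm_dir norm_eq_1)

lemma cos_less_1:
  fixes x :: real
  assumes "0 < x" "x < 2 * pi"
  shows "cos x \<noteq> 1"
proof
  assume "cos x = 1"
  then obtain n :: int where n: "x = of_int n * 2 * pi"
    unfolding cos_one_2pi_int by blast
  then have "0 < real_of_int n" "real_of_int n < 1"
    using assms by (auto simp: zero_less_mult_iff)
  then show False by (simp only: of_int_0_less_iff of_int_less_1_iff)
qed

text \<open>The bound on the total angle excludes that the arc reaches its end point too early after a full
  revolution.\<close>

lemma mem_circle_arcI:
  assumes r: "0 < r" and \<sigma>: "\<sigma> * \<sigma> = 1" and before: "0 \<le> \<sigma> * (\<eta> - \<eta>u)" and after: "0 \<le> \<sigma> * (\<eta>v - \<eta>)"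
    and less: "\<sigma> * (\<eta>v - \<eta>u) < 2 * pi"
  shows "c + r *\<^sub>R dir \<eta> \<in> circle_arc \<sigma> c (c + r *\<^sub>R dir \<eta>u) (c + r *\<^sub>R dir \<eta>v)"
proof -
  define \<theta> where "\<theta> = \<sigma> * (\<eta> - \<eta>u)"
  have "\<sigma> * \<theta> = \<eta> - \<eta>u"
    using \<sigma> by (simp add: \<theta>_def mult.assoc[symmetric])
  then have "c + r *\<^sub>R dir \<eta> = c + rotation (\<sigma> * \<theta>) *v (c + r *\<^sub>R dir \<eta>u - c)"
    by (simp add: rotation_dir)
  moreover have "c + rotation (\<sigma> * \<psi>) *v (c + r *\<^sub>R dir \<eta>u - c) \<noteq> c + r *\<^sub>R dir \<eta>v"
    if "0 \<le> \<psi>" "\<psi> < \<theta>" for \<psi>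
  proof
    assume "c + rotation (\<sigma> * \<psi>) *v (c + r *\<^sub>R dir \<eta>u - c) = c + r *\<^sub>R dir \<eta>v"
    then have "dir (\<eta>u + \<sigma> * \<psi>) = dir \<eta>v"
      using r by (simp add: rotation_dir)
    from dir_eq_imp_cos[OF this[symmetric]] have "cos (\<eta>v - (\<eta>u + \<sigma> * \<psi>)) = 1" .
    moreover have "\<sigma> = 1 \<or> \<sigma> = -1"
      using \<sigma> by (simp add: square_eq_1_iff)
    ultimately have c1: "cos (\<sigma> * (\<eta>v - (\<eta>u + \<sigma> * \<psi>))) = 1"
      by (metis cos_minus mult_1 mult_minus1)
    have e1: "\<sigma> * (\<eta>v - (\<eta>u + \<sigma> * \<psi>)) = \<sigma> * (\<eta>v - \<eta>u) - \<psi>"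
      using \<sigma> by (simp add: algebra_simps mult.assoc[symmetric])
    have e2: "\<sigma> * (\<eta>v - \<eta>u) - \<psi> = \<sigma> * (\<eta>v - \<eta>) + (\<theta> - \<psi>)"
      by (simp add: \<theta>_def algebra_simps)
    have "cos (\<sigma> * (\<eta>v - \<eta>u) - \<psi>) = 1"
      using c1 unfolding e1 .
    moreover have "0 < \<sigma> * (\<eta>v - \<eta>u) - \<psi>" "\<sigma> * (\<eta>v - \<eta>u) - \<psi> < 2 * pi"
      using e2 that after less by linarith+
    ultimately show False
      using cos_less_1 by blast
  qed
  ultimately show ?thesis
    unfolding circle_arc_def using before by (auto simp: \<theta>_def)
qed

text \<open>The geometric reason for the shape of the arcs: the discs are disjoint, so that
  \<open>\<rho>\<^sup>2 - u\<^sup>2 \<le> D\<^sup>2 - (u - y)\<^sup>2\<close>, and the derivatives of the two arcsines compare accordingly.\<close>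

lemma arcsin_difference_mono:
  fixes \<rho> \<rho>' D x x' y :: real
  assumes \<rho>: "0 < \<rho>" "0 < \<rho>'" "\<rho> + \<rho>' < D" and y: "\<bar>y\<bar> \<le> \<rho>'" and x: "- \<rho> \<le> x" "x \<le> x'" "x' \<le> \<rho>"
  shows "arcsin (x / \<rho>) - arcsin ((x - y) / D) \<le> arcsin (x' / \<rho>) - arcsin ((x' - y) / D)"
proof (rule DERIV_nonneg_imp_increasing_open[OF x(2)])
  have D: "0 < D" using \<rho> by simp
  have bD: "\<bar>u - y\<bar> < D" if "- \<rho> \<le> u" "u \<le> \<rho>" for u
    using that \<rho> y by linarith
  show "continuous_on {x..x'} (\<lambda>x. arcsin (x / \<rho>) - arcsin ((x - y) / D))"
  proof (intro continuous_intros ballI)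
    fix u assume "u \<in> {x..x'}"
    then have u: "- \<rho> \<le> u" "u \<le> \<rho>" using x by auto
    show "- 1 \<le> u / \<rho> \<and> u / \<rho> \<le> 1"
      using u \<rho> by (simp add: field_simps)
    show "- 1 \<le> (u - y) / D \<and> (u - y) / D \<le> 1"
      using bD[OF u] D by (simp add: field_simps abs_less_iff)
  qed (use \<rho> D in auto)
  fix u assume u: "x < u" "u < x'"
  have u1: "- 1 < u / \<rho>" "u / \<rho> < 1"
    using u x \<rho> by (simp_all add: field_simps)
  have u2: "- 1 < (u - y) / D" "(u - y) / D < 1"
  proof -
    have "\<bar>u - y\<bar> < D"
      by (rule bD) (use u x in auto)
    then have "- D < u - y" "u - y < D" by linarith+
    then show "- 1 < (u - y) / D" "(u - y) / D < 1"
      using D by (simp_all add: pos_less_divide_eq pos_divide_less_eq)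
  qed
  have d: "((\<lambda>x. arcsin (x / \<rho>) - arcsin ((x - y) / D)) has_real_derivative
      inverse (sqrt (1 - (u / \<rho>)\<^sup>2)) * (1 / \<rho>) - inverse (sqrt (1 - ((u - y) / D)\<^sup>2)) * (1 / D)) (at u)"
  proof (rule DERIV_diff)
    show "((\<lambda>x. arcsin (x / \<rho>)) has_real_derivative inverse (sqrt (1 - (u / \<rho>)\<^sup>2)) * (1 / \<rho>)) (at u)"
      by (rule DERIV_chain2[where f = arcsin and g = "\<lambda>x. x / \<rho>" and x = u, OF DERIV_arcsin[OF u1]])
        (use \<rho> in \<open>auto intro!: derivative_eq_intros\<close>)
    show "((\<lambda>x. arcsin ((x - y) / D)) has_real_derivative inverse (sqrt (1 - ((u - y) / D)\<^sup>2)) * (1 / D)) (at u)"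
      by (rule DERIV_chain2[where f = arcsin and g = "\<lambda>x. (x - y) / D" and x = u, OF DERIV_arcsin[OF u2]])
        (use D in \<open>auto intro!: derivative_eq_intros\<close>)
  qed
  have sq: "sqrt (1 - (w / r)\<^sup>2) * r = sqrt (r\<^sup>2 - w\<^sup>2)" if "0 < r" for w r :: real
  proof -
    have "sqrt (1 - (w / r)\<^sup>2) * r = sqrt (1 - (w / r)\<^sup>2) * sqrt (r\<^sup>2)"
      using that by simp
    also have "\<dots> = sqrt ((1 - (w / r)\<^sup>2) * r\<^sup>2)"
      by (rule real_sqrt_mult[symmetric])
    also have "(1 - (w / r)\<^sup>2) * r\<^sup>2 = r\<^sup>2 - w\<^sup>2"
      using that by (simp add: power_divide algebra_simps)
    finally show ?thesis .
  qed
  have pos: "0 < \<rho>\<^sup>2 - u\<^sup>2"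
    using abs_square_less_1[of "u / \<rho>"] u1 \<rho> by (simp add: power_divide abs_less_iff field_simps)
  have "\<rho>\<^sup>2 - u\<^sup>2 \<le> D\<^sup>2 - (u - y)\<^sup>2"
  proof -
    have "(\<rho> + \<rho>')\<^sup>2 \<le> D\<^sup>2"
      using \<rho> by (intro power_mono) auto
    moreover have "y\<^sup>2 \<le> \<rho>'\<^sup>2"
      using y \<rho> by (metis abs_le_square_iff abs_of_pos)
    moreover have "\<bar>u * y\<bar> \<le> \<rho> * \<rho>'"
      unfolding abs_mult using u x y \<rho> by (intro mult_mono) auto
    then have "- (\<rho> * \<rho>') \<le> u * y" by linarith
    ultimately show ?thesis
      by (simp add: power2_eq_square algebra_simps)
  qed
  then have "inverse (sqrt (D\<^sup>2 - (u - y)\<^sup>2)) \<le> inverse (sqrt (\<rho>\<^sup>2 - u\<^sup>2))"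
    using pos by (intro le_imp_inverse_le) auto
  then have "inverse (sqrt (1 - ((u - y) / D)\<^sup>2)) * (1 / D) \<le> inverse (sqrt (1 - (u / \<rho>)\<^sup>2)) * (1 / \<rho>)"
    unfolding sq[OF D, symmetric] sq[OF \<rho>(1), symmetric] by (simp add: divide_inverse)
  then show "\<exists>z. ((\<lambda>x. arcsin (x / \<rho>) - arcsin ((x - y) / D)) has_real_derivative z) (at u) \<and> 0 \<le> z"
    using d by (intro exI conjI) auto
qed

lemma moment_square_le: "\<bar>b\<bar> \<le> x \<Longrightarrow> b\<^sup>2 \<le> x\<^sup>2" for b x :: real
  by (metis abs_ge_self abs_le_square_iff order_trans)

lemma boundary_state_props:
  fixes c :: "real ^ 2" and \<theta> :: real
  assumes s: "0 < s" and b: "\<bar>b\<bar> \<le> R * s" and \<sigma>: "\<sigma>\<^sup>2 = 1" and R: "0 < R"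
  defines "x \<equiv> fst (boundary_state \<sigma> c R s b \<theta>)"
  shows "norm (x - c) = R" "(x - c) \<bullet> J (dir \<theta>) = b / s" "(x - c) \<bullet> dir \<theta> = \<sigma> * sqrt ((R * s)\<^sup>2 - b\<^sup>2) / s"
proof -
  show 1: "(x - c) \<bullet> J (dir \<theta>) = b / s"
    by (simp add: x_def boundary_state_def inner_add_left dir_inner_dir)
  show 2: "(x - c) \<bullet> dir \<theta> = \<sigma> * sqrt ((R * s)\<^sup>2 - b\<^sup>2) / s"
    by (simp add: x_def boundary_state_def inner_add_left dir_inner_dir)
  have "b\<^sup>2 \<le> (R * s)\<^sup>2"
    using b by (rule moment_square_le)
  then have "(norm (x - c))\<^sup>2 = R\<^sup>2"
    using inner_J_pythagoras[of "x - c" "dir \<theta>"] s \<sigma> unfolding 1 2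
    by (simp add: power_divide power_mult_distrib flip: add_divide_distrib)
  then show "norm (x - c) = R"
    using R by (simp add: power2_eq_iff_nonneg)
qed

lemma boundary_state_exit_angle:
  assumes s: "0 < s" and b: "\<bar>b\<bar> \<le> R * s" and R: "0 < R"
  shows "fst (boundary_state 1 c R s b \<theta>) = c + R *\<^sub>R dir (\<theta> - arcsin (b / (R * s)))"
    and "fst (boundary_state (- 1) c R s b \<theta>) = c + R *\<^sub>R dir (\<theta> + pi + arcsin (b / (R * s)))"
proof -
  have Rs: "0 < R * s" using s R by simp
  let ?A = "arcsin (b / (R * s))"
  have b1: "- 1 \<le> b / (R * s)" "b / (R * s) \<le> 1"
    using b Rs by (simp_all add: pos_le_divide_eq pos_divide_le_eq abs_le_iff)
  have sn: "R * sin ?A = b / s"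
    using b1 R by simp
  have "R * cos ?A = R * sqrt (1 - (b / (R * s))\<^sup>2)"
    using cos_arcsin[OF b1] by simp
  also have "1 - (b / (R * s))\<^sup>2 = ((R * s)\<^sup>2 - b\<^sup>2) / (R * s)\<^sup>2"
    using R s by (simp add: power_divide diff_divide_distrib)
  finally have cs: "R * cos ?A = sqrt ((R * s)\<^sup>2 - b\<^sup>2) / s"
    using R s by (simp add: real_sqrt_divide)
  have comb: "R *\<^sub>R dir (\<theta> - ?A) = (R * cos ?A) *\<^sub>R dir \<theta> + (R * sin ?A) *\<^sub>R J (dir \<theta>)"
    by (simp add: vec_eq_iff forall_2 cos_diff sin_diff algebra_simps)
  have comb': "R *\<^sub>R dir (\<theta> + pi + ?A) = - (R * cos ?A) *\<^sub>R dir \<theta> + (R * sin ?A) *\<^sub>R J (dir \<theta>)"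
    by (simp add: vec_eq_iff forall_2 cos_add sin_add algebra_simps)
  show "fst (boundary_state 1 c R s b \<theta>) = c + R *\<^sub>R dir (\<theta> - ?A)"
    unfolding comb sn cs by (simp add: boundary_state_def add.assoc)
  show "fst (boundary_state (- 1) c R s b \<theta>) = c + R *\<^sub>R dir (\<theta> + pi + ?A)"
    unfolding comb' sn cs by (simp add: boundary_state_def add.assoc)
qed

text \<open>Two disjoint discs, the second at distance \<open>d\<close> in direction \<open>\<alpha>\<close> from the first one.\<close>

locale bump_pair =
  fixes c c' :: "real ^ 2" and R R' s d \<alpha> :: real
  assumes R_pos: "0 < R" and R'_pos: "0 < R'" and s_pos: "0 < s" and disjoint: "R + R' < d"
    and axis: "c' - c = d *\<^sub>R dir \<alpha>"
begin

lemma d_pos: "0 < d" using R_pos R'_pos disjoint by simp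

text \<open>The angle between the axis \<open>\<alpha>\<close> and the line with momentum \<open>a\<close> about the first and \<open>b\<close> about the
  second centre.\<close>

definition tilt :: "real \<Rightarrow> real \<Rightarrow> real" where
  "tilt a b = arcsin ((a - b) / (s * d))"

lemma tilt_arg:
  assumes "\<bar>a\<bar> \<le> R * s" "\<bar>b\<bar> \<le> R' * s"
  shows "\<bar>a - b\<bar> \<le> (R + R') * s" "\<bar>a - b\<bar> < s * d" "- 1 < (a - b) / (s * d)" "(a - b) / (s * d) < 1"
proof -
  show 1: "\<bar>a - b\<bar> \<le> (R + R') * s"
    using assms by (simp add: distrib_right abs_le_iff)
  have "(R + R') * s < d * s"
    using disjoint s_pos by (rule mult_strict_right_mono)
  with 1 show 2: "\<bar>a - b\<bar> < s * d"
    by (simp add: mult.commute)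
  have "0 < s * d" using s_pos d_pos by simp
  then show "- 1 < (a - b) / (s * d)" "(a - b) / (s * d) < 1"
    using 2 by (simp_all add: pos_less_divide_eq pos_divide_less_eq abs_less_iff)
qed

lemma tilt_bounds:
  assumes "\<bar>a\<bar> \<le> R * s" "\<bar>b\<bar> \<le> R' * s"
  shows "- (pi / 2) < tilt a b" "tilt a b < pi / 2" "sin (tilt a b) = (a - b) / (s * d)" "0 < cos (tilt a b)"
proof -
  note t = tilt_arg(3,4)[OF assms]
  show *: "- (pi / 2) < tilt a b" "tilt a b < pi / 2"
    using arcsin_lt_bounded[OF t] by (simp_all add: tilt_def)
  show "sin (tilt a b) = (a - b) / (s * d)"
    using t by (simp add: tilt_def)
  show "0 < cos (tilt a b)"
    using cos_gt_zero_pi * by simp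
qed

text \<open>An explicit form of \<open>ell E S S' a b\<close>.\<close>

definition line :: "real \<Rightarrow> real \<Rightarrow> dline" where
  "line a b = (range (\<lambda>t. c + (a / s) *\<^sub>R J (dir (\<alpha> + tilt a b)) + t *\<^sub>R dir (\<alpha> + tilt a b)), dir (\<alpha> + tilt a b))"

lemma snd_line [simp]: "snd (line a b) = dir (\<alpha> + tilt a b)"
  by (simp add: line_def)

lemma mem_line_iff: "x \<in> fst (line a b) \<longleftrightarrow> (x - c) \<bullet> J (dir (\<alpha> + tilt a b)) = a / s"
proof
  assume "x \<in> fst (line a b)"
  then show "(x - c) \<bullet> J (dir (\<alpha> + tilt a b)) = a / s"
    by (auto simp: line_def inner_add_left)
next
  let ?e = "dir (\<alpha> + tilt a b)"
  assume *: "(x - c) \<bullet> J ?e = a / s"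
  have "x - c = ((x - c) \<bullet> ?e) *\<^sub>R ?e + (a / s) *\<^sub>R J ?e"
    using J_decomposition[of ?e "x - c"] * by simp
  then have "x = c + (a / s) *\<^sub>R J ?e + ((x - c) \<bullet> ?e) *\<^sub>R ?e"
    by (simp add: algebra_simps)
  then show "x \<in> fst (line a b)"
    unfolding line_def by (metis fst_conv rangeI)
qed

lemma target_momentum:
  assumes "\<bar>a\<bar> \<le> R * s" "\<bar>b\<bar> \<le> R' * s"
  shows "(x - c) \<bullet> J (dir (\<alpha> + tilt a b)) = a / s \<longleftrightarrow> (x - c') \<bullet> J (dir (\<alpha> + tilt a b)) = b / s"
proof -
  have "(x - c) \<bullet> J (dir (\<alpha> + tilt a b)) = (x - c') \<bullet> J (dir (\<alpha> + tilt a b)) + (c' - c) \<bullet> J (dir (\<alpha> + tilt a b))"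
    by (simp flip: inner_add_left)
  also have "(c' - c) \<bullet> J (dir (\<alpha> + tilt a b)) = d * sin (tilt a b)"
    unfolding axis by (simp add: dir_inner_J_dir)
  also have "\<dots> = a / s - b / s"
    unfolding tilt_bounds(3)[OF assms] using s_pos d_pos by (simp add: field_simps)
  finally show ?thesis by auto
qed

text \<open>The difference of the momenta determines the sine of the angle between line and axis, and the
  orientation selects one of the two angles with this sine.\<close>

lemma ell_eq_line:
  assumes s: "s = sqrt (2 * E)" and c: "center S = c" "center S' = c'"
    and a: "\<bar>a\<bar> \<le> R * s" and b: "\<bar>b\<bar> \<le> R' * s"
  shows "ell E S S' a b = line a b"
  unfolding ell_def c
proof (rule the_equality)
  let ?e = "dir (\<alpha> + tilt a b)"
  have "is_dline (line a b)"
    by (auto simp: is_dline_def line_def)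
  moreover have "snd (line a b) \<bullet> (c' - c) > 0"
    using tilt_bounds(4)[OF a b] d_pos by (simp add: line_def axis dir_inner_dir)
  moreover have "(x - c) \<bullet> J ?e = a / s \<and> (x - c') \<bullet> J ?e = b / s" if "x \<in> fst (line a b)" for x
    using that mem_line_iff[of x a b] target_momentum[OF a b, of x] by blast
  then have "has_momentum E c (line a b) a" "has_momentum E c' (line a b) b"
    using s_pos by (simp_all add: has_momentum_def s[symmetric])
  ultimately show "is_dline (line a b) \<and> snd (line a b) \<bullet> (c' - c) > 0 \<and>
      has_momentum E c (line a b) a \<and> has_momentum E c' (line a b) b" by blast
next
  fix l assume l: "is_dline l \<and> snd l \<bullet> (c' - c) > 0 \<and> has_momentum E c l a \<and> has_momentum E c' l b"
  obtain L e where le: "l = (L, e)" by fastforce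
  have "norm e = 1" using l le by (simp add: is_dline_def)
  then obtain \<omega> where \<omega>: "e = dir \<omega>" using unit_vector_dir by blast
  obtain x where L: "L = range (\<lambda>t. x + t *\<^sub>R e)"
    using l le by (auto simp: is_dline_def)
  then have "x \<in> L" by (metis add.right_neutral rangeI scaleR_zero_left)
  then have m: "s * ((x - c) \<bullet> J e) = a" "s * ((x - c') \<bullet> J e) = b"
    using l le by (auto simp: has_momentum_def s)
  have "s * ((c' - c) \<bullet> J e) = a - b"
    using m by (simp add: inner_diff_left algebra_simps)
  then have "sin (\<omega> - \<alpha>) * (s * d) = a - b"
    by (simp add: axis \<omega> dir_inner_J_dir mult_ac)
  then have sn: "sin (\<omega> - \<alpha>) = sin (tilt a b)"
    unfolding tilt_bounds(3)[OF a b] using s_pos d_pos by (simp add: nonzero_eq_divide_eq)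
  have cp: "0 < cos (\<omega> - \<alpha>)"
    using l le \<omega> d_pos by (simp add: axis dir_inner_dir zero_less_mult_iff)
  have "(cos (\<omega> - \<alpha>))\<^sup>2 = (cos (tilt a b))\<^sup>2"
    by (simp add: cos_squared_eq sn)
  then have cs: "cos (\<omega> - \<alpha>) = cos (tilt a b)"
    using cp tilt_bounds(4)[OF a b] by (simp add: power2_eq_iff_nonneg)
  have "dir (\<alpha> + (\<omega> - \<alpha>)) = dir (\<alpha> + tilt a b)"
    unfolding dir_def cos_add sin_add sn cs by simp
  then have e: "e = dir (\<alpha> + tilt a b)"
    by (simp add: \<omega>)
  have "y \<in> L \<longleftrightarrow> (y - c) \<bullet> J e = a / s" for y
  proof
    assume "y \<in> L"
    then have "s * ((y - c) \<bullet> J e) = a"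
      using l le by (auto simp: has_momentum_def s)
    then show "(y - c) \<bullet> J e = a / s"
      using s_pos by (simp add: field_simps)
  next
    assume y: "(y - c) \<bullet> J e = a / s"
    have "(x - c) \<bullet> J e = a / s"
      using m(1) s_pos by (auto simp: field_simps)
    with y have "(y - x) \<bullet> J e = 0"
      by (simp add: inner_diff_left)
    then have "y - x = ((y - x) \<bullet> e) *\<^sub>R e"
      using J_decomposition[of e "y - x"] \<open>norm e = 1\<close> by simp
    then have "y = x + ((y - x) \<bullet> e) *\<^sub>R e"
      by (simp add: algebra_simps)
    then show "y \<in> L"
      unfolding L by (metis rangeI)
  qed
  then have "L = fst (line a b)"
    using mem_line_iff[of _ a b] e by blast
  then show "l = line a b"
    using le e by (simp add: line_def)
qed

lemma exit_point_line:
  assumes c: "center S = c" "radius S = R" and a: "\<bar>a\<bar> \<le> R * s"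
  shows "exit_point S (line a b) = fst (boundary_state 1 c R s a (\<alpha> + tilt a b))" (is "_ = fst (?b)")
  unfolding exit_point_def circle_def c
proof (rule the_equality)
  let ?e = "dir (\<alpha> + tilt a b)"
  show "fst ?b \<in> sphere c R \<inter> fst (line a b) \<and> 0 \<le> (fst ?b - c) \<bullet> snd (line a b)"
    using boundary_state_props[OF s_pos a _ R_pos, of 1 c "\<alpha> + tilt a b"] s_pos moment_square_le[OF a]
    by (auto simp: mem_line_iff dist_norm norm_minus_commute)
  fix x assume x: "x \<in> sphere c R \<inter> fst (line a b) \<and> 0 \<le> (x - c) \<bullet> snd (line a b)"
  have "(x, s *\<^sub>R ?e) = ?b"
    using x s_pos by (intro boundary_state_eqI)
      (auto simp: mem_line_iff J_scale dist_norm norm_minus_commute)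
  then show "x = fst ?b" by (metis fst_conv)
qed

lemma entry_point_line:
  assumes c: "center S' = c'" "radius S' = R'" and a: "\<bar>a\<bar> \<le> R * s" and b: "\<bar>b\<bar> \<le> R' * s"
  shows "entry_point S' (line a b) = fst (boundary_state (- 1) c' R' s b (\<alpha> + tilt a b))" (is "_ = fst (?b)")
  unfolding entry_point_def circle_def c
proof (rule the_equality)
  let ?e = "dir (\<alpha> + tilt a b)"
  note on_line = mem_line_iff[of _ a b, unfolded target_momentum[OF a b]]
  show "fst ?b \<in> sphere c' R' \<inter> fst (line a b) \<and> (fst ?b - c') \<bullet> snd (line a b) \<le> 0"
    using boundary_state_props[OF s_pos b _ R'_pos, of "- 1" c' "\<alpha> + tilt a b"] s_pos moment_square_le[OF b]
    by (auto simp: on_line dist_norm norm_minus_commute)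
  fix x assume x: "x \<in> sphere c' R' \<inter> fst (line a b) \<and> (x - c') \<bullet> snd (line a b) \<le> 0"
  have "(x, s *\<^sub>R ?e) = ?b"
    using x s_pos by (intro boundary_state_eqI)
      (auto simp: on_line J_scale dist_norm norm_minus_commute mult_le_0_iff)
  then show "x = fst ?b" by (metis fst_conv)
qed

text \<open>Polar angles, about the respective centre, of the point where the line leaves the first disc and
  of the point where it enters the second one.\<close>

definition exit_angle :: "real \<Rightarrow> real \<Rightarrow> real" where
  "exit_angle a b = \<alpha> + tilt a b - arcsin (a / (R * s))"

definition entry_angle :: "real \<Rightarrow> real \<Rightarrow> real" where
  "entry_angle a b = \<alpha> + tilt a b + pi + arcsin (b / (R' * s))"

lemma tilt_mono:
  assumes "\<bar>a\<bar> \<le> R * s" "\<bar>b\<bar> \<le> R' * s" "\<bar>a'\<bar> \<le> R * s" "\<bar>b'\<bar> \<le> R' * s" "a \<le> a'" "b' \<le> b"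
  shows "tilt a b \<le> tilt a' b'"
  unfolding tilt_def using tilt_arg[OF assms(1,2)] tilt_arg[OF assms(3,4)] assms(5,6) s_pos d_pos
  by (intro arcsin_le_arcsin) (auto intro!: divide_right_mono)

lemma exit_angle_antimono:
  assumes "\<bar>a\<bar> \<le> R * s" "\<bar>b\<bar> \<le> R' * s" "\<bar>a'\<bar> \<le> R * s" "\<bar>b'\<bar> \<le> R' * s" "a \<le> a'" "b \<le> b'"
  shows "exit_angle a' b' \<le> exit_angle a b"
proof -
  have "arcsin (a / (R * s)) - arcsin ((a - b) / (s * d)) \<le> arcsin (a' / (R * s)) - arcsin ((a' - b) / (s * d))"
    by (rule arcsin_difference_mono[where \<rho>' = "R' * s"])
      (use assms R_pos R'_pos s_pos mult_strict_right_mono[OF disjoint s_pos] in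
        \<open>auto simp: algebra_simps abs_le_iff\<close>)
  then have "exit_angle a' b \<le> exit_angle a b"
    by (simp add: exit_angle_def tilt_def)
  moreover have "exit_angle a' b' \<le> exit_angle a' b"
    using tilt_mono[of a' b' a' b] assms by (simp add: exit_angle_def)
  ultimately show ?thesis by simp
qed

lemma entry_angle_mono:
  assumes "\<bar>a\<bar> \<le> R * s" "\<bar>b\<bar> \<le> R' * s" "\<bar>a'\<bar> \<le> R * s" "\<bar>b'\<bar> \<le> R' * s" "a \<le> a'" "b \<le> b'"
  shows "entry_angle a b \<le> entry_angle a' b'"
proof -
  have "arcsin (b / (R' * s)) - arcsin ((b - a) / (s * d)) \<le> arcsin (b' / (R' * s)) - arcsin ((b' - a) / (s * d))"
    by (rule arcsin_difference_mono[where \<rho>' = "R * s"])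
      (use assms R_pos R'_pos s_pos mult_strict_right_mono[OF disjoint s_pos] in
        \<open>auto simp: algebra_simps abs_le_iff\<close>)
  moreover have "arcsin ((x - a) / (s * d)) = - tilt a x" if "\<bar>x\<bar> \<le> R' * s" for x
    unfolding tilt_def using tilt_arg(3,4)[OF assms(1) that]
    by (subst arcsin_minus[symmetric]) (auto simp: minus_divide_left)
  ultimately have "entry_angle a b \<le> entry_angle a b'"
    using assms by (simp add: entry_angle_def)
  moreover have "entry_angle a b' \<le> entry_angle a' b'"
    using tilt_mono[of a b' a' b'] assms by (simp add: entry_angle_def)
  ultimately show ?thesis by simp
qed

lemma angle_spread:
  assumes "\<bar>a\<bar> \<le> R * s" "\<bar>b\<bar> \<le> R' * s" "\<bar>a'\<bar> \<le> R * s" "\<bar>b'\<bar> \<le> R' * s"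
  shows "exit_angle a b - exit_angle a' b' < 2 * pi" "entry_angle a b - entry_angle a' b' < 2 * pi"
proof -
  have as: "- (pi / 2) \<le> arcsin (x / (r * s)) \<and> arcsin (x / (r * s)) \<le> pi / 2"
    if "\<bar>x\<bar> \<le> r * s" "0 < r" for x r
    using that s_pos by (intro arcsin_bounded) (auto simp: pos_le_divide_eq pos_divide_le_eq abs_le_iff)
  note t = tilt_bounds[OF assms(1,2)] tilt_bounds[OF assms(3,4)]
  show "exit_angle a b - exit_angle a' b' < 2 * pi"
    using t as[OF assms(1) R_pos] as[OF assms(3) R_pos] by (simp add: exit_angle_def)
  show "entry_angle a b - entry_angle a' b' < 2 * pi"
    using t as[OF assms(2) R'_pos] as[OF assms(4) R'_pos] by (simp add: entry_angle_def)
qed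

lemma exit_point_angle:
  assumes "\<bar>a\<bar> \<le> R * s"
  shows "fst (boundary_state 1 c R s a (\<alpha> + tilt a b)) = c + R *\<^sub>R dir (exit_angle a b)"
  using boundary_state_exit_angle(1)[OF s_pos assms R_pos] by (simp add: exit_angle_def)

lemma entry_point_angle:
  assumes "\<bar>b\<bar> \<le> R' * s"
  shows "fst (boundary_state (- 1) c' R' s b (\<alpha> + tilt a b)) = c' + R' *\<^sub>R dir (entry_angle a b)"
  using boundary_state_exit_angle(2)[OF s_pos assms R'_pos] by (simp add: entry_angle_def)

text \<open>Both polar angles are monotone in both momenta. If the momenta lie between the tangent and the
  critical values, the angles therefore lie between their values at the two extreme pairs of momenta,
  and these are the end points of the arcs. Which pairs are extreme depends on whether the two signs
  agree, in the way in which the bounding lines of the arcs were chosen.\<close>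

lemma exit_and_entry_in_arcs:
  assumes s: "s = sqrt (2 * E)" and c: "center S = c" "center S' = c'" and R: "radius S = R" "radius S' = R'"
    and \<epsilon>: "outer_sign E S = \<epsilon>" "outer_sign E S' = \<epsilon>'" "\<epsilon> * \<epsilon> = 1" "\<epsilon>' * \<epsilon>' = 1"
    and I: "critical_momentum E S = I" "critical_momentum E S' = I'" "\<bar>I\<bar> \<le> R * s" "\<bar>I'\<bar> \<le> R' * s"
    and a: "- \<epsilon> * I \<le> - \<epsilon> * a" "- \<epsilon> * a \<le> R * s" and b: "- \<epsilon>' * I' \<le> - \<epsilon>' * b" "- \<epsilon>' * b \<le> R' * s"
  shows "fst (boundary_state 1 c R s a (\<alpha> + tilt a b)) \<in> exit_arc E S S'"
    and "fst (boundary_state (- 1) c' R' s b (\<alpha> + tilt a b)) \<in> entry_arc E S' S"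
proof -
  have \<epsilon>_cases: "\<epsilon> = 1 \<or> \<epsilon> = - 1" "\<epsilon>' = 1 \<or> \<epsilon>' = - 1"
    using \<epsilon> by (simp_all add: square_eq_1_iff)
  define \<tau> \<tau>' where "\<tau> = - \<epsilon> * R * s" and "\<tau>' = - \<epsilon>' * R' * s"
  have t: "tangent_momentum E S = \<tau>" "tangent_momentum E S' = \<tau>'"
    by (simp_all add: tangent_momentum_def \<tau>_def \<tau>'_def \<epsilon> R s)
  have bd: "\<bar>\<tau>\<bar> \<le> R * s" "\<bar>\<tau>'\<bar> \<le> R' * s" "\<bar>a\<bar> \<le> R * s" "\<bar>b\<bar> \<le> R' * s"
    using \<epsilon>_cases R_pos R'_pos s_pos a b I(3,4) by (auto simp: \<tau>_def \<tau>'_def)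
  note ell = ell_eq_line[OF s c]
  have lines: "exit_point S (ell E S S' x y) = c + R *\<^sub>R dir (exit_angle x y)"
    "entry_point S' (ell E S S' x y) = c' + R' *\<^sub>R dir (entry_angle x y)"
    if "\<bar>x\<bar> \<le> R * s" "\<bar>y\<bar> \<le> R' * s" for x y
    using that c R by (simp_all add: ell exit_point_line entry_point_line exit_point_angle entry_point_angle)
  have exit_arc: "exit_arc E S S' = circle_arc (- \<epsilon>) c (c + R *\<^sub>R dir (exit_angle \<tau> (if \<epsilon> = \<epsilon>' then \<tau>' else I')))
      (c + R *\<^sub>R dir (exit_angle I (if \<epsilon> = \<epsilon>' then I' else \<tau>')))"
    using bd I by (simp add: exit_arc_def source_tangent_def source_critical_def \<epsilon> t c lines)
  have entry_arc: "entry_arc E S' S = circle_arc \<epsilon>' c' (c' + R' *\<^sub>R dir (entry_angle (if \<epsilon> = \<epsilon>' then \<tau> else I) \<tau>'))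
      (c' + R' *\<^sub>R dir (entry_angle (if \<epsilon> = \<epsilon>' then I else \<tau>) I'))"
    using bd I by (simp add: entry_arc_def target_tangent_def target_critical_def \<epsilon> t c lines)
  have oa: "\<epsilon> = 1 \<longrightarrow> \<tau> \<le> a \<and> a \<le> I" "\<epsilon> = - 1 \<longrightarrow> I \<le> a \<and> a \<le> \<tau>"
    using a by (auto simp: \<tau>_def)
  have ob: "\<epsilon>' = 1 \<longrightarrow> \<tau>' \<le> b \<and> b \<le> I'" "\<epsilon>' = - 1 \<longrightarrow> I' \<le> b \<and> b \<le> \<tau>'"
    using b by (auto simp: \<tau>'_def)
  have exit_between: "0 \<le> - \<epsilon> * (exit_angle x' y' - exit_angle x y)"
    if "\<epsilon> = 1 \<longrightarrow> x \<le> x' \<and> y \<le> y'" "\<epsilon> = - 1 \<longrightarrow> x' \<le> x \<and> y' \<le> y"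
      "\<bar>x\<bar> \<le> R * s" "\<bar>y\<bar> \<le> R' * s" "\<bar>x'\<bar> \<le> R * s" "\<bar>y'\<bar> \<le> R' * s" for x y x' y'
  proof (cases "\<epsilon> = 1")
    case True
    then show ?thesis
      using exit_angle_antimono[of x y x' y'] that by simp
  next
    case False
    then have "\<epsilon> = - 1" using \<epsilon>_cases by blast
    then show ?thesis
      using exit_angle_antimono[of x' y' x y] that by simp
  qed
  have entry_between: "0 \<le> \<epsilon>' * (entry_angle x' y' - entry_angle x y)"
    if "\<epsilon>' = 1 \<longrightarrow> x \<le> x' \<and> y \<le> y'" "\<epsilon>' = - 1 \<longrightarrow> x' \<le> x \<and> y' \<le> y"
      "\<bar>x\<bar> \<le> R * s" "\<bar>y\<bar> \<le> R' * s" "\<bar>x'\<bar> \<le> R * s" "\<bar>y'\<bar> \<le> R' * s" for x y x' y'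
  proof (cases "\<epsilon>' = 1")
    case True
    then show ?thesis
      using entry_angle_mono[of x y x' y'] that by simp
  next
    case False
    then have "\<epsilon>' = - 1" using \<epsilon>_cases by blast
    then show ?thesis
      using entry_angle_mono[of x' y' x y] that by simp
  qed
  have spread: "\<sigma> * (exit_angle x' y' - exit_angle x y) < 2 * pi \<and> \<sigma> * (entry_angle x' y' - entry_angle x y) < 2 * pi"
    if "\<sigma> = 1 \<or> \<sigma> = - 1" "\<bar>x\<bar> \<le> R * s" "\<bar>y\<bar> \<le> R' * s" "\<bar>x'\<bar> \<le> R * s" "\<bar>y'\<bar> \<le> R' * s" for \<sigma> x y x' y'
    using that(1) angle_spread[OF that(2,3,4,5)] angle_spread[OF that(4,5,2,3)] by (elim disjE) simp_all
  show "fst (boundary_state 1 c R s a (\<alpha> + tilt a b)) \<in> exit_arc E S S'"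
    unfolding exit_point_angle[OF bd(3)] exit_arc
  proof (rule mem_circle_arcI[OF R_pos])
    show "0 \<le> - \<epsilon> * (exit_angle a b - exit_angle \<tau> (if \<epsilon> = \<epsilon>' then \<tau>' else I'))"
      by (rule exit_between) (use oa ob bd I(3,4) \<epsilon>_cases(2) in \<open>auto split: if_splits\<close>)
    show "0 \<le> - \<epsilon> * (exit_angle I (if \<epsilon> = \<epsilon>' then I' else \<tau>') - exit_angle a b)"
      by (rule exit_between) (use oa ob bd I(3,4) \<epsilon>_cases(2) in \<open>auto split: if_splits\<close>)
    show "- \<epsilon> * (exit_angle I (if \<epsilon> = \<epsilon>' then I' else \<tau>') - exit_angle \<tau> (if \<epsilon> = \<epsilon>' then \<tau>' else I')) < 2 * pi"
      by (rule spread[THEN conjunct1]) (use bd I(3,4) \<epsilon>_cases in \<open>auto split: if_splits\<close>)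
  qed (use \<epsilon> in simp)
  show "fst (boundary_state (- 1) c' R' s b (\<alpha> + tilt a b)) \<in> entry_arc E S' S"
    unfolding entry_point_angle[OF bd(4)] entry_arc
  proof (rule mem_circle_arcI[OF R'_pos])
    show "0 \<le> \<epsilon>' * (entry_angle a b - entry_angle (if \<epsilon> = \<epsilon>' then \<tau> else I) \<tau>')"
      by (rule entry_between) (use oa ob bd I(3,4) \<epsilon>_cases(1) in \<open>auto split: if_splits\<close>)
    show "0 \<le> \<epsilon>' * (entry_angle (if \<epsilon> = \<epsilon>' then I else \<tau>) I' - entry_angle a b)"
      by (rule entry_between) (use oa ob bd I(3,4) \<epsilon>_cases(1) in \<open>auto split: if_splits\<close>)
    show "\<epsilon>' * (entry_angle (if \<epsilon> = \<epsilon>' then I else \<tau>) I' - entry_angle (if \<epsilon> = \<epsilon>' then \<tau> else I) \<tau>') < 2 * pi"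
      by (rule spread[THEN conjunct2]) (use bd I(3,4) \<epsilon>_cases in \<open>auto split: if_splits\<close>)
  qed (use \<epsilon> in simp)
qed

text \<open>The exit and the entry point have the same offset from the direction of the line. The entry point
  lies ahead because \<open>w\<close>, which has length at most \<open>R + R'\<close> and the same offset as the vector
  between the centres, is shorter than that vector.\<close>

lemma flight_vector:
  assumes a: "\<bar>a\<bar> \<le> R * s" and b: "\<bar>b\<bar> \<le> R' * s"
  defines "x \<equiv> fst (boundary_state 1 c R s a (\<alpha> + tilt a b))"
    and "y \<equiv> fst (boundary_state (- 1) c' R' s b (\<alpha> + tilt a b))"
  obtains T where "y = x + (T * s) *\<^sub>R dir (\<alpha> + tilt a b)" "d - R - R' \<le> T * s" "T * s \<le> d + R + R'"
proof -
  let ?e = "dir (\<alpha> + tilt a b)"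
  note px = boundary_state_props[OF s_pos a _ R_pos, of 1 c "\<alpha> + tilt a b", folded x_def, simplified]
  note py = boundary_state_props[OF s_pos b _ R'_pos, of "- 1" c' "\<alpha> + tilt a b", folded y_def, simplified]
  define w where "w = (x - c) - (y - c')"
  have yx: "y - x = (c' - c) - w"
    by (simp add: w_def)
  have w_norm: "norm w \<le> R + R'"
    unfolding w_def using norm_triangle_ineq4[of "x - c" "y - c'"] px(1) py(1) by simp
  have wJ: "w \<bullet> J ?e = (a - b) / s"
    using px(2) py(2) by (simp add: w_def inner_diff_left diff_divide_distrib)
  have cJ: "(c' - c) \<bullet> J ?e = (a - b) / s"
    using tilt_bounds(3)[OF a b] s_pos d_pos by (simp add: axis dir_inner_J_dir)
  have ce: "(c' - c) \<bullet> ?e = d * cos (tilt a b)"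
    by (simp add: axis dir_inner_dir)
  have "(w \<bullet> ?e)\<^sup>2 + (w \<bullet> J ?e)\<^sup>2 \<le> (R + R')\<^sup>2"
    using inner_J_pythagoras[of w ?e] w_norm R_pos R'_pos by (simp add: power_mono)
  also have "(R + R')\<^sup>2 < d\<^sup>2"
    using disjoint R_pos R'_pos by (intro power_strict_mono) auto
  also have "d\<^sup>2 = ((c' - c) \<bullet> ?e)\<^sup>2 + ((c' - c) \<bullet> J ?e)\<^sup>2"
    using inner_J_pythagoras[of "c' - c" ?e] d_pos by (simp add: axis)
  finally have "(w \<bullet> ?e)\<^sup>2 < ((c' - c) \<bullet> ?e)\<^sup>2"
    by (simp add: wJ cJ)
  then have "w \<bullet> ?e < (c' - c) \<bullet> ?e"
    using tilt_bounds(4)[OF a b] d_pos ce by (auto intro: power2_less_imp_less)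
  then have pos: "0 < (y - x) \<bullet> ?e"
    unfolding yx by (simp add: inner_diff_left)
  have "(y - x) \<bullet> J ?e = 0"
    using wJ cJ by (simp add: yx inner_diff_left)
  then have along: "y - x = ((y - x) \<bullet> ?e) *\<^sub>R ?e"
    using J_decomposition[of ?e "y - x"] by simp
  then have len: "norm (y - x) = (y - x) \<bullet> ?e"
    using pos by (metis abs_of_pos mult.right_neutral norm_dir norm_scaleR)
  have nc: "norm (c' - c) = d"
    using d_pos by (simp add: axis)
  have "d - (R + R') \<le> norm (y - x)"
    unfolding yx using norm_triangle_ineq2[of "c' - c" w] nc w_norm by linarith
  moreover have "norm (y - x) \<le> d + (R + R')"
    unfolding yx using norm_triangle_ineq4[of "c' - c" w] nc w_norm by linarith
  moreover have Ts: "((y - x) \<bullet> ?e) / s * s = (y - x) \<bullet> ?e"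
    using s_pos by simp
  moreover have "y = x + ((y - x) \<bullet> ?e) *\<^sub>R ?e"
    using along by (metis add_diff_cancel_left' diff_add_cancel add.commute)
  ultimately show thesis
    by (intro that[of "((y - x) \<bullet> ?e) / s"]; simp only: Ts len)
qed

text \<open>Behind the exit point the distance from the first centre grows, and before the entry point the
  distance from the second centre decreases.\<close>

lemma flight_outside:
  assumes a: "\<bar>a\<bar> \<le> R * s" and b: "\<bar>b\<bar> \<le> R' * s"
  defines "x \<equiv> fst (boundary_state 1 c R s a (\<alpha> + tilt a b))"
    and "y \<equiv> fst (boundary_state (- 1) c' R' s b (\<alpha> + tilt a b))"
  assumes z: "z \<in> closed_segment x y"
  shows "R \<le> norm (z - c)" "R' \<le> norm (z - c')"
proof -
  let ?e = "dir (\<alpha> + tilt a b)"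
  note px = boundary_state_props[OF s_pos a _ R_pos, of 1 c "\<alpha> + tilt a b", folded x_def, simplified]
  note py = boundary_state_props[OF s_pos b _ R'_pos, of "- 1" c' "\<alpha> + tilt a b", folded y_def, simplified]
  obtain T where T: "y = x + (T * s) *\<^sub>R ?e" "d - R - R' \<le> T * s"
    using flight_vector[OF a b] unfolding x_def y_def by metis
  obtain u where u: "0 \<le> u" "u \<le> 1" "z = (1 - u) *\<^sub>R x + u *\<^sub>R y"
    using z by (auto simp: in_segment)
  have zx: "z = x + (u * (T * s)) *\<^sub>R ?e" and zy: "z = y + (- ((1 - u) * (T * s))) *\<^sub>R ?e"
    unfolding u(3) T(1) by (simp_all add: algebra_simps)
  have zc: "z - c = (x - c) + (u * (T * s)) *\<^sub>R ?e"
    by (simp add: zx)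
  have zc': "z - c' = (y - c') + (- ((1 - u) * (T * s))) *\<^sub>R ?e"
    by (simp only: zy diff_add_eq)
  have Ts: "0 \<le> T * s" using T(2) disjoint by simp
  have out: "(norm v)\<^sup>2 \<le> (norm (v + t *\<^sub>R ?e))\<^sup>2" if "0 \<le> t * (v \<bullet> ?e)" for v t
    using that by (simp add: power2_norm_eq_inner inner_add_left inner_add_right inner_commute)
  have "0 \<le> (x - c) \<bullet> ?e" "(y - c') \<bullet> ?e \<le> 0"
    using px(3) py(3) s_pos moment_square_le[OF a] moment_square_le[OF b] by simp_all
  then have "0 \<le> (u * (T * s)) * ((x - c) \<bullet> ?e)" "0 \<le> (- ((1 - u) * (T * s))) * ((y - c') \<bullet> ?e)"
    using u Ts by (simp_all add: mult_nonneg_nonpos)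
  from out[OF this(1)] out[OF this(2)]
  have "(norm (x - c))\<^sup>2 \<le> (norm (z - c))\<^sup>2" "(norm (y - c'))\<^sup>2 \<le> (norm (z - c'))\<^sup>2"
    unfolding zc zc' by simp_all
  then have "R\<^sup>2 \<le> (norm (z - c))\<^sup>2" "R'\<^sup>2 \<le> (norm (z - c'))\<^sup>2"
    by (simp_all only: px(1) py(1))
  then show "R \<le> norm (z - c)" "R' \<le> norm (z - c')"
    by (auto intro: power2_le_imp_le)
qed

end

context magnetic_flow
begin

lemma free_flight:
  assumes "x = (q, s *\<^sub>R dir \<theta>)" and free: "\<And>z. z \<in> closed_segment q (q + (T * s) *\<^sub>R dir \<theta>) \<Longrightarrow> B z = 0"
    and t: "0 \<le> t" "t \<le> T"
  shows "\<Phi> t x = (q + (t * s) *\<^sub>R dir \<theta>, s *\<^sub>R dir \<theta>)" "turn x t = 0"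
proof -
  have on_seg: "q + (v * s) *\<^sub>R dir \<theta> \<in> closed_segment q (q + (T * s) *\<^sub>R dir \<theta>)" if "0 \<le> v" "v \<le> T" for v
  proof (cases "T = 0")
    case False
    then show ?thesis
      unfolding in_segment using that by (intro exI[of _ "v / T"]) (auto simp: algebra_simps)
  qed (use that in auto)
  have *: "\<Phi> v x = (q + (v * s) *\<^sub>R dir \<theta>, s *\<^sub>R dir \<theta>)" if v: "0 \<le> v" "v \<le> T" for v
  proof (rule flow_unique[where q = "\<lambda>v. q + (v * s) *\<^sub>R dir \<theta>" and p = "\<lambda>_. s *\<^sub>R dir \<theta>"])
    fix u assume u: "0 \<le> u" "u \<le> v"
    show "((\<lambda>v. q + (v * s) *\<^sub>R dir \<theta>) has_vector_derivative s *\<^sub>R dir \<theta>) (at u)"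
      by (auto intro!: derivative_eq_intros)
    show "((\<lambda>_. s *\<^sub>R dir \<theta>) has_vector_derivative
        B (q + (u * s) *\<^sub>R dir \<theta>) *\<^sub>R J (s *\<^sub>R dir \<theta>)) (at u)"
      using free[OF on_seg[of u]] u v by (auto intro!: derivative_eq_intros)
  qed (use assms v in auto)
  then show "\<Phi> t x = (q + (t * s) *\<^sub>R dir \<theta>, s *\<^sub>R dir \<theta>)"
    using t by blast
  have "(turn x has_real_derivative 0) (at v within {0..t})" if "v \<in> {0..t}" for v
    using turn_deriv[of x v] *[of v] free[OF on_seg[of v]] that t
    by (auto intro: has_field_derivative_at_within)
  then have "\<exists>c. \<forall>v\<in>{0..t}. turn x v = c"
    by (intro has_field_derivative_zero_constant) auto
  then have "turn x t = turn x 0"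
    using t by (metis atLeastAtMost_iff order_refl)
  then show "turn x t = 0" by simp
qed

end

section \<open>A bump at fixed energy\<close>

lemma disjoint_cballs_imp_less_dist:
  fixes c c' :: "'a::real_normed_vector"
  assumes "cball c R \<inter> cball c' R' = {}" "0 \<le> R" "0 \<le> R'"
  shows "R + R' < dist c c'"
proof (rule ccontr)
  assume *: "\<not> R + R' < dist c c'"
  show False
  proof (cases "dist c c' \<le> R")
    case True
    then have "c' \<in> cball c R \<inter> cball c' R'" using assms(2,3) by simp
    then show False using assms by blast
  next
    case False
    let ?d = "dist c c'"
    have d: "0 < ?d" "R < ?d" using False assms by auto
    define p where "p = c + (R / ?d) *\<^sub>R (c' - c)"
    have "dist c p = R"
      using d assms by (simp add: p_def dist_norm norm_minus_commute)
    moreover have "c' - p = (1 - R / ?d) *\<^sub>R (c' - c)"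
      by (simp add: p_def algebra_simps)
    then have "dist c' p = \<bar>1 - R / ?d\<bar> * ?d"
      by (simp add: dist_norm norm_minus_commute)
    then have "dist c' p = ?d - R"
      using d by (simp add: abs_of_nonneg left_diff_distrib)
    ultimately have "p \<in> cball c R \<inter> cball c' R'"
      using * by simp
    then show False using assms(1) by blast
  qed
qed

text \<open>Radial symmetry and compact support turn the local Lipschitz condition in the plane into a global
  one for the profile. The profile vanishes on the boundary circle too, by continuity.\<close>

lemma bump_profile:
  assumes ll: "local_lipschitz (UNIV :: real set) UNIV (\<lambda>_. bump_field S)"
    and ne: "\<exists>x. bump_field S x \<noteq> 0" and sp: "supp (bump_field S) \<subseteq> disc S"
  obtains L where "L-lipschitz_on {0..} (profile S)" "\<And>r. radius S \<le> r \<Longrightarrow> profile S r = 0" "0 < radius S"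
proof -
  let ?c = "center S" and ?f = "profile S" and ?R = "radius S"
  have out: "bump_field S x = 0" if "?R < norm (x - ?c)" for x
  proof (rule ccontr)
    assume "bump_field S x \<noteq> 0"
    then have "x \<in> supp (bump_field S)"
      unfolding supp_def using closure_subset by fastforce
    then show False
      using sp that by (auto simp: disc_def dist_norm norm_minus_commute)
  qed
  have radial: "?f r = bump_field S (?c + r *\<^sub>R dir 0)" if "0 \<le> r" for r
    using that by (simp add: bump_field_def)
  have out_f: "?f r = 0" if "?R < r" "0 \<le> r" for r
    using out[of "?c + r *\<^sub>R dir 0"] that by (simp add: radial)
  obtain x where x: "bump_field S x \<noteq> 0" using ne by blast
  then have R0: "0 \<le> ?R" using out[of x] by (meson norm_ge_zero not_le order_trans)
  obtain L where L: "L-lipschitz_on (cball ?c (?R + 1)) (bump_field S)"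
  proof (rule local_lipschitz_compact_implies_lipschitz[OF local_lipschitz_subset[OF ll], of "{0}" "cball ?c (?R + 1)"])
    show "continuous_on {0::real} (\<lambda>t. bump_field S x)" for x by simp
  qed (use that in auto)
  have lip1: "\<bar>?f r - ?f r'\<bar> \<le> L * \<bar>r - r'\<bar>" if "0 \<le> r" "r \<le> ?R + 1" "0 \<le> r'" "r' \<le> ?R + 1" for r r'
  proof -
    have "dist (bump_field S (?c + r *\<^sub>R dir 0)) (bump_field S (?c + r' *\<^sub>R dir 0))
        \<le> L * dist (?c + r *\<^sub>R dir 0) (?c + r' *\<^sub>R dir 0)"
      using that by (intro lipschitz_onD[OF L]) (auto simp: dist_norm)
    moreover have "dist (?c + r *\<^sub>R dir 0) (?c + r' *\<^sub>R dir 0) = \<bar>r - r'\<bar>"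
    proof -
      have "(?c + r *\<^sub>R dir 0) - (?c + r' *\<^sub>R dir 0) = (r - r') *\<^sub>R dir 0"
        by (simp add: algebra_simps)
      then show ?thesis by (simp add: dist_norm)
    qed
    ultimately show ?thesis
      using that by (simp add: radial dist_real_def)
  qed
  have L0: "0 \<le> L" using L by (rule lipschitz_on_nonneg)
  have "?f ?R = 0"
  proof (rule ccontr)
    assume nz: "?f ?R \<noteq> 0"
    define \<delta> where "\<delta> = min 1 (\<bar>?f ?R\<bar> / (2 * (L + 1)))"
    have \<delta>: "0 < \<delta>" "\<delta> \<le> 1" "\<delta> \<le> \<bar>?f ?R\<bar> / (2 * (L + 1))"
      using nz L0 by (auto simp: \<delta>_def)
    have "\<bar>?f ?R\<bar> \<le> L * \<delta>"
      using lip1[of ?R "?R + \<delta>"] out_f[of "?R + \<delta>"] \<delta> R0 by simp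
    also have "\<dots> \<le> (L + 1) * \<delta>"
      using \<delta> by (intro mult_right_mono) auto
    also have "\<dots> \<le> \<bar>?f ?R\<bar> / 2"
      using \<delta>(3) L0 by (simp add: field_simps)
    finally show False using nz by simp
  qed
  then have off: "?f r = 0" if "?R \<le> r" for r
    using out_f[of r] that R0 by (cases "r = ?R") auto
  have "?f (norm (x - ?c)) \<noteq> 0"
    using x by (simp add: bump_field_def)
  then have Rpos: "0 < ?R"
    using off by (meson norm_ge_zero not_le order_trans)
  have half: "\<bar>?f r - ?f r'\<bar> \<le> L * (r' - r)" if "0 \<le> r" "r \<le> r'" for r r'
  proof (cases "r' \<le> ?R")
    case True
    then show ?thesis using lip1[of r r'] that by simp
  next
    case False
    show ?thesis
    proof (cases "r \<le> ?R")
      case True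
      have "\<bar>?f r - ?f r'\<bar> = \<bar>?f r - ?f ?R\<bar>"
        using off False by simp
      also have "\<dots> \<le> L * (?R - r)"
        using lip1[of r ?R] that True R0 by simp
      also have "\<dots> \<le> L * (r' - r)"
        using False L0 by (intro mult_left_mono) auto
      finally show ?thesis .
    next
      case False
      then show ?thesis using off that L0 by simp
    qed
  qed
  have "L-lipschitz_on {0..} ?f"
  proof (rule lipschitz_onI[OF _ L0])
    fix r r' :: real assume "r \<in> {0..}" "r' \<in> {0..}"
    then show "dist (?f r) (?f r') \<le> L * dist r r'"
      using half[of r r'] half[of r' r] by (cases "r \<le> r'") (auto simp: dist_real_def abs_minus_commute)
  qed
  then show thesis
    using that off Rpos by blast
qed

locale energetic_bump =
  fixes S :: bump and L E :: real
  assumes profile_lip: "L-lipschitz_on {0..} (profile S)"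
    and profile_off: "\<And>r. radius S \<le> r \<Longrightarrow> profile S r = 0"
    and radius_pos: "0 < radius S" and E_pos: "0 < E" and E_le: "E \<le> bump_critical_energy S"
begin

definition s :: real where "s = sqrt (2 * E)"

definition a :: real where "a = outer_radius E S"

definition \<epsilon> :: real where "\<epsilon> = outer_sign E S"

definition \<beta> :: "real \<Rightarrow> real" where "\<beta> r = \<epsilon> * profile S r"

lemma s_pos: "0 < s"
  using E_pos by (simp add: s_def)

lemma continuous_on_profile: "X \<subseteq> {0..} \<Longrightarrow> continuous_on X (profile S)"
  using lipschitz_on_continuous_on[OF profile_lip] continuous_on_subset by blast

lemma continuous_on_strength: "X \<subseteq> {0..} \<Longrightarrow> continuous_on X (\<lambda>r. \<bar>profile S r\<bar> * r)"
  by (intro continuous_intros continuous_on_profile)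

text \<open>The supremum in the definition of the critical energy is attained, since the profile has compact
  support.\<close>

lemma strong_radius: obtains r0 where "0 \<le> r0" "r0 \<le> radius S" "s \<le> \<bar>profile S r0\<bar> * r0"
proof -
  have "continuous_on {0..radius S} (\<lambda>r. (profile S r * r)\<^sup>2 / 2)"
    by (intro continuous_intros continuous_on_profile) auto
  moreover have "{0..radius S} \<noteq> {}" using radius_pos by simp
  ultimately obtain r0 where r0: "r0 \<in> {0..radius S}"
      "\<And>r. r \<in> {0..radius S} \<Longrightarrow> (profile S r * r)\<^sup>2 / 2 \<le> (profile S r0 * r0)\<^sup>2 / 2"
    using continuous_attains_sup[OF compact_Icc] by blast
  have "bump_critical_energy S \<le> (profile S r0 * r0)\<^sup>2 / 2"
    unfolding bump_critical_energy_def
  proof (rule cSUP_least)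
    fix r :: real assume "r \<in> {0..}"
    then show "(profile S r * r)\<^sup>2 / 2 \<le> (profile S r0 * r0)\<^sup>2 / 2"
      using r0(2)[of r] profile_off[of r] by (cases "r \<le> radius S") auto
  qed simp
  then have "2 * E \<le> (profile S r0 * r0)\<^sup>2"
    using E_le by simp
  then have "s \<le> sqrt ((profile S r0 * r0)\<^sup>2)"
    unfolding s_def by (rule real_sqrt_le_mono)
  then have "s \<le> \<bar>profile S r0\<bar> * r0"
    using r0(1) by (simp add: abs_mult)
  then show thesis
    using that r0 by auto
qed

lemma outer_radius_greatest:
  shows "0 < a" "\<bar>profile S a\<bar> * a = s" "\<And>r. 0 < r \<Longrightarrow> \<bar>profile S r\<bar> * r = s \<Longrightarrow> r \<le> a"
proof -
  let ?Z = "{0..radius S} \<inter> (\<lambda>r. \<bar>profile S r\<bar> * r) -` {s}"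
  have "closed ?Z"
    by (intro continuous_closed_preimage continuous_on_strength) auto
  then have "compact ?Z"
    using compact_Int_closed[OF compact_Icc[of 0 "radius S"], of ?Z] by (simp add: Int_assoc[symmetric])
  moreover have "?Z \<noteq> {}"
  proof -
    obtain r0 where r0: "0 \<le> r0" "r0 \<le> radius S" "s \<le> \<bar>profile S r0\<bar> * r0"
      using strong_radius .
    have "\<exists>x\<ge>r0. x \<le> radius S \<and> \<bar>profile S x\<bar> * x = s"
      by (rule IVT2') (use r0 s_pos profile_off[of "radius S"] continuous_on_strength[of "{r0..radius S}"] in auto)
    then obtain x where "r0 \<le> x" "x \<le> radius S" "\<bar>profile S x\<bar> * x = s" by blast
    then have "x \<in> ?Z" using r0(1) by simp
    then show ?thesis by blast
  qed
  ultimately obtain z where z: "z \<in> ?Z" "\<And>r. r \<in> ?Z \<Longrightarrow> r \<le> z"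
    using compact_attains_sup[of ?Z] by blast
  have max: "r \<le> z" if "0 < r" "\<bar>profile S r\<bar> * r = s" for r
  proof -
    have "r \<le> radius S"
      using that profile_off[of r] s_pos by (force simp: not_le[symmetric])
    then show ?thesis using z(2) that by auto
  qed
  have "0 < z" using z(1) s_pos by (cases "z = 0") auto
  then have "a = z"
    unfolding a_def outer_radius_def using z(1) max
    by (intro Greatest_equality) (auto simp: s_def)
  then show "0 < a" "\<bar>profile S a\<bar> * a = s" "\<And>r. 0 < r \<Longrightarrow> \<bar>profile S r\<bar> * r = s \<Longrightarrow> r \<le> a"
    using z(1) max \<open>0 < z\<close> by auto
qed

lemma a_less: "a < radius S"
  using outer_radius_greatest(2) s_pos profile_off[of a] by (cases "radius S \<le> a") auto

text \<open>Otherwise the intermediate value theorem would give a larger circular orbit.\<close>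

lemma weak_outside: "a < r \<Longrightarrow> \<bar>profile S r\<bar> * r < s"
proof (rule ccontr)
  assume r: "a < r" and n: "\<not> \<bar>profile S r\<bar> * r < s"
  have "r < radius S"
    using n s_pos profile_off[of r] by (cases "radius S \<le> r") auto
  then have "\<exists>x\<ge>r. x \<le> radius S \<and> \<bar>profile S x\<bar> * x = s"
    using n s_pos r outer_radius_greatest(1) profile_off[of "radius S"] continuous_on_strength[of "{r..radius S}"]
    by (intro IVT2') auto
  then obtain x where "r \<le> x" "\<bar>profile S x\<bar> * x = s" by blast
  then show False
    using outer_radius_greatest(1) outer_radius_greatest(3)[of x] r by simp
qed

lemma \<epsilon>_sq: "\<epsilon> * \<epsilon> = 1" and \<epsilon>_profile: "\<epsilon> * profile S a = \<bar>profile S a\<bar>"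
proof -
  have nz: "profile S a \<noteq> 0" using outer_radius_greatest(2) s_pos by auto
  have e: "\<epsilon> = sgn (profile S a)" by (simp add: \<epsilon>_def a_def outer_sign_def)
  show "\<epsilon> * \<epsilon> = 1" unfolding e using nz by (auto simp: sgn_if)
  show "\<epsilon> * profile S a = \<bar>profile S a\<bar>" unfolding e by (simp add: sgn_if)
qed

lemma abs_\<beta>: "\<bar>\<beta> r\<bar> = \<bar>profile S r\<bar>" and profile_eq: "profile S r = \<epsilon> * \<beta> r"
proof -
  have "\<epsilon> = 1 \<or> \<epsilon> = - 1" using \<epsilon>_sq by (simp add: square_eq_1_iff)
  then show "\<bar>\<beta> r\<bar> = \<bar>profile S r\<bar>" "profile S r = \<epsilon> * \<beta> r"
    by (auto simp: \<beta>_def)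
qed

lemma whirl: "radius S < R' \<Longrightarrow> whirl \<beta> a (radius S) R' s L"
proof
  show "L-lipschitz_on {a..R'} \<beta>"
  proof (rule lipschitz_onI)
    fix r r' assume "r \<in> {a..R'}" "r' \<in> {a..R'}"
    then have "dist (profile S r) (profile S r') \<le> L * dist r r'"
      using outer_radius_greatest(1) by (intro lipschitz_onD[OF profile_lip]) auto
    moreover have "\<bar>\<epsilon>\<bar> = 1" using \<epsilon>_sq by (auto simp: square_eq_1_iff)
    then have "dist (\<beta> r) (\<beta> r') = dist (profile S r) (profile S r')"
      by (simp add: \<beta>_def dist_real_def right_diff_distrib[symmetric] abs_mult)
    ultimately show "dist (\<beta> r) (\<beta> r') \<le> L * dist r r'" by simp
  qed (rule lipschitz_on_nonneg[OF profile_lip])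
  show "\<beta> a * a = s"
    using outer_radius_greatest(2) by (simp add: \<beta>_def \<epsilon>_profile)
qed (use outer_radius_greatest(1) a_less s_pos weak_outside profile_off in \<open>auto simp: abs_\<beta>, simp add: \<beta>_def\<close>)

lemma critical_momentum_eq:
  assumes "radius S < R'"
  shows "critical_momentum E S = - \<epsilon> * whirl.exit_moment \<beta> (radius S) s a"
proof -
  have "integral {a..radius S} (\<lambda>r. profile S r * r) = \<epsilon> * integral {a..radius S} (\<lambda>r. \<beta> r * r)"
    by (simp add: profile_eq mult.assoc)
  moreover have "critical_momentum E S = - \<epsilon> * a * s - integral {a..radius S} (\<lambda>r. profile S r * r)"
    by (simp only: critical_momentum_def \<epsilon>_def a_def s_def)
  ultimately show ?thesis
    unfolding whirl.exit_moment_def[OF whirl[OF assms]] by (simp add: algebra_simps)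
qed

end

text \<open>Circular orbits of lower energy lie further out. Hence the outer radius at the largest admissible
  energy is a lower bound for all energies.\<close>

lemma outer_radius_antimono:
  assumes "energetic_bump S L E" "energetic_bump S L E'" "E \<le> E'"
  shows "outer_radius E' S \<le> outer_radius E S"
proof (rule ccontr)
  interpret e: energetic_bump S L E by (rule assms)
  interpret e': energetic_bump S L E' by (rule assms)
  assume "\<not> ?thesis"
  then have "e.a < e'.a"
    by (simp add: e.a_def e'.a_def)
  then have "e'.s < e.s"
    using e.weak_outside[of e'.a] e'.outer_radius_greatest(2) by simp
  then show False
    using assms(3) by (simp add: e.s_def e'.s_def)
qed

lemma bump_field_lipschitz:
  assumes "L-lipschitz_on {0..} (profile S)"
  shows "L-lipschitz_on UNIV (bump_field S)"
proof (rule lipschitz_onI)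
  fix x y :: "real ^ 2"
  have "dist (bump_field S x) (bump_field S y) \<le> L * dist (norm (x - center S)) (norm (y - center S))"
    unfolding bump_field_def by (intro lipschitz_onD[OF assms]) auto
  also have "\<dots> \<le> L * dist x y"
    using lipschitz_on_nonneg[OF assms] norm_triangle_ineq3[of "x - center S" "y - center S"]
    by (intro mult_left_mono) (auto simp: dist_real_def dist_norm)
  finally show "dist (bump_field S x) (bump_field S y) \<le> L * dist x y" .
qed (rule lipschitz_on_nonneg[OF assms])

lemma bump_field_bounded:
  assumes "L-lipschitz_on {0..} (profile S)" "\<And>r. radius S \<le> r \<Longrightarrow> profile S r = 0" "0 < radius S"
  shows "\<bar>bump_field S x\<bar> \<le> L * radius S"
proof (cases "radius S \<le> norm (x - center S)")
  case False
  have "dist (profile S (norm (x - center S))) (profile S (radius S)) \<le> L * dist (norm (x - center S)) (radius S)"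
    using assms(3) by (intro lipschitz_onD[OF assms(1)]) auto
  also have "\<dots> \<le> L * radius S"
    using False lipschitz_on_nonneg[OF assms(1)] by (intro mult_left_mono) (auto simp: dist_real_def)
  finally show ?thesis
    using assms(2)[of "radius S"] by (simp add: bump_field_def dist_real_def)
qed (use assms lipschitz_on_nonneg[OF assms(1)] in \<open>auto simp: bump_field_def\<close>)

section \<open>Orbits with prescribed revolution numbers\<close>

lemma boundary_state_2pi: "boundary_state \<sigma> c R s b (\<theta> + 2 * pi * of_int k) = boundary_state \<sigma> c R s b \<theta>"
  by (simp add: boundary_state_def dir_add_2pi_int)

text \<open>Two strictly increasing integer sequences are determined by their sets of values.\<close>

lemma strict_mono_mutual_range:
  fixes f g :: "nat \<Rightarrow> int"
  assumes f: "strict_mono f" and g: "strict_mono g" and "f 0 = g 0"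
    and fg: "\<And>i. i \<le> L \<Longrightarrow> f i \<in> range g" and gf: "\<And>i. i \<le> L \<Longrightarrow> g i \<in> range f"
    and "i \<le> L"
  shows "f i = g i"
  using \<open>i \<le> L\<close>
proof (induction i)
  case (Suc i)
  have le: "h' (Suc i) \<le> h (Suc i)"
    if h: "strict_mono h" "strict_mono h'" "h i = h' i" "h (Suc i) \<in> range h'" for h h' :: "nat \<Rightarrow> int"
  proof -
    obtain k where k: "h (Suc i) = h' k" using h(4) by auto
    have "h i < h (Suc i)" using h(1) by (simp add: strict_mono_def)
    then have "h' i < h' k" using h(3) k by simp
    then have "i < k" using h(2) by (simp add: strict_mono_less)
    then have "h' (Suc i) \<le> h' k" using h(2) by (simp add: strict_mono_less_eq)
    then show ?thesis using k by simp
  qed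
  show ?case
    using le[OF f g] le[OF g f] Suc fg gf by (simp add: antisym)
qed (use assms in simp)

text \<open>Two bumps, visited alternately. All data carry the number of the visit as an index and have period
  two in it, so that flights and passages are treated alike for both bumps. The assumption
  \<open>free\<close> is the only trace of the remaining bumps.\<close>

locale bump_chain = magnetic_flow B \<Phi> LB M
  for B \<Phi> LB M +
  fixes \<beta> :: "nat \<Rightarrow> real \<Rightarrow> real" and a R R' Lp \<epsilon> :: "nat \<Rightarrow> real" and c :: "nat \<Rightarrow> real ^ 2"
    and s d \<alpha> a0 :: real
  assumes scat: "\<And>j. scatterer B \<Phi> LB M (\<beta> j) (a j) (R j) (R' j) s (Lp j) (c j) (\<epsilon> j)"
    and pair: "\<And>j. bump_pair (c j) (c (Suc j)) (R j) (R (Suc j)) s d (\<alpha> + real j * pi)"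
    and free: "\<And>j x y z. \<lbrakk>whirl.exit_moment (\<beta> j) (R j) s (a j) \<le> - \<epsilon> j * x; - \<epsilon> j * x \<le> R j * s;
        whirl.exit_moment (\<beta> (Suc j)) (R (Suc j)) s (a (Suc j)) \<le> - \<epsilon> (Suc j) * y; - \<epsilon> (Suc j) * y \<le> R (Suc j) * s;
        z \<in> closed_segment
          (fst (boundary_state 1 (c j) (R j) s x (\<alpha> + real j * pi + bump_pair.tilt s d x y)))
          (fst (boundary_state (- 1) (c (Suc j)) (R (Suc j)) s y (\<alpha> + real j * pi + bump_pair.tilt s d x y)))\<rbrakk>
        \<Longrightarrow> B z = 0"
    and period: "\<And>j. c (Suc (Suc j)) = c j" "\<And>j. R (Suc (Suc j)) = R j" "\<And>j. \<epsilon> (Suc (Suc j)) = \<epsilon> j"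
    and a0: "0 < a0" "\<And>j. a0 \<le> a j"
begin

definition half :: "nat \<Rightarrow> real \<Rightarrow> real" where
  "half j = whirl.half_angle (\<beta> j) (R j) (R' j) s"

definition moment :: "nat \<Rightarrow> real \<Rightarrow> real" where
  "moment j \<rho> = - \<epsilon> j * whirl.exit_moment (\<beta> j) (R j) s \<rho>"

definition heading :: "nat \<Rightarrow> real \<Rightarrow> real \<Rightarrow> real" where
  "heading j x y = \<alpha> + real j * pi + bump_pair.tilt s d x y"

abbreviation "exit_state j x \<theta> \<equiv> boundary_state 1 (c j) (R j) s x \<theta>"
abbreviation "entry_state j x \<theta> \<equiv> boundary_state (- 1) (c j) (R j) s x \<theta>"

text \<open>Bounds \<open>s\<close> times the duration of a passage with half turn at most \<open>6 \<pi>\<close>; see \<open>pass\<close>.\<close>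

definition pass_bound :: "nat \<Rightarrow> real" where
  "pass_bound j = 4 * R j * (6 * pi + (2 * (1 / (2 * R j) + 1 / a0) * R j
      + (1 / (2 * R j) + 1 / a0) / a0 * (R j)\<^sup>2 / 2))"

lemma whirl: "whirl (\<beta> j) (a j) (R j) (R' j) s (Lp j)"
  using scat[of j] by (simp add: scatterer_def)

lemma sign: "\<epsilon> j * \<epsilon> j = 1"
  by (rule scatterer.sign[OF scat])

lemma R_pos: "0 < R j" and s_pos: "0 < s" and d_pos: "0 < d" and disjoint: "R j + R (Suc j) < d"
  using bump_pair.R_pos[OF pair[of j]] bump_pair.s_pos[OF pair] bump_pair.d_pos[OF pair]
    bump_pair.disjoint[OF pair] by auto

lemma moment_props:
  assumes "a j \<le> \<rho>" "\<rho> \<le> R j"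
  shows "whirl.exit_moment (\<beta> j) (R j) s (a j) \<le> - \<epsilon> j * moment j \<rho>" "- \<epsilon> j * moment j \<rho> \<le> R j * s"
    "\<bar>moment j \<rho>\<bar> \<le> R j * s"
proof -
  have eq: "- \<epsilon> j * moment j \<rho> = whirl.exit_moment (\<beta> j) (R j) s \<rho>"
    using sign[of j] by (simp add: moment_def mult.assoc[symmetric])
  note r = whirl.exit_moment_range[OF whirl assms]
  show "whirl.exit_moment (\<beta> j) (R j) s (a j) \<le> - \<epsilon> j * moment j \<rho>" "- \<epsilon> j * moment j \<rho> \<le> R j * s"
    using r unfolding eq by auto
  have "\<bar>moment j \<rho>\<bar> = \<bar>whirl.exit_moment (\<beta> j) (R j) s \<rho>\<bar>"
    using scatterer.\<epsilon>_cases[OF scat[of j]] by (auto simp: moment_def)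
  then show "\<bar>moment j \<rho>\<bar> \<le> R j * s" using r by (simp add: abs_le_iff)
qed

text \<open>An interval of turning radii on which half of the turn covers \<open>[\<pi>, 6 \<pi>]\<close>. This leaves room for
  revolution numbers from \<open>2\<close> to \<open>5\<close> in \<open>chain_solution\<close>.\<close>

lemma window:
  obtains u v where "\<And>j. a j < v j" "\<And>j. v j < u j" "\<And>j. u j < R j"
    "\<And>j. half j (u j) \<le> pi" "\<And>j. 6 * pi \<le> half j (v j)"
proof -
  have "\<exists>u v. a j < v \<and> v < u \<and> u < R j \<and> half j u \<le> pi \<and> 6 * pi \<le> half j v" for j
  proof -
    interpret w: scatterer B \<Phi> LB M "\<beta> j" "a j" "R j" "R' j" s "Lp j" "c j" "\<epsilon> j" by (rule scat)
    obtain v where v: "a j < v" "v < R j" "\<And>x. w.turns v x \<Longrightarrow> 6 * pi \<le> x"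
      using w.turns_large_near_circular_orbit[of "6 * pi"] by (metis order_refl)
    obtain u0 where u0: "a j < u0" "u0 < R j"
        "\<And>\<rho> x. u0 < \<rho> \<Longrightarrow> \<rho> < R j \<Longrightarrow> w.turns \<rho> x \<Longrightarrow> \<bar>x\<bar> \<le> pi"
      using w.turns_small_near_boundary[OF pi_gt_zero] by metis
    define u where "u = (max u0 v + R j) / 2"
    have u: "u0 < u" "v < u" "u < R j" using u0 v by (auto simp: u_def)
    obtain x y where xy: "w.turns u x" "w.turns v y"
      using w.turns_exists[of u] w.turns_exists[of v] u v by (meson less_trans)
    have "half j u = x" "half j v = y"
      unfolding half_def using w.half_angle_eq[OF xy(1)] w.half_angle_eq[OF xy(2)] u v by auto
    moreover have "x \<le> pi" using u0(3)[OF u(1,3) xy(1)] by auto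
    moreover have "6 * pi \<le> y" using v(3)[OF xy(2)] .
    ultimately show ?thesis using u v by blast
  qed
  then show thesis using that by metis
qed

lemma flight_step:
  assumes x: "whirl.exit_moment (\<beta> j) (R j) s (a j) \<le> - \<epsilon> j * x" "- \<epsilon> j * x \<le> R j * s" "\<bar>x\<bar> \<le> R j * s"
    and y: "whirl.exit_moment (\<beta> (Suc j)) (R (Suc j)) s (a (Suc j)) \<le> - \<epsilon> (Suc j) * y"
      "- \<epsilon> (Suc j) * y \<le> R (Suc j) * s" "\<bar>y\<bar> \<le> R (Suc j) * s"
  obtains T where "d - R j - R (Suc j) \<le> T * s" "T * s \<le> d + R j + R (Suc j)"
    "\<Phi> T (exit_state j x (heading j x y)) = entry_state (Suc j) y (heading j x y)"
    "\<And>t. 0 \<le> t \<Longrightarrow> t \<le> T \<Longrightarrow> turn (exit_state j x (heading j x y)) t = 0"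
proof -
  interpret p: bump_pair "c j" "c (Suc j)" "R j" "R (Suc j)" s d "\<alpha> + real j * pi" by (rule pair)
  let ?x = "exit_state j x (heading j x y)" and ?y = "entry_state (Suc j) y (heading j x y)"
  obtain T where T: "fst ?y = fst ?x + (T * s) *\<^sub>R dir (heading j x y)"
      "d - R j - R (Suc j) \<le> T * s" "T * s \<le> d + R j + R (Suc j)"
    using p.flight_vector[OF x(3) y(3)] unfolding heading_def by metis
  have snd: "snd ?x = s *\<^sub>R dir (heading j x y)" "snd ?y = s *\<^sub>R dir (heading j x y)"
    by (simp_all add: boundary_state_def)
  have x_eq: "?x = (fst ?x, s *\<^sub>R dir (heading j x y))" and y_eq: "?y = (fst ?y, s *\<^sub>R dir (heading j x y))"
    by (simp_all add: prod_eq_iff snd)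
  have "0 < T * s" using T(2) disjoint[of j] by simp
  then have "0 < T" using s_pos by (simp add: zero_less_mult_iff)
  have fr: "B z = 0" if "z \<in> closed_segment (fst ?x) (fst ?x + (T * s) *\<^sub>R dir (heading j x y))" for z
    by (rule free[OF x(1,2) y(1,2)]) (use that[folded T(1)] in \<open>simp only: heading_def\<close>)
  show thesis
  proof (rule that[OF T(2,3)])
    show "\<Phi> T ?x = ?y"
      using free_flight(1)[OF x_eq fr, of T] \<open>0 < T\<close> T(1) y_eq by simp
    show "turn ?x t = 0" if "0 \<le> t" "t \<le> T" for t
      by (rule free_flight(2)[OF x_eq fr that])
  qed
qed

definition code_sign :: "nat \<Rightarrow> int" where
  "code_sign j = (if \<epsilon> j = 1 then 1 else - 1)"

lemma of_int_code_sign: "of_int (code_sign j) = \<epsilon> j"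
  using scatterer.\<epsilon>_cases[OF scat[of j]] by (auto simp: code_sign_def)

text \<open>Relative to the axis, the lifted direction of the \<open>j\<close>-th flight is \<open>\<pi> level m j\<close> up to its tilt: every
  passage reverses the direction and adds \<open>m\<close> revolutions, clockwise or counterclockwise according to
  the sign of the bump.\<close>

definition level :: "(nat \<Rightarrow> nat) \<Rightarrow> nat \<Rightarrow> int" where
  "level m j = int j - 2 * (\<Sum>i\<in>{1..j}. code_sign i * int (m i))"

definition flight_min :: real where "flight_min = (d - R 0 - R 1) / s"

definition step_max :: real where "step_max = (d + R 0 + R 1 + pass_bound 0 + pass_bound 1) / s"

definition tilt_max :: real where "tilt_max = arcsin ((R 0 + R 1) / d)"

text \<open>The flight number \<open>j\<close> takes place between the times \<open>T j\<close> and \<open>T j + Tf j\<close> with tilt \<open>\<psi> j\<close>, and is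
  followed by a passage of the other bump until \<open>T (j + 1)\<close>. Of the orbit only those properties are
  recorded that the separation argument uses.\<close>

definition itinerary ::
  "(nat \<Rightarrow> nat) \<Rightarrow> phase \<Rightarrow> (nat \<Rightarrow> real) \<Rightarrow> (nat \<Rightarrow> real) \<Rightarrow> (nat \<Rightarrow> real) \<Rightarrow> bool" where
  "itinerary m x \<psi> T Tf \<longleftrightarrow>
     norm (fst x - c 0) = R 0 \<and> snd x = s *\<^sub>R dir (\<alpha> + \<psi> 0) \<and> T 0 = 0 \<and>
     (\<forall>j. \<bar>\<psi> j\<bar> \<le> tilt_max \<and> flight_min \<le> Tf j \<and> T j + Tf j \<le> T (Suc j) \<and> T (Suc j) \<le> T j + step_max \<and>
       (\<forall>t. T j \<le> t \<and> t \<le> T j + Tf j \<longrightarrow> turn x t = pi * of_int (level m j) + \<psi> j - \<psi> 0) \<and>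
       (\<forall>t. T j + Tf j \<le> t \<and> t \<le> T (Suc j) \<longrightarrow> norm (fst (\<Phi> t x) - c (Suc j)) \<le> R (Suc j)))"

lemma level_Suc: "level m (Suc j) = level m j + 1 - 2 * code_sign (Suc j) * int (m (Suc j))"
  by (simp add: level_def)

lemma periodic_01:
  fixes f :: "nat \<Rightarrow> 'b"
  assumes "\<And>j. f (Suc (Suc j)) = f j"
  shows "f j = f (j mod 2)"
proof (induction j rule: less_induct)
  case (less j)
  show ?case
  proof (cases "j < 2")
    case False
    then obtain i where i: "j = Suc (Suc i)" by (metis add_2_eq_Suc le_add_diff_inverse not_le)
    then show ?thesis using assms less[of i] by simp
  qed simp
qed

lemma R_consecutive: "R j + R (Suc j) = R 0 + R 1"
  using periodic_01[of R j, OF period(2)] periodic_01[of R "Suc j", OF period(2)]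
  by (cases "even j") (auto simp: even_iff_mod_2_eq_zero odd_iff_mod_2_eq_one mod_Suc)

lemma pass_bound_le: "pass_bound j \<le> pass_bound 0 + pass_bound 1"
proof -
  have pos: "0 \<le> pass_bound i" for i
    using R_pos[of i] a0(1) by (simp add: pass_bound_def)
  have "pass_bound j = pass_bound (j mod 2)"
    by (rule periodic_01) (simp add: pass_bound_def period)
  moreover have "j mod 2 = 0 \<or> j mod 2 = 1" by auto
  ultimately show ?thesis using pos[of 0] pos[of 1] by auto
qed

lemma tilt_max_bounds: "0 \<le> tilt_max" "tilt_max < pi / 2"
proof -
  have "0 \<le> (R 0 + R 1) / d" "(R 0 + R 1) / d < 1"
    using R_pos[of 0] R_pos[of 1] d_pos disjoint[of 0] by (auto simp: pos_divide_less_eq)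
  then show "0 \<le> tilt_max" "tilt_max < pi / 2"
    unfolding tilt_max_def using arcsin_lt_bounded[of "(R 0 + R 1) / d"] by (auto intro: arcsin_nonneg)
qed

lemma tilt_le_tilt_max:
  assumes "\<bar>x\<bar> \<le> R j * s" "\<bar>y\<bar> \<le> R (Suc j) * s"
  shows "\<bar>arcsin ((x - y) / (s * d))\<bar> \<le> tilt_max"
proof -
  have le: "\<bar>(x - y) / (s * d)\<bar> \<le> (R 0 + R 1) / d"
  proof -
    have "\<bar>x - y\<bar> \<le> (R j + R (Suc j)) * s"
      using assms by (simp add: distrib_right abs_le_iff)
    then have "\<bar>x - y\<bar> \<le> (R 0 + R 1) * s"
      by (simp only: R_consecutive[of j])
    then have "\<bar>x - y\<bar> / (s * d) \<le> (R 0 + R 1) * s / (s * d)"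
      using s_pos d_pos by (intro divide_right_mono) auto
    then show ?thesis
      using s_pos d_pos by (simp add: abs_mult)
  qed
  have lt: "(R 0 + R 1) / d < 1"
    using d_pos disjoint[of 0] by (simp add: pos_divide_less_eq)
  have le': "(x - y) / (s * d) \<le> (R 0 + R 1) / d" "- ((R 0 + R 1) / d) \<le> (x - y) / (s * d)"
    using le by (simp_all only: abs_le_iff minus_le_iff)
  have "arcsin ((x - y) / (s * d)) \<le> tilt_max"
    unfolding tilt_max_def by (rule arcsin_le_arcsin) (use le' lt in linarith)+
  moreover have "arcsin (- ((R 0 + R 1) / d)) \<le> arcsin ((x - y) / (s * d))"
    by (rule arcsin_le_arcsin) (use le' lt in linarith)+
  moreover have "arcsin (- ((R 0 + R 1) / d)) = - tilt_max"
    unfolding tilt_max_def by (rule arcsin_minus) (use le' lt in linarith)+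
  ultimately show ?thesis by simp
qed

text \<open>Any sequence of revolution numbers from \<open>2\<close> to \<open>5\<close> is realised. \<open>chain_solution\<close> provides the
  momenta; the flights and passages then fit together because the directions before and after each
  passage agree with the required ones modulo \<open>2 \<pi>\<close>.\<close>

lemma itinerary_exists:
  assumes m: "\<And>j. 2 \<le> m j \<and> m j \<le> 5"
  shows "\<exists>x \<psi> T Tf. itinerary m x \<psi> T Tf"
proof -
  obtain u v where win: "\<And>j. a j < v j" "\<And>j. v j < u j" "\<And>j. u j < R j"
    "\<And>j. half j (u j) \<le> pi" "\<And>j. 6 * pi \<le> half j (v j)"
    by (rule window, rule that, assumption+)
  have range: "a j < \<rho>" "\<rho> < R j" if "v j \<le> \<rho>" "\<rho> \<le> u j" for \<rho> j
    using win(1)[of j] win(3)[of j] that by auto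
  have half_cont: "continuous_on {v j..u j} (half j)" for j
  proof -
    interpret w: scatterer B \<Phi> LB M "\<beta> j" "a j" "R j" "R' j" s "Lp j" "c j" "\<epsilon> j" by (rule scat)
    show ?thesis
      unfolding half_def using range[of j]
      by (intro continuous_on_subset[OF w.continuous_on_half_angle] w.turns_exists) auto
  qed
  have moment_cont: "continuous_on {v j..u j} (moment j)" for j
    unfolding moment_def[abs_def] using win(1,3)[of j]
    by (intro continuous_intros continuous_on_subset[OF whirl.continuous_on_exit_moment[OF whirl]]) auto
  have moment_mono: "- \<epsilon> j * moment j x \<le> - \<epsilon> j * moment j y" if "v j \<le> x" "x \<le> y" "y \<le> u j" for j x y
    using whirl.exit_moment_mono[OF whirl, of j x y] win(1,3)[of j] that sign[of j]
    by (simp add: moment_def mult.assoc[symmetric])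
  have m_real: "2 \<le> real (m j)" "real (m j) \<le> 5" for j using m[of j] by auto
  have vu: "v j \<le> u j" for j using win(2)[of j] by simp
  have low: "2 * half j (u j) + 2 * pi \<le> 2 * pi * real (m j)" for j
  proof -
    have "2 * pi * 2 \<le> 2 * pi * real (m j)"
      using m_real[of j] by (intro mult_left_mono) auto
    then show ?thesis using win(4)[of j] by linarith
  qed
  have high: "2 * pi * real (m j) + 2 * pi \<le> 2 * half j (v j)" for j
  proof -
    have "2 * pi * real (m j) \<le> 2 * pi * 5"
      using m_real[of j] by (intro mult_left_mono) auto
    then show ?thesis using win(5)[of j] by linarith
  qed
  have mom0: "\<bar>moment j x\<bar> \<le> R j * s" if "v j \<le> x" "x \<le> u j" for j x
    using moment_props(3)[of j x] range[OF that] by simp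
  have RD: "R j * s + R (Suc j) * s < s * d" for j
    using mult_strict_right_mono[OF disjoint[of j] s_pos] by (simp add: algebra_simps)
  define recurrence where "recurrence cs \<rho> \<longleftrightarrow> cs 0 = moment 0 (v 0) \<and> (\<forall>j. cs (Suc j) = moment (Suc j) (\<rho> (Suc j)) \<and>
      v (Suc j) \<le> \<rho> (Suc j) \<and> \<rho> (Suc j) \<le> u (Suc j) \<and>
      2 * half (Suc j) (\<rho> (Suc j)) = 2 * pi * real (m (Suc j))
       - \<epsilon> (Suc j) * (pi + arcsin ((cs (Suc j) - cs (Suc (Suc j))) / (s * d)) - arcsin ((cs j - cs (Suc j)) / (s * d))))"
    for cs \<rho>
  have "\<exists>cs \<rho>. recurrence cs \<rho>"
  proof (rule chain_solution[of v u half moment \<epsilon> "\<lambda>j. R j * s" "s * d" "moment 0 (v 0)" "\<lambda>j. real (m j)"])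
    fix \<rho> cs
    assume "cs 0 = moment 0 (v 0)" "\<And>j. cs (Suc j) = moment (Suc j) (\<rho> (Suc j))"
      "\<And>j. v (Suc j) \<le> \<rho> (Suc j)" "\<And>j. \<rho> (Suc j) \<le> u (Suc j)"
      "\<And>j. 2 * half (Suc j) (\<rho> (Suc j)) = 2 * pi * real (m (Suc j))
       - \<epsilon> (Suc j) * (pi + arcsin ((cs (Suc j) - cs (Suc (Suc j))) / (s * d)) - arcsin ((cs j - cs (Suc j)) / (s * d)))"
    then have "recurrence cs \<rho>"
      unfolding recurrence_def by blast
    then show ?thesis by blast
  next
    show "v j \<le> u j" "continuous_on {v j..u j} (half j)" "continuous_on {v j..u j} (moment j)"
      "\<epsilon> j * \<epsilon> j = 1" "R j * s + R (Suc j) * s < s * d" "\<bar>moment 0 (v 0)\<bar> \<le> R 0 * s"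
      "2 * half j (u j) + 2 * pi \<le> 2 * pi * real (m j)" "2 * pi * real (m j) + 2 * pi \<le> 2 * half j (v j)" for j
      by (rule vu half_cont moment_cont sign RD mom0[OF order_refl vu] low high)+
    show "- \<epsilon> j * moment j x \<le> - \<epsilon> j * moment j y" if "v j \<le> x" "x \<le> y" "y \<le> u j" for j x y
      by (rule moment_mono[OF that])
    show "\<bar>moment j x\<bar> \<le> R j * s" if "v j \<le> x" "x \<le> u j" for j x
      by (rule mom0[OF that])
  qed
  then obtain cs \<rho> where "recurrence cs \<rho>" by blast
  then have cs0: "cs 0 = moment 0 (v 0)" and cs: "cs (Suc j) = moment (Suc j) (\<rho> (Suc j))"
    and \<rho>: "v (Suc j) \<le> \<rho> (Suc j)" "\<rho> (Suc j) \<le> u (Suc j)"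
    and eq: "2 * half (Suc j) (\<rho> (Suc j)) = 2 * pi * real (m (Suc j))
       - \<epsilon> (Suc j) * (pi + arcsin ((cs (Suc j) - cs (Suc (Suc j))) / (s * d)) - arcsin ((cs j - cs (Suc j)) / (s * d)))"
    for j
    unfolding recurrence_def by blast+
  have cs_mom: "\<exists>r. a j < r \<and> r < R j \<and> cs j = moment j r" for j
  proof (cases j)
    case 0
    then show ?thesis using cs0 range[OF order_refl vu, of 0] by auto
  next
    case (Suc i)
    then show ?thesis using cs[of i] range[OF \<rho>[of i]] by auto
  qed
  have cs_props: "whirl.exit_moment (\<beta> j) (R j) s (a j) \<le> - \<epsilon> j * cs j" "- \<epsilon> j * cs j \<le> R j * s"
    "\<bar>cs j\<bar> \<le> R j * s" for j
    using cs_mom[of j] moment_props[of j] by (auto simp: less_imp_le)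
  define \<psi> where "\<psi> j = arcsin ((cs j - cs (Suc j)) / (s * d))" for j
  define \<omega> where "\<omega> j = \<alpha> + real j * pi + \<psi> j" for j
  have head: "heading j (cs j) (cs (Suc j)) = \<omega> j" for j
    by (simp add: heading_def bump_pair.tilt_def[OF pair] \<psi>_def \<omega>_def)
  have "\<exists>Tf. d - R j - R (Suc j) \<le> Tf * s \<and> Tf * s \<le> d + R j + R (Suc j) \<and>
      \<Phi> Tf (exit_state j (cs j) (\<omega> j)) = entry_state (Suc j) (cs (Suc j)) (\<omega> j) \<and>
      (\<forall>t. 0 \<le> t \<and> t \<le> Tf \<longrightarrow> turn (exit_state j (cs j) (\<omega> j)) t = 0)" for j
    using flight_step[OF cs_props[of j] cs_props[of "Suc j"]] unfolding head by metis
  then obtain Tf where Tf: "\<And>j. d - R j - R (Suc j) \<le> Tf j * s" "\<And>j. Tf j * s \<le> d + R j + R (Suc j)"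
      "\<And>j. \<Phi> (Tf j) (exit_state j (cs j) (\<omega> j)) = entry_state (Suc j) (cs (Suc j)) (\<omega> j)"
      "\<And>j t. 0 \<le> t \<Longrightarrow> t \<le> Tf j \<Longrightarrow> turn (exit_state j (cs j) (\<omega> j)) t = 0"
    by metis
  define h where "h j = half (Suc j) (\<rho> (Suc j))" for j
  have h_eq: "2 * \<epsilon> (Suc j) * h j = 2 * pi * (\<epsilon> (Suc j) * real (m (Suc j))) - (pi + \<psi> (Suc j) - \<psi> j)" for j
  proof -
    have "\<epsilon> (Suc j) * (2 * h j) = \<epsilon> (Suc j) * (2 * pi * real (m (Suc j)) - \<epsilon> (Suc j) * (pi + \<psi> (Suc j) - \<psi> j))"
      unfolding h_def eq \<psi>_def ..
    also have "\<dots> = 2 * pi * (\<epsilon> (Suc j) * real (m (Suc j))) - (\<epsilon> (Suc j) * \<epsilon> (Suc j)) * (pi + \<psi> (Suc j) - \<psi> j)"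
      by (simp add: algebra_simps)
    finally show ?thesis by (simp add: sign mult_ac)
  qed
  have \<psi>_bound: "\<bar>\<psi> j\<bar> \<le> tilt_max" for j
    unfolding \<psi>_def by (rule tilt_le_tilt_max[OF cs_props(3) cs_props(3)])
  have h_bound: "h j \<le> 6 * pi" for j
  proof -
    have "2 * h j = 2 * pi * real (m (Suc j)) - \<epsilon> (Suc j) * (pi + \<psi> (Suc j) - \<psi> j)"
      unfolding h_def eq \<psi>_def ..
    moreover have "2 * pi * real (m (Suc j)) \<le> 2 * pi * 5"
      using m_real[of "Suc j"] by (intro mult_left_mono) auto
    moreover have "- \<epsilon> (Suc j) * (pi + \<psi> (Suc j) - \<psi> j) \<le> 2 * pi"
      using \<psi>_bound[of j] \<psi>_bound[of "Suc j"] tilt_max_bounds scatterer.\<epsilon>_cases[OF scat[of "Suc j"]]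
      by (auto simp: abs_le_iff)
    ultimately show ?thesis by linarith
  qed
  have "\<exists>\<tau>. 0 < \<tau> \<and> \<Phi> \<tau> (entry_state (Suc j) (cs (Suc j)) (\<omega> j))
        = exit_state (Suc j) (cs (Suc j)) (\<omega> j - 2 * \<epsilon> (Suc j) * h j) \<and>
      turn (entry_state (Suc j) (cs (Suc j)) (\<omega> j)) \<tau> = - 2 * \<epsilon> (Suc j) * h j \<and>
      (\<forall>t. 0 \<le> t \<and> t \<le> \<tau> \<longrightarrow> norm (fst (\<Phi> t (entry_state (Suc j) (cs (Suc j)) (\<omega> j))) - c (Suc j)) \<le> R (Suc j)) \<and>
      s * \<tau> \<le> pass_bound (Suc j)" for j
  proof -
    interpret w: scatterer B \<Phi> LB M "\<beta> (Suc j)" "a (Suc j)" "R (Suc j)" "R' (Suc j)" s "Lp (Suc j)"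
      "c (Suc j)" "\<epsilon> (Suc j)" by (rule scat)
    define b where "b = - \<epsilon> (Suc j) * w.exit_moment (\<rho> (Suc j))"
    have b: "cs (Suc j) = b" using cs[of j] by (simp add: moment_def b_def)
    have hh: "h j = w.half_angle (\<rho> (Suc j))" by (simp add: h_def half_def)
    obtain \<tau> where \<tau>: "0 < \<tau>" "\<Phi> \<tau> (w.entry b (\<omega> j)) = w.exit b (\<omega> j - 2 * \<epsilon> (Suc j) * h j)"
      "turn (w.entry b (\<omega> j)) \<tau> = - 2 * \<epsilon> (Suc j) * h j"
      "\<And>t. 0 \<le> t \<Longrightarrow> t \<le> \<tau> \<Longrightarrow> norm (fst (\<Phi> t (w.entry b (\<omega> j))) - c (Suc j)) \<le> R (Suc j)"
      "s * \<tau> \<le> 4 * R (Suc j) * (h j + (2 * (1 / (2 * R (Suc j)) + 1 / a0) * R (Suc j)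
        + (1 / (2 * R (Suc j)) + 1 / a0) / a0 * (R (Suc j))\<^sup>2 / 2))"
      using w.pass[OF range[OF \<rho>[of j]] a0(1) a0(2)[of "Suc j"], of "\<omega> j"]
      unfolding b_def hh by metis
    have "s * \<tau> \<le> pass_bound (Suc j)"
      unfolding pass_bound_def using h_bound[of j] R_pos[of "Suc j"]
      by (intro order_trans[OF \<tau>(5)] mult_left_mono add_right_mono) auto
    then show ?thesis using \<tau> unfolding b by blast
  qed
  then obtain \<tau> where \<tau>: "\<And>j. 0 < \<tau> j" "\<And>j. \<Phi> (\<tau> j) (entry_state (Suc j) (cs (Suc j)) (\<omega> j))
        = exit_state (Suc j) (cs (Suc j)) (\<omega> j - 2 * \<epsilon> (Suc j) * h j)"
      "\<And>j. turn (entry_state (Suc j) (cs (Suc j)) (\<omega> j)) (\<tau> j) = - 2 * \<epsilon> (Suc j) * h j"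
      "\<And>j t. 0 \<le> t \<Longrightarrow> t \<le> \<tau> j \<Longrightarrow> norm (fst (\<Phi> t (entry_state (Suc j) (cs (Suc j)) (\<omega> j))) - c (Suc j)) \<le> R (Suc j)"
      "\<And>j. s * \<tau> j \<le> pass_bound (Suc j)"
    by metis
  have turned: "exit_state (Suc j) (cs (Suc j)) (\<omega> j - 2 * \<epsilon> (Suc j) * h j)
      = exit_state (Suc j) (cs (Suc j)) (\<omega> (Suc j))" for j
  proof -
    \<comment> \<open>the matching condition: the outgoing direction is the next heading up to full revolutions\<close>
    have "\<omega> j - 2 * \<epsilon> (Suc j) * h j = \<omega> (Suc j) + 2 * pi * of_int (- (code_sign (Suc j) * int (m (Suc j))))"
      unfolding h_eq by (simp add: \<omega>_def of_int_code_sign algebra_simps)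
    then show ?thesis
      by (simp only: boundary_state_2pi)
  qed
  define T where "T j = (\<Sum>i<j. Tf i + \<tau> i)" for j
  define x where "x = exit_state 0 (cs 0) (\<omega> 0)"
  have Tf_pos: "0 < Tf j" for j
  proof -
    have "0 < Tf j * s" using Tf(1)[of j] disjoint[of j] by simp
    then show ?thesis using s_pos by (simp add: zero_less_mult_iff)
  qed
  have T_Suc: "T (Suc j) = T j + Tf j + \<tau> j" for j by (simp add: T_def)
  have T_nonneg: "0 \<le> T j" for j
    unfolding T_def using Tf_pos \<tau>(1) by (intro sum_nonneg) (simp add: less_imp_le)
  have flight: "\<Phi> (T j + t) x = \<Phi> t (exit_state j (cs j) (\<omega> j)) \<and>
      turn x (T j + t) = turn x (T j) + turn (exit_state j (cs j) (\<omega> j)) t"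
    if "\<Phi> (T j) x = exit_state j (cs j) (\<omega> j)" "0 \<le> t" for j t
    using flow_add[OF that(2), of "T j" x] turn_add[OF that(2), of x "T j"] that(1) by (simp add: add.commute)
  have pass: "\<Phi> (T j + Tf j + t) x = \<Phi> t (entry_state (Suc j) (cs (Suc j)) (\<omega> j)) \<and>
      turn x (T j + Tf j + t) = turn x (T j) + turn (entry_state (Suc j) (cs (Suc j)) (\<omega> j)) t"
    if st: "\<Phi> (T j) x = exit_state j (cs j) (\<omega> j)" and "0 \<le> t" for j t
  proof -
    have "\<Phi> (T j + Tf j) x = entry_state (Suc j) (cs (Suc j)) (\<omega> j) \<and> turn x (T j + Tf j) = turn x (T j)"
      using flight[OF st less_imp_le[OF Tf_pos]] Tf(3)[of j] Tf(4)[of "Tf j" j] Tf_pos[of j] by simp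
    then show ?thesis
      using flow_add[OF that(2), of "T j + Tf j" x] turn_add[OF that(2), of x "T j + Tf j"]
      by (simp add: add_ac)
  qed
  have state: "\<Phi> (T j) x = exit_state j (cs j) (\<omega> j) \<and>
      turn x (T j) = pi * of_int (level m j) + \<psi> j - \<psi> 0" for j
  proof (induction j)
    case 0
    then show ?case by (simp add: T_def x_def level_def)
  next
    case (Suc j)
    then have st: "\<Phi> (T j) x = exit_state j (cs j) (\<omega> j)" and tn: "turn x (T j) = pi * of_int (level m j) + \<psi> j - \<psi> 0"
      by auto
    have "\<Phi> (T (Suc j)) x = exit_state (Suc j) (cs (Suc j)) (\<omega> (Suc j))"
      using pass[OF st less_imp_le[OF \<tau>(1)[of j]]] \<tau>(2)[of j] turned[of j] by (simp add: T_Suc)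
    moreover have "turn x (T (Suc j)) = turn x (T j) - 2 * \<epsilon> (Suc j) * h j"
      using pass[OF st less_imp_le[OF \<tau>(1)[of j]]] \<tau>(3)[of j] by (simp add: T_Suc)
    ultimately show ?case
      unfolding h_eq tn level_Suc by (simp add: of_int_code_sign algebra_simps)
  qed
  have times: "flight_min \<le> Tf j" "Tf j + \<tau> j \<le> step_max" for j
  proof -
    have "d - R 0 - R 1 \<le> Tf j * s" "Tf j * s \<le> d + R 0 + R 1"
      using Tf(1,2)[of j] R_consecutive[of j] by linarith+
    moreover have "\<tau> j * s \<le> pass_bound 0 + pass_bound 1"
      using \<tau>(5)[of j] pass_bound_le[of "Suc j"] by (simp add: mult.commute)
    ultimately show "flight_min \<le> Tf j" "Tf j + \<tau> j \<le> step_max"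
      using s_pos by (simp_all add: flight_min_def step_max_def pos_divide_le_eq pos_le_divide_eq distrib_right)
  qed
  have "itinerary m x \<psi> T Tf"
    unfolding itinerary_def
  proof (intro conjI allI impI)
    show "norm (fst x - c 0) = R 0"
      unfolding x_def using boundary_state_props(1)[OF s_pos cs_props(3) _ R_pos, where \<sigma> = 1 and c = "c 0"] by simp
    show "snd x = s *\<^sub>R dir (\<alpha> + \<psi> 0)"
      by (simp add: x_def boundary_state_def \<omega>_def)
    show "T 0 = 0" by (simp add: T_def)
    fix j
    show "\<bar>\<psi> j\<bar> \<le> tilt_max" by (rule \<psi>_bound)
    show "flight_min \<le> Tf j" "T j + Tf j \<le> T (Suc j)" "T (Suc j) \<le> T j + step_max"
      using times[of j] \<tau>(1)[of j] by (simp_all add: T_Suc)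
    show "turn x t = pi * of_int (level m j) + \<psi> j - \<psi> 0" if "T j \<le> t \<and> t \<le> T j + Tf j" for t
      using flight[of j "t - T j"] state[of j] Tf(4)[of "t - T j" j] that by simp
    show "norm (fst (\<Phi> t x) - c (Suc j)) \<le> R (Suc j)" if "T j + Tf j \<le> t \<and> t \<le> T (Suc j)" for t
      using pass[of j "t - (T j + Tf j)"] state[of j] \<tau>(4)[of "t - (T j + Tf j)" j] that by (simp add: T_Suc)
  qed
  then show ?thesis by blast
qed

end

section \<open>Separation of orbits\<close>

context bump_chain
begin

text \<open>The coordinate along the axis. The open strip of width \<open>2 gap\<close> about \<open>mid\<close> separates the two discs.\<close>

definition height :: "phase \<Rightarrow> real" where
  "height x = (fst x - c 0) \<bullet> dir \<alpha>"

definition mid :: real where "mid = (R 0 + d - R 1) / 2"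
definition gap :: real where "gap = (d - R 0 - R 1) / 2"

lemma gap_pos: "0 < gap" and flight_min_pos: "0 < flight_min"
  using disjoint[of 0] s_pos by (simp_all add: gap_def flight_min_def)

lemma centers: "c j = (if even j then c 0 else c 0 + d *\<^sub>R dir \<alpha>)" "R j = R (j mod 2)"
proof -
  have "c 1 = c 0 + d *\<^sub>R dir \<alpha>"
    using bump_pair.axis[OF pair[of 0]] by (simp add: algebra_simps)
  then show "c j = (if even j then c 0 else c 0 + d *\<^sub>R dir \<alpha>)"
    using periodic_01[of c j, OF period(1)] by (auto simp: even_iff_mod_2_eq_zero odd_iff_mod_2_eq_one)
  show "R j = R (j mod 2)" by (rule periodic_01[of R, OF period(2)])
qed

lemma height_in_disc:
  assumes "norm (fst x - c j) \<le> R j"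
  shows "even j \<Longrightarrow> height x \<le> mid - gap" "odd j \<Longrightarrow> mid + gap \<le> height x"
proof -
  have cs: "\<bar>(fst x - c j) \<bullet> dir \<alpha>\<bar> \<le> R j"
    using Cauchy_Schwarz_ineq2[of "fst x - c j" "dir \<alpha>"] assms by simp
  show "height x \<le> mid - gap" if "even j"
  proof -
    have "c j = c 0" "R j = R 0" using centers[of j] that by simp_all
    then show ?thesis
      using cs by (simp add: height_def mid_def gap_def abs_le_iff field_simps)
  qed
  show "mid + gap \<le> height x" if "odd j"
  proof -
    have "c j = c 0 + d *\<^sub>R dir \<alpha>" "R j = R 1" using centers[of j] that by (simp_all add: odd_iff_mod_2_eq_one)
    then show ?thesis
      using cs by (simp add: height_def mid_def gap_def abs_le_iff inner_diff_left inner_add_left field_simps)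
  qed
qed

lemma height_lipschitz: "\<bar>height x - height y\<bar> \<le> dist x y"
proof -
  have "height x - height y = (fst x - fst y) \<bullet> dir \<alpha>"
    by (simp add: height_def inner_diff_left)
  then have "\<bar>height x - height y\<bar> \<le> norm (fst x - fst y)"
    using Cauchy_Schwarz_ineq2[of "fst x - fst y" "dir \<alpha>"] by simp
  also have "\<dots> \<le> dist x y"
    using dist_fst_le[of x y] by (simp add: dist_norm)
  finally show ?thesis .
qed

lemma itineraryD:
  assumes "itinerary m x \<psi> T Tf"
  shows "norm (fst x - c 0) = R 0" "snd x = s *\<^sub>R dir (\<alpha> + \<psi> 0)" "T 0 = 0"
    "\<bar>\<psi> j\<bar> \<le> tilt_max" "flight_min \<le> Tf j" "T j + Tf j \<le> T (Suc j)" "T (Suc j) \<le> T j + step_max"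
    "T j \<le> t \<Longrightarrow> t \<le> T j + Tf j \<Longrightarrow> turn x t = pi * of_int (level m j) + \<psi> j - \<psi> 0"
    "T j + Tf j \<le> t \<Longrightarrow> t \<le> T (Suc j) \<Longrightarrow> norm (fst (\<Phi> t x) - c (Suc j)) \<le> R (Suc j)"
  using assms unfolding itinerary_def by blast+

lemma itinerary_times:
  assumes it: "itinerary m x \<psi> T Tf"
  shows "real j * flight_min \<le> T j" "T j \<le> real j * step_max"
proof (induction j)
  case 0
  case 1 show ?case using itineraryD(3)[OF it] by simp
  case 2 show ?case using itineraryD(3)[OF it] by simp
next
  case (Suc j)
  case 1 show ?case
    using Suc itineraryD(5,6)[OF it, of j] by (simp add: distrib_right)
  case 2 show ?case
    using Suc itineraryD(7)[OF it, of j] by (simp add: distrib_right)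
qed

lemma itinerary_phase:
  assumes it: "itinerary m x \<psi> T Tf" and "0 \<le> t"
  obtains j where "T j \<le> t" "t \<le> T (Suc j)"
proof -
  obtain n where "t / flight_min < real n"
    using reals_Archimedean2 by blast
  then have "t < real n * flight_min"
    using flight_min_pos by (simp add: pos_divide_less_eq)
  then have n: "t < T n"
    using itinerary_times(1)[OF it, of n] by simp
  define k where "k = (LEAST k. t < T k)"
  have k: "t < T k" unfolding k_def using n by (rule LeastI)
  have "k \<noteq> 0" using k itineraryD(3)[OF it] assms(2) by (auto intro: ccontr)
  then obtain j where j: "k = Suc j" using not0_implies_Suc by blast
  have "\<not> t < T j"
    using not_less_Least[of j "\<lambda>k. t < T k"] j k_def by simp
  then show thesis using that[of j] k j by simp
qed

lemma in_strip_imp_in_flight: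
  assumes it: "itinerary m x \<psi> T Tf" and "0 \<le> t" and strip: "\<bar>height (\<Phi> t x) - mid\<bar> < gap"
  obtains j where "turn x t = pi * of_int (level m j) + \<psi> j - \<psi> 0"
proof -
  obtain j where j: "T j \<le> t" "t \<le> T (Suc j)"
    using itinerary_phase[OF it \<open>0 \<le> t\<close>] .
  show thesis
  proof (cases "t \<le> T j + Tf j")
    case True
    then show ?thesis using itineraryD(8)[OF it j(1)] that by blast
  next
    case False
    then have "norm (fst (\<Phi> t x) - c (Suc j)) \<le> R (Suc j)"
      using itineraryD(9)[OF it, of j t] j by simp
    then have "height (\<Phi> t x) \<le> mid - gap \<or> mid + gap \<le> height (\<Phi> t x)"
      using height_in_disc by (cases "even (Suc j)") auto
    then show ?thesis using strip by auto
  qed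
qed

lemma itinerary_crosses:
  assumes it: "itinerary m x \<psi> T Tf" and "even j"
  obtains t where "T j \<le> t" "t \<le> T j + Tf j" "height (\<Phi> t x) = mid"
proof -
  have Tf: "0 \<le> Tf j" using itineraryD(5)[OF it, of j] flight_min_pos by simp
  have "norm (fst (\<Phi> (T j) x) - c j) \<le> R j"
  proof (cases j)
    case 0
    then show ?thesis using itineraryD(1,3)[OF it] by simp
  next
    case (Suc i)
    then show ?thesis using itineraryD(9)[OF it, of i "T j"] itineraryD(6)[OF it, of i] by simp
  qed
  then have lo: "height (\<Phi> (T j) x) \<le> mid"
    using height_in_disc(1)[of "\<Phi> (T j) x" j] \<open>even j\<close> gap_pos by simp
  have "norm (fst (\<Phi> (T j + Tf j) x) - c (Suc j)) \<le> R (Suc j)"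
    using itineraryD(9)[OF it, of j "T j + Tf j"] itineraryD(6)[OF it, of j] by simp
  then have hi: "mid \<le> height (\<Phi> (T j + Tf j) x)"
    using height_in_disc(2)[of "\<Phi> (T j + Tf j) x" "Suc j"] \<open>even j\<close> gap_pos by simp
  have "continuous_on {T j..T j + Tf j} (\<lambda>t. height (\<Phi> t x))"
    unfolding height_def by (intro continuous_intros continuous_flow)
  then have "\<exists>t\<ge>T j. t \<le> T j + Tf j \<and> height (\<Phi> t x) = mid"
    using lo hi Tf by (intro IVT') auto
  then show thesis using that by blast
qed

text \<open>Lifted directions of two flights which are closer than this have the same level, since tilts are
  at most \<open>tilt_max\<close> and levels are integers.\<close>

definition lift_gap :: real where "lift_gap = pi - 2 * tilt_max"

lemma lift_gap_bounds: "0 < lift_gap" "lift_gap \<le> pi"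
  using tilt_max_bounds by (simp_all add: lift_gap_def)

definition tolerance :: real where
  "tolerance = min (gap / 2) (s * sin (lift_gap / 2))"

lemma tolerance_pos: "0 < tolerance"
  using gap_pos s_pos lift_gap_bounds sin_gt_zero[of "lift_gap / 2"] by (simp add: tolerance_def)

text \<open>If the velocities remain close, their directions are close modulo \<open>2 \<pi>\<close>. The lifted difference is
  continuous and initially small, so it cannot jump to another multiple of \<open>2 \<pi>\<close>.\<close>

lemma lifts_stay_close:
  assumes x: "snd x = s *\<^sub>R dir \<omega>" and x': "snd x' = s *\<^sub>R dir \<omega>'" and "\<bar>\<omega> - \<omega>'\<bar> < pi"
    and close: "\<And>t. 0 \<le> t \<Longrightarrow> t < N \<Longrightarrow> dist (\<Phi> t x) (\<Phi> t x') \<le> tolerance"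
    and t: "0 \<le> t" "t < N"
  shows "\<bar>(\<omega> + turn x t) - (\<omega>' + turn x' t)\<bar> < lift_gap"
proof -
  define D where "D t = \<bar>(\<omega> + turn x t) - (\<omega>' + turn x' t)\<bar>" for t
  have sin_small: "\<bar>sin (D t / 2)\<bar> < sin (lift_gap / 2)" if "0 \<le> t" "t < N" for t
  proof -
    have "norm (snd (\<Phi> t x) - snd (\<Phi> t x')) \<le> dist (\<Phi> t x) (\<Phi> t x')"
      using dist_snd_le[of "\<Phi> t x" "\<Phi> t x'"] by (simp add: dist_norm)
    also have "\<dots> \<le> s * sin (lift_gap / 2)"
      using close[OF that] by (simp add: tolerance_def)
    also have "norm (snd (\<Phi> t x) - snd (\<Phi> t x')) = s * norm (dir (\<omega> + turn x t) - dir (\<omega>' + turn x' t))"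
      unfolding momentum_direction[OF x] momentum_direction[OF x'] using s_pos
      by (simp flip: scaleR_diff_right)
    also have "\<dots> = s * (2 * \<bar>sin (D t / 2)\<bar>)"
    proof -
      have "\<bar>sin (\<bar>z\<bar> / 2)\<bar> = \<bar>sin (z / 2)\<bar>" for z :: real
        by (cases "0 \<le> z") (simp_all add: abs_if)
      then show ?thesis by (simp add: norm_dir_diff D_def)
    qed
    finally have "2 * \<bar>sin (D t / 2)\<bar> \<le> sin (lift_gap / 2)"
      using s_pos by simp
    moreover have "0 < sin (lift_gap / 2)"
      using lift_gap_bounds by (intro sin_gt_zero) auto
    ultimately show ?thesis by linarith
  qed
  have not_eq: "D u \<noteq> lift_gap" if "0 \<le> u" "u < N" for u
    using sin_small[OF that] by auto
  have D0: "D 0 < lift_gap"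
  proof (rule ccontr)
    assume "\<not> D 0 < lift_gap"
    then have "lift_gap / 2 \<le> D 0 / 2" "D 0 / 2 \<le> pi / 2"
      using assms(3) by (auto simp: D_def)
    then have "sin (lift_gap / 2) \<le> sin (D 0 / 2)"
      using lift_gap_bounds by (intro sin_monotone_2pi_le) auto
    then show False
      using sin_small[of 0] t by auto
  qed
  have cont: "continuous_on {0..t} D"
    unfolding D_def
    by (intro continuous_intros DERIV_continuous_on[OF has_field_derivative_at_within[OF turn_deriv]])
  show ?thesis
  proof (rule ccontr)
    assume "\<not> ?thesis"
    then have "lift_gap \<le> D t" by (simp add: D_def)
    then have "\<exists>u\<ge>0. u \<le> t \<and> D u = lift_gap"
      using D0 t cont by (intro IVT') auto
    then show False using not_eq t by force
  qed
qed

lemma even_level: "even (level m j) \<longleftrightarrow> even j"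
  by (simp add: level_def)

text \<open>When the first orbit crosses the middle of the strip during an even flight, the second one is in
  the strip too, hence on a flight, and its lifted direction is close; so both flights have the same
  level.\<close>

lemma close_imp_same_levels:
  assumes it: "itinerary m x \<psi> T Tf" and it': "itinerary m' x' \<psi>' T' Tf'"
    and close: "\<And>t. 0 \<le> t \<Longrightarrow> t < N \<Longrightarrow> dist (\<Phi> t x) (\<Phi> t x') \<le> tolerance"
    and j: "even j" "real (Suc j) * step_max < N"
  obtains i where "even i" "level m j = level m' i"
proof -
  obtain t where t: "T j \<le> t" "t \<le> T j + Tf j" "height (\<Phi> t x) = mid"
    using itinerary_crosses[OF it j(1)] .
  have "0 \<le> T j"
    using order_trans[OF mult_nonneg_nonneg itinerary_times(1)[OF it, of j]] flight_min_pos by simp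
  then have t0: "0 \<le> t" using t by simp
  have tN: "t < N"
    using t itineraryD(6)[OF it, of j] itinerary_times(2)[OF it, of "Suc j"] j(2) by simp
  have "\<bar>height (\<Phi> t x') - mid\<bar> \<le> gap / 2"
    using height_lipschitz[of "\<Phi> t x" "\<Phi> t x'"] close[OF t0 tN] t(3) by (simp add: tolerance_def abs_minus_commute)
  then have "\<bar>height (\<Phi> t x') - mid\<bar> < gap" using gap_pos by simp
  then obtain i where i: "turn x' t = pi * of_int (level m' i) + \<psi>' i - \<psi>' 0"
    using in_strip_imp_in_flight[OF it' t0] by blast
  have turn: "turn x t = pi * of_int (level m j) + \<psi> j - \<psi> 0"
    by (rule itineraryD(8)[OF it t(1,2)])
  have \<psi>: "\<bar>\<psi> j\<bar> \<le> tilt_max" "\<bar>\<psi> 0\<bar> \<le> tilt_max" "\<bar>\<psi>' i\<bar> \<le> tilt_max" "\<bar>\<psi>' 0\<bar> \<le> tilt_max"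
    using itineraryD(4)[OF it] itineraryD(4)[OF it'] by auto
  have "\<bar>(\<alpha> + \<psi> 0) - (\<alpha> + \<psi>' 0)\<bar> < pi"
    using \<psi> tilt_max_bounds by (simp add: abs_if split: if_splits)
  from lifts_stay_close[OF itineraryD(2)[OF it] itineraryD(2)[OF it'] this close t0 tN]
  have "\<bar>pi * of_int (level m j) + \<psi> j - (pi * of_int (level m' i) + \<psi>' i)\<bar> < lift_gap"
    by (simp add: turn i)
  then have "\<bar>pi * of_int (level m j) - pi * of_int (level m' i)\<bar> < pi"
    using \<psi> by (simp add: lift_gap_def abs_if split: if_splits)
  then have "pi * \<bar>real_of_int (level m j - level m' i)\<bar> < pi * 1"
    by (simp add: abs_mult flip: right_diff_distrib)
  then have "\<bar>real_of_int (level m j - level m' i)\<bar> < 1"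
    by (simp only: mult_less_cancel_left_pos pi_gt_zero)
  then have "level m j = level m' i" by linarith
  then show thesis
    using that[of i] j(1) even_level by metis
qed

text \<open>Only the revolutions about the first bump carry information. The number \<open>2\<close> for the second bump is
  small compared with \<open>4\<close>, so that the levels of the even flights are monotone even if the two bumps
  turn orbits in opposite directions.\<close>

definition admissible :: "(nat \<Rightarrow> nat) \<Rightarrow> bool" where
  "admissible m \<longleftrightarrow> (\<forall>j. if even j then m j = 4 \<or> m j = 5 else m j = 2)"

lemma code_sign_cases: "code_sign j = 1 \<or> code_sign j = - 1" and code_sign_period: "code_sign (Suc (Suc j)) = code_sign j"
  by (simp_all add: code_sign_def period)

lemma code_sign_parity: "code_sign (2 * i) = code_sign 0" "code_sign (Suc (2 * i)) = code_sign 1"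
proof -
  have p: "code_sign j = code_sign (j mod 2)" for j
    by (rule periodic_01[of code_sign, OF code_sign_period])
  show "code_sign (2 * i) = code_sign 0" "code_sign (Suc (2 * i)) = code_sign 1"
    using p[of "2 * i"] p[of "Suc (2 * i)"] by simp_all
qed

text \<open>The level of the \<open>i\<close>-th even flight, with the sign that makes it increase with \<open>i\<close>.\<close>

definition height_code :: "(nat \<Rightarrow> nat) \<Rightarrow> nat \<Rightarrow> int" where
  "height_code m i = - code_sign 0 * level m (2 * i)"

lemma height_code_Suc:
  assumes "admissible m"
  shows "height_code m (Suc i) = height_code m i + 2 * int (m (2 * Suc i)) + 4 * code_sign 0 * code_sign 1 - 2 * code_sign 0"
proof -
  have "m (Suc (2 * i)) = 2" using assms by (simp add: admissible_def)
  moreover have "code_sign 0 * code_sign 0 = 1" using code_sign_cases[of 0] by auto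
  ultimately show ?thesis
    using code_sign_parity[of "Suc i"] code_sign_parity[of i]
    by (simp add: height_code_def level_Suc algebra_simps)
qed

lemma strict_mono_height_code: "admissible m \<Longrightarrow> strict_mono (height_code m)"
proof (rule strict_mono_Suc_iff[THEN iffD2], intro allI)
  fix i assume m: "admissible m"
  then have "even (2 * Suc i) \<longrightarrow> m (2 * Suc i) = 4 \<or> m (2 * Suc i) = 5"
    unfolding admissible_def by presburger
  then have "4 \<le> int (m (2 * Suc i))" by auto
  then show "height_code m i < height_code m (Suc i)"
    using height_code_Suc[OF m, of i] code_sign_cases[of 0] code_sign_cases[of 1] by auto
qed

text \<open>Two orbits that stay close visit the same levels during even flights. As these levels increase
  along each orbit, the sequences of levels coincide, and their differences reveal the revolution
  numbers.\<close>

lemma close_imp_same_word: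
  assumes it: "itinerary m x \<psi> T Tf" "admissible m" and it': "itinerary m' x' \<psi>' T' Tf'" "admissible m'"
    and close: "\<And>t. 0 \<le> t \<Longrightarrow> t < N \<Longrightarrow> dist (\<Phi> t x) (\<Phi> t x') \<le> tolerance"
    and L: "real (2 * L + 1) * step_max < N" and i: "1 \<le> i" "i \<le> L"
  shows "m (2 * i) = m' (2 * i)"
proof -
  have step: "0 \<le> step_max"
    using itineraryD(5,6,7)[OF it(1), of 0] flight_min_pos by linarith
  have time: "real (Suc (2 * i)) * step_max < N" if "i \<le> L" for i
  proof -
    have "real (Suc (2 * i)) * step_max \<le> real (2 * L + 1) * step_max"
      using that step by (intro mult_right_mono) auto
    then show ?thesis using L by simp
  qed
  have in_range: "height_code m1 i \<in> range (height_code m2)"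
    if prems: "itinerary m1 x1 \<psi>1 T1 Tf1" "itinerary m2 x2 \<psi>2 T2 Tf2"
      "\<And>t. 0 \<le> t \<Longrightarrow> t < N \<Longrightarrow> dist (\<Phi> t x1) (\<Phi> t x2) \<le> tolerance" "i \<le> L"
    for m1 x1 \<psi>1 T1 Tf1 m2 x2 \<psi>2 T2 Tf2 i
  proof -
    have "even (2 * i)" by simp
    obtain k where "even k" "level m1 (2 * i) = level m2 k"
      using close_imp_same_levels[OF prems(1,2,3) \<open>even (2 * i)\<close> time[OF prems(4)]] by blast
    then obtain k' where "level m1 (2 * i) = level m2 (2 * k')" by (auto elim: evenE)
    then show ?thesis by (auto simp: height_code_def)
  qed
  have same: "height_code m i = height_code m' i" if "i \<le> L" for i
  proof (rule strict_mono_mutual_range[OF strict_mono_height_code[OF it(2)] strict_mono_height_code[OF it'(2)] _ _ _ that])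
    show "height_code m 0 = height_code m' 0" by (simp add: height_code_def level_def)
    show "height_code m i \<in> range (height_code m')" if "i \<le> L" for i
      by (rule in_range[OF it(1) it'(1) close that])
    show "height_code m' i \<in> range (height_code m)" if "i \<le> L" for i
      by (rule in_range[OF it'(1) it(1) _ that]) (simp add: close dist_commute)
  qed
  obtain k where k: "i = Suc k" using i by (cases i) auto
  have "height_code m k = height_code m' k" "height_code m (Suc k) = height_code m' (Suc k)"
    using same i k by auto
  then show ?thesis
    using height_code_Suc[OF it(2), of k] height_code_Suc[OF it'(2), of k] k by simp
qed

text \<open>A word is a set \<open>A\<close> of positions at which the first bump is circled five instead of four times.
  Closeness at integer times extends to all times by continuous dependence over unit time, at the
  cost of the factor \<open>exp \<kappa>\<close> in the resolution.\<close>

theorem entropy_lower_bound: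
  assumes X: "X = {x :: phase. norm (snd x) = s}"
  shows "ereal (ln 2 / (2 * step_max)) \<le> topological_entropy X (\<Phi> 1)"
proof -
  define word where "word A j = (if odd j then 2 else if j div 2 \<in> A then 5 else 4 :: nat)" for A :: "nat set" and j
  have adm: "admissible (word A)" for A
    by (auto simp: admissible_def word_def)
  have "\<exists>x \<psi> T Tf. itinerary (word A) x \<psi> T Tf" for A
    by (rule itinerary_exists) (auto simp: word_def)
  then obtain x \<psi> T Tf where it: "\<And>A. itinerary (word A) (x A) (\<psi> A) (T A) (Tf A)"
    by metis
  define \<kappa> where "\<kappa> = 1 + M + LB * s"
  have \<kappa>: "0 \<le> \<kappa>"
    unfolding \<kappa>_def using B_bound[of 0] lipschitz_on_nonneg[OF B_lip] s_pos
    by (smt (verit) mult_nonneg_nonneg abs_ge_zero)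
  define \<eta> where "\<eta> = tolerance / exp \<kappa>"
  have \<eta>: "0 < \<eta>" using tolerance_pos by (simp add: \<eta>_def)
  have speed: "norm (snd (x A)) = s" for A
    using itineraryD(2)[OF it[of A]] s_pos by simp
  define K :: "phase set" where "K = cball (c 0) (R 0) \<times> sphere 0 s"
  have step: "0 < step_max"
    using itineraryD(5,6,7)[OF it, of "{}" 0] flight_min_pos by linarith
  have same: "A \<inter> {1..L} = A' \<inter> {1..L}"
    if n: "(2 * step_max) * real L + (step_max + 1) \<le> real n"
      and close: "\<And>i. i < n \<Longrightarrow> dist ((\<Phi> 1 ^^ i) (x A)) ((\<Phi> 1 ^^ i) (x A')) \<le> \<eta>" for A A' L n
  proof -
    have c: "dist (\<Phi> t (x A)) (\<Phi> t (x A')) \<le> tolerance" if t: "0 \<le> t" "t < real n" for t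
    proof -
      define i where "i = nat \<lfloor>t\<rfloor>"
      have i: "real i \<le> t" "t - real i < 1" "i < n"
        using t by (simp_all add: i_def, linarith+)
      have "dist (\<Phi> t (x A)) (\<Phi> t (x A'))
          = dist (\<Phi> (t - real i) (\<Phi> (real i) (x A))) (\<Phi> (t - real i) (\<Phi> (real i) (x A')))"
        using flow_add[of "t - real i" "real i"] i by simp
      also have "\<dots> \<le> exp (\<kappa> * (t - real i)) * dist (\<Phi> (real i) (x A)) (\<Phi> (real i) (x A'))"
        unfolding \<kappa>_def using i by (intro flow_close) (auto simp: speed_flow speed)
      also have "\<dots> \<le> exp \<kappa> * \<eta>"
      proof (rule mult_mono)
        have "\<kappa> * (t - real i) \<le> \<kappa> * 1"
          using i \<kappa> by (intro mult_left_mono) auto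
        then show "exp (\<kappa> * (t - real i)) \<le> exp \<kappa>" by simp
        show "dist (\<Phi> (real i) (x A)) (\<Phi> (real i) (x A')) \<le> \<eta>"
          using close[OF i(3)] by (simp add: time_one_iterate)
      qed auto
      finally show ?thesis by (simp add: \<eta>_def)
    qed
    have "real (2 * L + 1) * step_max < real n"
      using n step by (simp add: algebra_simps)
    then have "word A (2 * i) = word A' (2 * i)" if "1 \<le> i" "i \<le> L" for i
      using close_imp_same_word[OF it adm it adm c] that by blast
    then show ?thesis
      by (force simp: word_def split: if_splits)
  qed
  have inj: "inj_on x (Pow {1..L})" for L
  proof (rule inj_onI)
    fix A A' assume A: "A \<in> Pow {1..L}" "A' \<in> Pow {1..L}" "x A = x A'"
    obtain n where "(2 * step_max) * real L + (step_max + 1) \<le> real n"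
      using real_arch_simple by blast
    then have "A \<inter> {1..L} = A' \<inter> {1..L}"
      by (rule same) (use A(3) \<eta> in simp)
    then show "A = A'" using A by blast
  qed
  show ?thesis
  proof (rule topological_entropy_ge_ln2_over[where K = K and \<epsilon> = \<eta> and b = "step_max + 1"])
    show "K \<subseteq> X" by (auto simp: K_def X)
    show "compact K" unfolding K_def by (intro compact_Times) auto
    show "0 < \<eta>" "0 < 2 * step_max" using \<eta> step by auto
    fix L
    show "\<exists>F. F \<subseteq> K \<and> finite F \<and> card F = 2 ^ L \<and>
       (\<forall>n. real n \<ge> (2 * step_max) * real L + (step_max + 1) \<longrightarrow> bowen_separated (\<Phi> 1) n \<eta> F)"
    proof (intro exI conjI allI impI)
      show "x ` Pow {1..L} \<subseteq> K"
      proof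
        fix y assume "y \<in> x ` Pow {1..L}"
        then obtain A where y: "y = x A" by auto
        show "y \<in> K"
          unfolding y using itineraryD(1)[OF it[of A]] speed[of A]
          by (auto simp: K_def mem_Times_iff dist_norm norm_minus_commute)
      qed
      show "finite (x ` Pow {1..L})" by simp
      show "card (x ` Pow {1..L}) = 2 ^ L"
        using card_image[OF inj] by (simp add: card_Pow)
      fix n assume n: "(2 * step_max) * real L + (step_max + 1) \<le> real n"
      show "bowen_separated (\<Phi> 1) n \<eta> (x ` Pow {1..L})"
        unfolding bowen_separated_def
      proof (intro ballI impI)
        fix y y' assume "y \<in> x ` Pow {1..L}" "y' \<in> x ` Pow {1..L}" "y \<noteq> y'"
        then obtain A A' where A: "A \<subseteq> {1..L}" "A' \<subseteq> {1..L}" "y = x A" "y' = x A'" "A \<noteq> A'" by auto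
        show "\<exists>i<n. \<eta> < dist ((\<Phi> 1 ^^ i) y) ((\<Phi> 1 ^^ i) y')"
        proof (rule ccontr)
          assume "\<not> ?thesis"
          then have "dist ((\<Phi> 1 ^^ i) (x A)) ((\<Phi> 1 ^^ i) (x A')) \<le> \<eta>" if "i < n" for i
            using that A by force
          then have "A \<inter> {1..L} = A' \<inter> {1..L}" by (rule same[OF n])
          then show False using A by blast
        qed
      qed
    qed
  qed
qed

end

section \<open>Entropy on the energy surfaces\<close>

lemma dir_add_nat_pi: "dir (\<alpha> + real j * pi) = (if even j then dir \<alpha> else - dir \<alpha>)"
proof (induction j)
  case (Suc j)
  have "dir (\<alpha> + real (Suc j) * pi) = - dir (\<alpha> + real j * pi)"
    using dir_add_pi[of "\<alpha> + real j * pi"] by (simp add: algebra_simps)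
  then show ?case using Suc by simp
qed simp

text \<open>The discs are closed and finite in number, hence each of them has a neighbourhood that misses the
  other ones.\<close>

lemma isolated_disc:
  assumes radii: "\<And>m. m \<in> {1..n} \<Longrightarrow> 0 < radius (S m)"
    and off: "\<And>m r. m \<in> {1..n} \<Longrightarrow> radius (S m) \<le> r \<Longrightarrow> profile (S m) r = 0"
    and disj: "\<And>m. m \<in> {1..n} \<Longrightarrow> m \<noteq> k \<Longrightarrow> disc (S k) \<inter> disc (S m) = {}" and k: "k \<in> {1..n}"
  obtains R' where "radius (S k) < R'"
    "\<And>x. norm (x - center (S k)) \<le> R' \<Longrightarrow> total_field n S x = bump_field (S k) x"
proof -
  define f where "f m = (radius (S k) + (dist (center (S k)) (center (S m)) - radius (S m))) / 2" for m
  define R' where "R' = Min (insert (radius (S k) + 1) (f ` ({1..n} - {k})))"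
  have sep: "radius (S k) + radius (S m) < dist (center (S k)) (center (S m))" if "m \<in> {1..n}" "m \<noteq> k" for m
    using disj[OF that] radii[OF k] radii[OF that(1)] unfolding disc_def
    by (intro disjoint_cballs_imp_less_dist) auto
  have "radius (S k) < f m" "f m < dist (center (S k)) (center (S m)) - radius (S m)"
    if "m \<in> {1..n}" "m \<noteq> k" for m
    using sep[OF that] by (simp_all add: f_def)
  note f = this
  have "radius (S k) < R'"
    unfolding R'_def by (subst Min_gr_iff) (use f(1) in auto)
  moreover have "total_field n S x = bump_field (S k) x" if x: "norm (x - center (S k)) \<le> R'" for x
  proof -
    have "bump_field (S m) x = 0" if m: "m \<in> {1..n} - {k}" for m
    proof -
      have "R' \<le> f m"
        unfolding R'_def using m by (intro Min_le) auto
      then have "norm (x - center (S k)) < dist (center (S k)) (center (S m)) - radius (S m)"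
        using f(2)[of m] m x by auto
      moreover have "dist (center (S k)) (center (S m)) \<le> norm (x - center (S k)) + norm (x - center (S m))"
        using dist_triangle[of "center (S k)" "center (S m)" x] by (simp add: dist_norm norm_minus_commute)
      ultimately have "radius (S m) \<le> norm (x - center (S m))" by simp
      then show ?thesis using off[of m] m by (simp add: bump_field_def)
    qed
    then show ?thesis
      unfolding total_field_def using k by (simp add: sum.remove[of _ k])
  qed
  ultimately show thesis using that by blast
qed

lemma total_field_lipschitz_bounded:
  assumes lip: "\<And>m. m \<in> {1..n} \<Longrightarrow> (L m)-lipschitz_on {0..} (profile (S m))"
    and radii: "\<And>m. m \<in> {1..n} \<Longrightarrow> 0 < radius (S m)"
    and off: "\<And>m r. m \<in> {1..n} \<Longrightarrow> radius (S m) \<le> r \<Longrightarrow> profile (S m) r = 0"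
  shows "(\<Sum>m\<in>{1..n}. L m)-lipschitz_on UNIV (total_field n S)"
    and "\<bar>total_field n S x\<bar> \<le> (\<Sum>m\<in>{1..n}. L m * radius (S m))"
proof -
  show "(\<Sum>m\<in>{1..n}. L m)-lipschitz_on UNIV (total_field n S)"
  proof (rule lipschitz_onI)
    fix x y
    have "dist (total_field n S x) (total_field n S y) = \<bar>\<Sum>m\<in>{1..n}. bump_field (S m) x - bump_field (S m) y\<bar>"
      by (simp add: total_field_def dist_real_def sum_subtractf)
    also have "\<dots> \<le> (\<Sum>m\<in>{1..n}. \<bar>bump_field (S m) x - bump_field (S m) y\<bar>)"
      by (rule sum_abs)
    also have "\<dots> \<le> (\<Sum>m\<in>{1..n}. L m * dist x y)"
    proof (rule sum_mono)
      fix m assume "m \<in> {1..n}"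
      then show "\<bar>bump_field (S m) x - bump_field (S m) y\<bar> \<le> L m * dist x y"
        using lipschitz_onD[OF bump_field_lipschitz[OF lip], of m x y] by (simp add: dist_real_def)
    qed
    finally show "dist (total_field n S x) (total_field n S y) \<le> (\<Sum>m\<in>{1..n}. L m) * dist x y"
      by (simp add: sum_distrib_right)
  qed (intro sum_nonneg lipschitz_on_nonneg[OF lip])
  have "\<bar>total_field n S x\<bar> \<le> (\<Sum>m\<in>{1..n}. \<bar>bump_field (S m) x\<bar>)"
    unfolding total_field_def by (rule sum_abs)
  also have "\<dots> \<le> (\<Sum>m\<in>{1..n}. L m * radius (S m))"
    by (intro sum_mono bump_field_bounded lip off radii)
  finally show "\<bar>total_field n S x\<bar> \<le> (\<Sum>m\<in>{1..n}. L m * radius (S m))" .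
qed

text \<open>General position enters here: flights between the two bumps stay in the convex hull of the arcs,
  which no other bump meets, and the field of the two bumps themselves vanishes outside their
  discs. The bound has the form \<open>const \<cdot> sqrt E\<close> with a constant that involves the energy only through
  \<open>a0\<close>.\<close>

lemma entropy_of_two_bumps:
  fixes S :: "nat \<Rightarrow> bump"
  assumes flow: "magnetic_flow (total_field n S) \<Phi> LB M"
    and idx: "i1 \<in> {1..n}" "i2 \<in> {1..n}" "i1 \<noteq> i2"
    and eb1: "energetic_bump (S i1) L1 E" and eb2: "energetic_bump (S i2) L2 E"
    and R1': "radius (S i1) < R1'" "\<And>x. norm (x - center (S i1)) \<le> R1' \<Longrightarrow> total_field n S x = bump_field (S i1) x"
    and R2': "radius (S i2) < R2'" "\<And>x. norm (x - center (S i2)) \<le> R2' \<Longrightarrow> total_field n S x = bump_field (S i2) x"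
    and axis: "center (S i2) - center (S i1) = d *\<^sub>R dir \<alpha>" "radius (S i1) + radius (S i2) < d"
    and gp: "general_position n S E"
    and a0: "0 < a0" "a0 \<le> outer_radius E (S i1)" "a0 \<le> outer_radius E (S i2)"
  defines "pb \<equiv> \<lambda>R. 4 * R * (6 * pi + (2 * (1 / (2 * R) + 1 / a0) * R + (1 / (2 * R) + 1 / a0) / a0 * R\<^sup>2 / 2))"
  shows "ereal (ln 2 / (2 * ((d + radius (S i1) + radius (S i2) + pb (radius (S i1)) + pb (radius (S i2))) / sqrt (2 * E))))
     \<le> flow_entropy (energy_surface E) \<Phi>"
proof -
  define i where "i j = (if even j then i1 else i2)" for j :: nat
  define L where "L j = (if even j then L1 else L2)" for j :: nat
  define R' where "R' j = (if even j then R1' else R2')" for j :: nat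
  define s where "s = sqrt (2 * E)"
  define \<beta> where "\<beta> j = energetic_bump.\<beta> (S (i j)) E" for j
  define a where "a j = outer_radius E (S (i j))" for j
  define \<epsilon> where "\<epsilon> j = outer_sign E (S (i j))" for j
  define R where "R j = radius (S (i j))" for j
  define c where "c j = center (S (i j))" for j
  interpret flow: magnetic_flow "total_field n S" \<Phi> LB M by (rule flow)
  have eb: "energetic_bump (S (i j)) (L j) E" for j
    using eb1 eb2 by (simp add: i_def L_def)
  have i_in: "i j \<in> {1..n}" "i j \<noteq> i (Suc j)" for j
    using idx by (auto simp: i_def)
  have RR': "R j < R' j" "\<And>x. norm (x - c j) \<le> R' j \<Longrightarrow> total_field n S x = bump_field (S (i j)) x" for j
    using R1' R2' by (simp_all add: R_def c_def R'_def i_def split: if_splits)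
  have s_eq: "energetic_bump.s E = s" "energetic_bump.a (S (i j)) E = a j" "energetic_bump.\<epsilon> (S (i j)) E = \<epsilon> j" for j
    by (simp_all add: energetic_bump.s_def[OF eb[of j]] energetic_bump.a_def[OF eb[of j]]
        energetic_bump.\<epsilon>_def[OF eb[of j]] s_def a_def \<epsilon>_def)
  have s_pos: "0 < s"
    using energetic_bump.s_pos[OF eb[of 0]] by (simp add: s_eq)
  have R_pos: "0 < R j" for j
    using energetic_bump.radius_pos[OF eb[of j]] by (simp add: R_def)
  have off: "profile (S (i j)) r = 0" if "R j \<le> r" for j r
    using energetic_bump.profile_off[OF eb[of j]] that by (simp add: R_def)
  have sign: "\<epsilon> j * \<epsilon> j = 1" for j
    using energetic_bump.\<epsilon>_sq[OF eb[of j]] by (simp add: s_eq)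
  have wh: "whirl (\<beta> j) (a j) (R j) (R' j) s (L j)" for j
    using energetic_bump.whirl[OF eb[of j], of "R' j"] RR'(1)[of j] by (simp add: \<beta>_def R_def s_eq)
  have scat: "scatterer (total_field n S) \<Phi> LB M (\<beta> j) (a j) (R j) (R' j) s (L j) (c j) (\<epsilon> j)" for j
  proof -
    have "scatterer_axioms (total_field n S) (\<beta> j) (R' j) (c j) (\<epsilon> j)"
    proof
      fix x assume "norm (x - c j) \<le> R' j"
      then have "total_field n S x = profile (S (i j)) (norm (x - c j))"
        using RR'(2) by (simp add: bump_field_def c_def)
      also have "\<dots> = \<epsilon> j * \<beta> j (norm (x - c j))"
        using energetic_bump.profile_eq[OF eb[of j]] by (simp add: \<beta>_def s_eq)
      finally show "total_field n S x = \<epsilon> j * \<beta> j (norm (x - c j))" .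
    qed (rule sign)
    then show ?thesis
      using flow wh[of j] by (simp add: scatterer_def)
  qed
  have pair: "bump_pair (c j) (c (Suc j)) (R j) (R (Suc j)) s d (\<alpha> + real j * pi)" for j
  proof
    show "c (Suc j) - c j = d *\<^sub>R dir (\<alpha> + real j * pi)"
      unfolding dir_add_nat_pi using axis(1) by (auto simp: c_def i_def algebra_simps)
    show "R j + R (Suc j) < d"
      using axis(2) by (simp add: R_def i_def)
  qed (use R_pos s_pos in auto)
  have I: "critical_momentum E (S (i j)) = - \<epsilon> j * whirl.exit_moment (\<beta> j) (R j) s (a j)" for j
    using energetic_bump.critical_momentum_eq[OF eb[of j], of "R' j"] RR'(1)[of j]
    by (simp add: \<beta>_def R_def s_eq)
  have I_eq: "- \<epsilon> j * critical_momentum E (S (i j)) = whirl.exit_moment (\<beta> j) (R j) s (a j)" for j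
    unfolding I using sign[of j] by (simp add: mult.assoc[symmetric])
  have \<epsilon>_cases: "\<epsilon> j = 1 \<or> \<epsilon> j = - 1" for j
    using sign[of j] by (simp add: square_eq_1_iff)
  have I_bound: "\<bar>critical_momentum E (S (i j))\<bar> \<le> R j * s" for j
  proof -
    have "a j \<le> R j" using whirl.a_less[OF wh[of j]] by simp
    from whirl.exit_moment_range[OF wh order_refl this]
    show ?thesis unfolding I using \<epsilon>_cases[of j] by (auto simp: abs_le_iff)
  qed
  have clear: "\<forall>k\<in>{1..n}. \<forall>l\<in>{1..n}. \<forall>m\<in>{1..n}. k \<noteq> l \<longrightarrow> k \<noteq> m \<longrightarrow> l \<noteq> m \<longrightarrow>
      (convex hull (exit_arc E (S k) (S l) \<union> entry_arc E (S l) (S k))) \<inter> supp (bump_field (S m)) = {}"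
    using gp unfolding general_position_def by (rule conjunct1)
  have chain: "bump_chain (total_field n S) \<Phi> LB M \<beta> a R R' L \<epsilon> c s d \<alpha> a0"
  proof (intro bump_chain.intro bump_chain_axioms.intro flow scat pair)
    fix j x y z
    let ?x = "fst (boundary_state 1 (c j) (R j) s x (\<alpha> + real j * pi + bump_pair.tilt s d x y))"
    let ?y = "fst (boundary_state (- 1) (c (Suc j)) (R (Suc j)) s y (\<alpha> + real j * pi + bump_pair.tilt s d x y))"
    assume x: "whirl.exit_moment (\<beta> j) (R j) s (a j) \<le> - \<epsilon> j * x" "- \<epsilon> j * x \<le> R j * s"
      and y: "whirl.exit_moment (\<beta> (Suc j)) (R (Suc j)) s (a (Suc j)) \<le> - \<epsilon> (Suc j) * y"
        "- \<epsilon> (Suc j) * y \<le> R (Suc j) * s"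
      and z: "z \<in> closed_segment ?x ?y"
    have bound: "\<bar>w\<bar> \<le> R k * s"
      if "whirl.exit_moment (\<beta> k) (R k) s (a k) \<le> - \<epsilon> k * w" "- \<epsilon> k * w \<le> R k * s" for k w
      using that I_bound[of k] \<epsilon>_cases[of k] unfolding I by (auto simp: abs_le_iff)
    note xb = bound[OF x] and yb = bound[OF y]
    have arcs: "?x \<in> exit_arc E (S (i j)) (S (i (Suc j)))" "?y \<in> entry_arc E (S (i (Suc j))) (S (i j))"
      by (rule bump_pair.exit_and_entry_in_arcs[OF pair[of j] s_def c_def[symmetric] c_def[symmetric]
          R_def[symmetric] R_def[symmetric] \<epsilon>_def[symmetric] \<epsilon>_def[symmetric] sign sign refl refl
          I_bound I_bound x(1)[folded I_eq] x(2) y(1)[folded I_eq] y(2)])+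
    have hull: "z \<in> convex hull (exit_arc E (S (i j)) (S (i (Suc j))) \<union> entry_arc E (S (i (Suc j))) (S (i j)))"
      using z arcs by (meson UnI1 UnI2 closed_segment_subset_convex_hull hull_inc subsetD)
    have "bump_field (S m) z = 0" if m: "m \<in> {1..n}" for m
    proof -
      consider "m = i j" | "m = i (Suc j)" | "m \<noteq> i j" "m \<noteq> i (Suc j)" by blast
      then show ?thesis
      proof cases
        case 1
        then show ?thesis
          using bump_pair.flight_outside(1)[OF pair xb yb z] off[of j] by (simp add: bump_field_def c_def)
      next
        case 2
        then show ?thesis
          using bump_pair.flight_outside(2)[OF pair xb yb z] off[of "Suc j"] by (simp add: bump_field_def c_def)
      next
        case 3
        have "(convex hull (exit_arc E (S (i j)) (S (i (Suc j))) \<union> entry_arc E (S (i (Suc j))) (S (i j))))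
            \<inter> supp (bump_field (S m)) = {}"
          by (rule clear[rule_format, OF i_in(1) i_in(1) m i_in(2)]) (use 3 in simp_all)
        then have "z \<notin> supp (bump_field (S m))"
          using hull by (meson disjoint_iff)
        moreover have "{x. bump_field (S m) x \<noteq> 0} \<subseteq> supp (bump_field (S m))"
          unfolding supp_def by (rule closure_subset)
        ultimately show ?thesis by blast
      qed
    qed
    then show "total_field n S z = 0"
      by (simp add: total_field_def)
  next
    show "0 < a0" by (rule a0)
    show "a0 \<le> a j" for j using a0 by (simp add: a_def i_def)
  qed (simp_all add: c_def R_def \<epsilon>_def i_def)
  interpret chain: bump_chain "total_field n S" \<Phi> LB M \<beta> a R R' L \<epsilon> c s d \<alpha> a0
    by (rule chain)
  have "norm (snd x) = s \<longleftrightarrow> energy x = E" for x :: phase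
  proof -
    have "energy x = E \<longleftrightarrow> (norm (snd x))\<^sup>2 = s\<^sup>2"
      using energetic_bump.E_pos[OF eb[of 0]] by (auto simp: energy_def s_def)
    then show ?thesis using s_pos by (simp add: power2_eq_iff_nonneg)
  qed
  then have "energy_surface E = {x. norm (snd x) = s}"
    by (simp add: energy_surface_def)
  from chain.entropy_lower_bound[OF this]
  have "ereal (ln 2 / (2 * chain.step_max)) \<le> flow_entropy (energy_surface E) \<Phi>"
    by (simp add: flow_entropy_def)
  moreover have "chain.step_max = (d + radius (S i1) + radius (S i2) + pb (radius (S i1)) + pb (radius (S i2))) / s"
    unfolding chain.step_max_def chain.pass_bound_def pb_def R_def i_def by simp
  ultimately show ?thesis by (simp add: s_def)
qed

theorem corollary3p5:
  fixes n :: nat and S :: "nat \<Rightarrow> bump" and \<Phi> :: "real \<Rightarrow> phase \<Rightarrow> phase"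
  assumes "n \<ge> 2"
    and "magnetic_bumps n S"
    and "is_magnetic_flow (total_field n S) \<Phi>"
    and "\<And>E. 0 < E \<Longrightarrow> E \<le> critical_energy n S \<Longrightarrow> general_position n S E"
  shows "\<exists>c::real. c > 0 \<and>
    (\<forall>E. 0 < E \<and> E \<le> critical_energy n S \<longrightarrow>
       flow_entropy (energy_surface E) \<Phi> \<ge> ereal (c * sqrt E))"
proof (cases "0 < critical_energy n S")
  case False
  then show ?thesis by (intro exI[of _ 1]) auto
next
  case pos: True
  have "\<exists>L. L-lipschitz_on {0..} (profile (S m)) \<and> (\<forall>r. radius (S m) \<le> r \<longrightarrow> profile (S m) r = 0) \<and> 0 < radius (S m)"
    if "m \<in> {1..n}" for m
  proof -
    have "local_lipschitz (UNIV :: real set) UNIV (\<lambda>_. bump_field (S m))"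
      "\<exists>x. bump_field (S m) x \<noteq> 0" "supp (bump_field (S m)) \<subseteq> disc (S m)"
      using assms(2) that unfolding magnetic_bumps_def by blast+
    from bump_profile[OF this] show ?thesis by metis
  qed
  then obtain L where lip: "\<And>m. m \<in> {1..n} \<Longrightarrow> (L m)-lipschitz_on {0..} (profile (S m))"
    and off: "\<And>m r. m \<in> {1..n} \<Longrightarrow> radius (S m) \<le> r \<Longrightarrow> profile (S m) r = 0"
    and radii: "\<And>m. m \<in> {1..n} \<Longrightarrow> 0 < radius (S m)"
    by metis
  have disj: "disc (S k) \<inter> disc (S l) = {}" if "k \<in> {1..n}" "l \<in> {1..n}" "k \<noteq> l" for k l
    using assms(2) that unfolding magnetic_bumps_def by blast
  define LB where "LB = (\<Sum>m\<in>{1..n}. L m)"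
  define M where "M = (\<Sum>m\<in>{1..n}. L m * radius (S m))"
  have flow: "magnetic_flow (total_field n S) \<Phi> LB M"
    unfolding LB_def M_def
    by unfold_locales (rule assms(3) total_field_lipschitz_bounded[OF lip radii off]; assumption)+
  have idx: "1 \<in> {1..n}" "2 \<in> {1..n}" "(1::nat) \<noteq> 2" using assms(1) by auto
  define d where "d = dist (center (S 1)) (center (S 2))"
  have disj_d: "radius (S 1) + radius (S 2) < d"
    using disj[OF idx] radii[OF idx(1)] radii[OF idx(2)] unfolding disc_def d_def
    by (intro disjoint_cballs_imp_less_dist) auto
  have d_pos: "0 < d" using disj_d radii[OF idx(1)] radii[OF idx(2)] by simp
  have "norm ((1 / d) *\<^sub>R (center (S 2) - center (S 1))) = 1"
    using d_pos by (simp add: d_def dist_norm norm_minus_commute)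
  then obtain \<alpha> where "(1 / d) *\<^sub>R (center (S 2) - center (S 1)) = dir \<alpha>"
    using unit_vector_dir by blast
  then have "d *\<^sub>R ((1 / d) *\<^sub>R (center (S 2) - center (S 1))) = d *\<^sub>R dir \<alpha>"
    by simp
  then have axis: "center (S 2) - center (S 1) = d *\<^sub>R dir \<alpha>"
    using d_pos by simp
  have isolated: "\<exists>R'. radius (S k) < R' \<and>
      (\<forall>x. norm (x - center (S k)) \<le> R' \<longrightarrow> total_field n S x = bump_field (S k) x)" if "k \<in> {1..n}" for k
  proof (rule isolated_disc[of n S k])
    show "disc (S k) \<inter> disc (S m) = {}" if "m \<in> {1..n}" "m \<noteq> k" for m
      using disj[OF \<open>k \<in> {1..n}\<close> that(1)] that(2) by auto
  qed (use radii off that in auto)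
  obtain R1' R2' where R1': "radius (S 1) < R1'"
      "\<And>x. norm (x - center (S 1)) \<le> R1' \<Longrightarrow> total_field n S x = bump_field (S 1) x"
    and R2': "radius (S 2) < R2'"
      "\<And>x. norm (x - center (S 2)) \<le> R2' \<Longrightarrow> total_field n S x = bump_field (S 2) x"
    using isolated[OF idx(1)] isolated[OF idx(2)] by blast
  have eb: "energetic_bump (S k) (L k) E" if "k \<in> {1..n}" "0 < E" "E \<le> critical_energy n S" for k E
  proof
    have "critical_energy n S \<le> bump_critical_energy (S k)"
      unfolding critical_energy_def using that(1) by (intro Min_le) auto
    then show "E \<le> bump_critical_energy (S k)" using that(3) by simp
  qed (use lip off radii that in auto)
  let ?E0 = "critical_energy n S"
  \<comment> \<open>outer radii decrease with the energy, so this choice serves all energies below\<close>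
  define a0 where "a0 = min (outer_radius ?E0 (S 1)) (outer_radius ?E0 (S 2))"
  have "0 < outer_radius ?E0 (S k)" if "k \<in> {1..n}" for k
    using energetic_bump.outer_radius_greatest(1)[OF eb[OF that pos order_refl]]
    unfolding energetic_bump.a_def[OF eb[OF that pos order_refl]] .
  then have a0: "0 < a0"
    unfolding a0_def min_less_iff_conj using idx by blast
  have a0_le: "a0 \<le> outer_radius E (S 1)" "a0 \<le> outer_radius E (S 2)" if E: "0 < E" "E \<le> ?E0" for E
    using outer_radius_antimono[OF eb[OF idx(1) E] eb[OF idx(1) pos order_refl] E(2)]
      outer_radius_antimono[OF eb[OF idx(2) E] eb[OF idx(2) pos order_refl] E(2)]
    by (auto simp: a0_def)
  define pb where "pb = (\<lambda>R. 4 * R * (6 * pi + (2 * (1 / (2 * R) + 1 / a0) * R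
      + (1 / (2 * R) + 1 / a0) / a0 * R\<^sup>2 / 2)))"
  define Q where "Q = d + radius (S 1) + radius (S 2) + pb (radius (S 1)) + pb (radius (S 2))"
  have "0 \<le> pb R" if "0 < R" for R
    using that a0 by (simp add: pb_def)
  then have Q: "0 < Q"
    using d_pos radii[OF idx(1)] radii[OF idx(2)] by (simp add: Q_def add_pos_nonneg add_pos_pos)
  show ?thesis
  proof (intro exI[of _ "ln 2 * sqrt 2 / (2 * Q)"] conjI allI impI)
    show "0 < ln 2 * sqrt 2 / (2 * Q)" using Q by simp
    fix E assume E: "0 < E \<and> E \<le> critical_energy n S"
    have "ereal (ln 2 / (2 * (Q / sqrt (2 * E)))) \<le> flow_entropy (energy_surface E) \<Phi>"
      unfolding Q_def pb_def
      by (rule entropy_of_two_bumps[OF flow idx eb[OF idx(1)] eb[OF idx(2)] R1' R2' axis disj_d assms(4) a0 a0_le])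
        (use E in auto)
    moreover have "ln 2 * sqrt 2 / (2 * Q) * sqrt E = ln 2 / (2 * (Q / sqrt (2 * E)))"
      using E Q by (simp add: real_sqrt_mult)
    ultimately show "ereal (ln 2 * sqrt 2 / (2 * Q) * sqrt E) \<le> flow_entropy (energy_surface E) \<Phi>"
      by (simp only:)
  qed
qed

end
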